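(* Let $M(\phi,\xi,\eta,g_M)$ be a Sasakian manifold, $(N,g_N)$ a Riemannian manifold, and $F:M(\phi,\xi,\eta,g_M)\to(N,g_N)$ an anti-invariant Riemannian submersion such that $(\ker F_* )^\perp=\phi\ker F_*\oplus\{\xi\}$. Then $F$ is a totally geodesic map if and only if $$\mathcal{T}_W\phi V=0\quad\text{for all }W,V\in\Gamma(\ker F_* )$$ and $$\mathcal{A}_X\phi W=0\quad\text{for all }X\in\Gamma((\ker F_* )^\perp),\ W\in\Gamma(\ker F_* ).$$
   Context: A Sasakian manifold $M(\phi,\xi,\eta,g_M)$ is a smooth manifold with a $(1,1)$-tensor field $\phi$, a vector field $\xi$ (the characteristic vector field), a 1-form $\eta$ and a Riemannian metric $g_M$ such that $\phi^2=-I+\eta\otimes\xi$, $\phi\xi=0$, $\eta\circ\phi=0$, $\eta(\xi)=1$, $g_M(\phi X,\phi Y)=g_M(X,Y)-\eta(X)\eta(Y)$, $\eta(X)=g_M(X,\xi)$, and $(\nabla_X\phi)Y=g_M(X,Y)\xi-\eta(Y)X$, where $\nabla$ is the Levi-Civita connection of $g_M$ (so that $\nabla_X\xi=-\phi X$). A Riemannian submersion $F:(M,g_M)\to(N,g_N)$ is a smooth surjective map of maximal rank whose differential $F_*$ preserves lengths of horizontal vectors. Vertical means tangent to $\ker F_*$; horizontal means tangent to $(\ker F_* )^\perp$; $\mathcal V,\mathcal H$ are the corresponding orthogonal projections. $F$ is anti-invariant if $\phi(\ker F_* )\subseteq(\ker F_* )^\perp$. $\{\xi\}$ denotes the line distribution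 spanned by $\xi$, and $\oplus$ is an orthogonal direct sum. O'Neill's tensors are $\mathcal{T}_EG=\mathcal{H}\nabla_{\mathcal{V}E}\mathcal{V}G+\mathcal{V}\nabla_{\mathcal{V}E}\mathcal{H}G$ and $\mathcal{A}_EG=\mathcal{V}\nabla_{\mathcal{H}E}\mathcal{H}G+\mathcal{H}\nabla_{\mathcal{H}E}\mathcal{V}G$. The second fundamental form of $F$ is $(\nabla F_* )(X,Y)=\nabla^F_XF_*(Y)-F_*(\nabla_XY)$ with $\nabla^F$ the pullback connection; $F$ is totally geodesic if $\nabla F_*=0$. *)

theory Defs
  imports "HOL-Analysis.Analysis"
begin

text \<open>Only meaningful for open \<open>S\<close>, which is the only way it is used below.\<close>

primrec Ck_on :: "nat \<Rightarrow> 'e::real_normed_vector set \<Rightarrow> ('e \<Rightarrow> 'f::real_normed_vector) \<Rightarrow> bool" where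
  "Ck_on 0 S f \<longleftrightarrow> continuous_on S f"
| "Ck_on (Suc k) S f \<longleftrightarrow> (\<forall>x\<in>S. f differentiable (at x)) \<and>
     (\<forall>v. Ck_on k S (\<lambda>x. frechet_derivative f (at x) v))"

definition smooth_on :: "'e::real_normed_vector set \<Rightarrow> ('e \<Rightarrow> 'f::real_normed_vector) \<Rightarrow> bool" where
  "smooth_on S f \<longleftrightarrow> (\<forall>k. Ck_on k S f)"

text \<open>A chart is a pair of a domain and a coordinate map, which is only relevant on that domain.
  The model space is a Euclidean space \<open>'e\<close>, so the dimension of the manifold is \<open>DIM('e)\<close>.\<close>

type_synonym ('a, 'e) chart = "'a set \<times> ('a \<Rightarrow> 'e)"

definition chart_inv :: "('a, 'e) chart \<Rightarrow> 'e \<Rightarrow> 'a" where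
  "chart_inv ch = inv_into (fst ch) (snd ch)"

record ('a, 'e) manifold =
  mtop :: "'a topology"
  atlas :: "('a, 'e) chart set"

abbreviation points :: "('a, 'e) manifold \<Rightarrow> 'a set" where
  "points M \<equiv> topspace (mtop M)"

definition smooth_manifold :: "('a, 'e::euclidean_space) manifold \<Rightarrow> bool" where
  "smooth_manifold M \<longleftrightarrow>
     Hausdorff_space (mtop M) \<and> second_countable (mtop M) \<and>
     (\<Union>ch\<in>atlas M. fst ch) = points M \<and>
     (\<forall>(U, c)\<in>atlas M. openin (mtop M) U \<and> open (c ` U) \<and>
        homeomorphic_map (subtopology (mtop M) U) (top_of_set (c ` U)) c) \<and>
     (\<forall>(U, c)\<in>atlas M. \<forall>(V, d)\<in>atlas M. smooth_on (c ` (U \<inter> V)) (d \<circ> chart_inv (U, c)))"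

definition smooth_fun :: "('a, 'e::euclidean_space) manifold \<Rightarrow> ('a \<Rightarrow> real) \<Rightarrow> bool" where
  "smooth_fun M f \<longleftrightarrow> (\<forall>(U, c)\<in>atlas M. smooth_on (c ` U) (f \<circ> chart_inv (U, c)))"

definition smooth_map ::
  "('a, 'e::euclidean_space) manifold \<Rightarrow> ('b, 'f::euclidean_space) manifold \<Rightarrow> ('a \<Rightarrow> 'b) \<Rightarrow> bool" where
  "smooth_map M N F \<longleftrightarrow> continuous_map (mtop M) (mtop N) F \<and>
     (\<forall>(U, c)\<in>atlas M. \<forall>(V, d)\<in>atlas N.
        smooth_on (c ` (U \<inter> F -` V)) (d \<circ> F \<circ> chart_inv (U, c)))"

text \<open>A tangent vector at \<open>p\<close> is classically a class of pairs (chart around \<open>p\<close>, vector of \<open>'e\<close>)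
  modulo the Jacobians of the chart changes. Every class has exactly one representative in each
  chart around \<open>p\<close>; we choose once and for all a chart \<open>chart_at M p\<close> around \<open>p\<close> and represent
  the tangent space at \<open>p\<close> by \<open>'e\<close>, via the components with respect to that chart. As the
  chosen chart varies with \<open>p\<close> in an arbitrary way, smoothness of sections is always
  expressed through the components \<open>tcomp\<close> in a fixed chart.\<close>

definition chart_at :: "('a, 'e) manifold \<Rightarrow> 'a \<Rightarrow> ('a, 'e) chart" where
  "chart_at M p = (SOME ch. ch \<in> atlas M \<and> p \<in> fst ch)"

definition tcomp ::
  "('a, 'e::euclidean_space) manifold \<Rightarrow> ('a, 'e) chart \<Rightarrow> 'a \<Rightarrow> 'e \<Rightarrow> 'e" where
  "tcomp M ch p v =
     frechet_derivative (snd ch \<circ> chart_inv (chart_at M p)) (at (snd (chart_at M p) p)) v"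

text \<open>\<open>dfun M f p v\<close> is the derivative of the function \<open>f\<close> in the direction of the tangent
  vector \<open>v\<close> at \<open>p\<close>, and \<open>dmap M N F p\<close> is the differential of \<open>F\<close> at \<open>p\<close>.\<close>

definition dfun :: "('a, 'e::euclidean_space) manifold \<Rightarrow> ('a \<Rightarrow> real) \<Rightarrow> 'a \<Rightarrow> 'e \<Rightarrow> real" where
  "dfun M f p v = frechet_derivative (f \<circ> chart_inv (chart_at M p)) (at (snd (chart_at M p) p)) v"

definition dmap ::
  "('a, 'e::euclidean_space) manifold \<Rightarrow> ('b, 'f::euclidean_space) manifold \<Rightarrow>
    ('a \<Rightarrow> 'b) \<Rightarrow> 'a \<Rightarrow> 'e \<Rightarrow> 'f" where
  "dmap M N F p v =
     frechet_derivative (snd (chart_at N (F p)) \<circ> F \<circ> chart_inv (chart_at M p))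
       (at (snd (chart_at M p) p)) v"

text \<open>Smooth sections of the pullback bundle \<open>F\<^sup>*TN\<close>, i.e. smooth vector fields along \<open>F\<close>;
  vector fields on \<open>M\<close> are the case of the identity map.\<close>

definition section_along ::
  "('a, 'e::euclidean_space) manifold \<Rightarrow> ('b, 'f::euclidean_space) manifold \<Rightarrow>
    ('a \<Rightarrow> 'b) \<Rightarrow> ('a \<Rightarrow> 'f) \<Rightarrow> bool" where
  "section_along M N F s \<longleftrightarrow>
     (\<forall>(U, c)\<in>atlas M. \<forall>(V, d)\<in>atlas N.
        smooth_on (c ` (U \<inter> F -` V))
          ((\<lambda>p. tcomp N (V, d) (F p) (s p)) \<circ> chart_inv (U, c)))"

definition vector_field :: "('a, 'e::euclidean_space) manifold \<Rightarrow> ('a \<Rightarrow> 'e) \<Rightarrow> bool" where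
  "vector_field M X \<longleftrightarrow> section_along M M (\<lambda>p. p) X"

text \<open>The bracket at \<open>p\<close>, by its coordinate expression \<open>DY(X) - DX(Y)\<close> in the chart
  \<open>chart_at M p\<close>.\<close>

definition lie_bracket ::
  "('a, 'e::euclidean_space) manifold \<Rightarrow> ('a \<Rightarrow> 'e) \<Rightarrow> ('a \<Rightarrow> 'e) \<Rightarrow> 'a \<Rightarrow> 'e" where
  "lie_bracket M X Y p =
     (let ch = chart_at M p;
          loc = (\<lambda>Z. (\<lambda>q. tcomp M ch q (Z q)) \<circ> chart_inv ch)
      in frechet_derivative (loc Y) (at (snd ch p)) (X p)
         - frechet_derivative (loc X) (at (snd ch p)) (Y p))"

definition one_form :: "('a, 'e::euclidean_space) manifold \<Rightarrow> ('a \<Rightarrow> 'e \<Rightarrow> real) \<Rightarrow> bool" where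
  "one_form M \<omega> \<longleftrightarrow> (\<forall>p\<in>points M. linear (\<omega> p)) \<and>
     (\<forall>X. vector_field M X \<longrightarrow> smooth_fun M (\<lambda>p. \<omega> p (X p)))"

definition tensor_field_11 :: "('a, 'e::euclidean_space) manifold \<Rightarrow> ('a \<Rightarrow> 'e \<Rightarrow> 'e) \<Rightarrow> bool" where
  "tensor_field_11 M A \<longleftrightarrow> (\<forall>p\<in>points M. linear (A p)) \<and>
     (\<forall>X. vector_field M X \<longrightarrow> vector_field M (\<lambda>p. A p (X p)))"

definition riemannian_manifold ::
  "('a, 'e::euclidean_space) manifold \<Rightarrow> ('a \<Rightarrow> 'e \<Rightarrow> 'e \<Rightarrow> real) \<Rightarrow> bool" where
  "riemannian_manifold M g \<longleftrightarrow> smooth_manifold M \<and>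
     (\<forall>p\<in>points M. bilinear (g p) \<and> (\<forall>v w. g p v w = g p w v) \<and> (\<forall>v. v \<noteq> 0 \<longrightarrow> g p v v > 0)) \<and>
     (\<forall>X Y. vector_field M X \<and> vector_field M Y \<longrightarrow> smooth_fun M (\<lambda>p. g p (X p) (Y p)))"

text \<open>A connection on \<open>F\<^sup>*TN\<close>; \<open>D p v s\<close> is the covariant derivative at \<open>p\<close> of the section \<open>s\<close>
  in the direction of the tangent vector \<open>v\<close> at \<open>p\<close>. Hence the derivative of \<open>s\<close> along a
  vector field \<open>X\<close> is \<open>\<lambda>p. D p (X p) s\<close>, and tensoriality in \<open>X\<close> is built in. Homogeneity in
  \<open>s\<close> is the case of a constant \<open>f\<close> in the Leibniz rule.\<close>

definition connection_along ::
  "('a, 'e::euclidean_space) manifold \<Rightarrow> ('b, 'f::euclidean_space) manifold \<Rightarrow>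
    ('a \<Rightarrow> 'b) \<Rightarrow> ('a \<Rightarrow> 'e \<Rightarrow> ('a \<Rightarrow> 'f) \<Rightarrow> 'f) \<Rightarrow> bool" where
  "connection_along M N F D \<longleftrightarrow>
     (\<forall>X s. vector_field M X \<and> section_along M N F s \<longrightarrow>
        section_along M N F (\<lambda>p. D p (X p) s)) \<and>
     (\<forall>p\<in>points M. \<forall>s. section_along M N F s \<longrightarrow> linear (\<lambda>v. D p v s)) \<and>
     (\<forall>p\<in>points M. \<forall>v s t. section_along M N F s \<and> section_along M N F t \<longrightarrow>
        D p v (\<lambda>q. s q + t q) = D p v s + D p v t) \<and>
     (\<forall>p\<in>points M. \<forall>v f s. smooth_fun M f \<and> section_along M N F s \<longrightarrow>
        D p v (\<lambda>q. f q *\<^sub>R s q) = dfun M f p v *\<^sub>R s p + f p *\<^sub>R D p v s)"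

definition affine_connection ::
  "('a, 'e::euclidean_space) manifold \<Rightarrow> ('a \<Rightarrow> 'e \<Rightarrow> ('a \<Rightarrow> 'e) \<Rightarrow> 'e) \<Rightarrow> bool" where
  "affine_connection M nabla \<longleftrightarrow> connection_along M M (\<lambda>p. p) nabla"

definition levi_civita ::
  "('a, 'e::euclidean_space) manifold \<Rightarrow> ('a \<Rightarrow> 'e \<Rightarrow> 'e \<Rightarrow> real) \<Rightarrow>
    ('a \<Rightarrow> 'e \<Rightarrow> ('a \<Rightarrow> 'e) \<Rightarrow> 'e) \<Rightarrow> bool" where
  "levi_civita M g nabla \<longleftrightarrow> affine_connection M nabla \<and>
     (\<forall>X Y. vector_field M X \<and> vector_field M Y \<longrightarrow> (\<forall>p\<in>points M.
        nabla p (X p) Y - nabla p (Y p) X = lie_bracket M X Y p)) \<and>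
     (\<forall>Y Z. vector_field M Y \<and> vector_field M Z \<longrightarrow> (\<forall>p\<in>points M. \<forall>v.
        dfun M (\<lambda>q. g q (Y q) (Z q)) p v = g p (nabla p v Y) (Z p) + g p (Y p) (nabla p v Z)))"

text \<open>The pullback along \<open>F\<close> of a connection of \<open>N\<close>: the unique connection on \<open>F\<^sup>*TN\<close> whose value
  on sections of the form \<open>Z \<circ> F\<close> is prescribed as follows.\<close>

definition pullback_connection ::
  "('a, 'e::euclidean_space) manifold \<Rightarrow> ('b, 'f::euclidean_space) manifold \<Rightarrow> ('a \<Rightarrow> 'b) \<Rightarrow>
    ('b \<Rightarrow> 'f \<Rightarrow> ('b \<Rightarrow> 'f) \<Rightarrow> 'f) \<Rightarrow> ('a \<Rightarrow> 'e \<Rightarrow> ('a \<Rightarrow> 'f) \<Rightarrow> 'f) \<Rightarrow> bool" where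
  "pullback_connection M N F nablaN D \<longleftrightarrow> connection_along M N F D \<and>
     (\<forall>Z. vector_field N Z \<longrightarrow> (\<forall>p\<in>points M. \<forall>v.
        D p v (\<lambda>q. Z (F q)) = nablaN (F p) (dmap M N F p v) Z))"

definition second_fundamental_form ::
  "('a, 'e::euclidean_space) manifold \<Rightarrow> ('b, 'f::euclidean_space) manifold \<Rightarrow> ('a \<Rightarrow> 'b) \<Rightarrow>
    ('a \<Rightarrow> 'e \<Rightarrow> ('a \<Rightarrow> 'e) \<Rightarrow> 'e) \<Rightarrow> ('a \<Rightarrow> 'e \<Rightarrow> ('a \<Rightarrow> 'f) \<Rightarrow> 'f) \<Rightarrow>
    ('a \<Rightarrow> 'e) \<Rightarrow> ('a \<Rightarrow> 'e) \<Rightarrow> 'a \<Rightarrow> 'f" where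
  "second_fundamental_form M N F nabla D X Y p =
     D p (X p) (\<lambda>q. dmap M N F q (Y q)) - dmap M N F p (nabla p (X p) Y)"

definition totally_geodesic_map ::
  "('a, 'e::euclidean_space) manifold \<Rightarrow> ('b, 'f::euclidean_space) manifold \<Rightarrow> ('a \<Rightarrow> 'b) \<Rightarrow>
    ('a \<Rightarrow> 'e \<Rightarrow> ('a \<Rightarrow> 'e) \<Rightarrow> 'e) \<Rightarrow> ('a \<Rightarrow> 'e \<Rightarrow> ('a \<Rightarrow> 'f) \<Rightarrow> 'f) \<Rightarrow> bool" where
  "totally_geodesic_map M N F nabla D \<longleftrightarrow>
     (\<forall>X Y. vector_field M X \<and> vector_field M Y \<longrightarrow>
        (\<forall>p\<in>points M. second_fundamental_form M N F nabla D X Y p = 0))"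

definition sasakian_manifold ::
  "('a, 'e::euclidean_space) manifold \<Rightarrow> ('a \<Rightarrow> 'e \<Rightarrow> 'e) \<Rightarrow> ('a \<Rightarrow> 'e) \<Rightarrow> ('a \<Rightarrow> 'e \<Rightarrow> real) \<Rightarrow>
    ('a \<Rightarrow> 'e \<Rightarrow> 'e \<Rightarrow> real) \<Rightarrow> ('a \<Rightarrow> 'e \<Rightarrow> ('a \<Rightarrow> 'e) \<Rightarrow> 'e) \<Rightarrow> bool" where
  "sasakian_manifold M \<phi> \<xi> \<eta> g nabla \<longleftrightarrow>
     riemannian_manifold M g \<and> levi_civita M g nabla \<and>
     tensor_field_11 M \<phi> \<and> vector_field M \<xi> \<and> one_form M \<eta> \<and>
     (\<forall>p\<in>points M.
        (\<forall>v. \<phi> p (\<phi> p v) = - v + \<eta> p v *\<^sub>R \<xi> p) \<and>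
        \<phi> p (\<xi> p) = 0 \<and>
        (\<forall>v. \<eta> p (\<phi> p v) = 0) \<and>
        \<eta> p (\<xi> p) = 1 \<and>
        (\<forall>v w. g p (\<phi> p v) (\<phi> p w) = g p v w - \<eta> p v * \<eta> p w) \<and>
        (\<forall>v. \<eta> p v = g p v (\<xi> p))) \<and>
     (\<forall>X Y. vector_field M X \<and> vector_field M Y \<longrightarrow> (\<forall>p\<in>points M.
        nabla p (X p) (\<lambda>q. \<phi> q (Y q)) - \<phi> p (nabla p (X p) Y)
          = g p (X p) (Y p) *\<^sub>R \<xi> p - \<eta> p (Y p) *\<^sub>R X p))"

definition vertical_space ::
  "('a, 'e::euclidean_space) manifold \<Rightarrow> ('b, 'f::euclidean_space) manifold \<Rightarrow> ('a \<Rightarrow> 'b) \<Rightarrow>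
    'a \<Rightarrow> 'e set" where
  "vertical_space M N F p = {v. dmap M N F p v = 0}"

definition horizontal_space ::
  "('a, 'e::euclidean_space) manifold \<Rightarrow> ('b, 'f::euclidean_space) manifold \<Rightarrow> ('a \<Rightarrow> 'b) \<Rightarrow>
    ('a \<Rightarrow> 'e \<Rightarrow> 'e \<Rightarrow> real) \<Rightarrow> 'a \<Rightarrow> 'e set" where
  "horizontal_space M N F g p = {v. \<forall>w\<in>vertical_space M N F p. g p v w = 0}"

text \<open>Orthogonal projection onto \<open>S\<close> with respect to the inner product \<open>b\<close>.\<close>

definition orth_proj :: "('e::euclidean_space \<Rightarrow> 'e \<Rightarrow> real) \<Rightarrow> 'e set \<Rightarrow> 'e \<Rightarrow> 'e" where
  "orth_proj b S v = (THE w. w \<in> S \<and> (\<forall>u\<in>S. b (v - w) u = 0))"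

definition vproj ::
  "('a, 'e::euclidean_space) manifold \<Rightarrow> ('b, 'f::euclidean_space) manifold \<Rightarrow> ('a \<Rightarrow> 'b) \<Rightarrow>
    ('a \<Rightarrow> 'e \<Rightarrow> 'e \<Rightarrow> real) \<Rightarrow> 'a \<Rightarrow> 'e \<Rightarrow> 'e" where
  "vproj M N F g p = orth_proj (g p) (vertical_space M N F p)"

definition hproj ::
  "('a, 'e::euclidean_space) manifold \<Rightarrow> ('b, 'f::euclidean_space) manifold \<Rightarrow> ('a \<Rightarrow> 'b) \<Rightarrow>
    ('a \<Rightarrow> 'e \<Rightarrow> 'e \<Rightarrow> real) \<Rightarrow> 'a \<Rightarrow> 'e \<Rightarrow> 'e" where
  "hproj M N F g p = orth_proj (g p) (horizontal_space M N F g p)"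

definition vertical_field ::
  "('a, 'e::euclidean_space) manifold \<Rightarrow> ('b, 'f::euclidean_space) manifold \<Rightarrow> ('a \<Rightarrow> 'b) \<Rightarrow>
    ('a \<Rightarrow> 'e) \<Rightarrow> bool" where
  "vertical_field M N F X \<longleftrightarrow>
     vector_field M X \<and> (\<forall>p\<in>points M. X p \<in> vertical_space M N F p)"

definition horizontal_field ::
  "('a, 'e::euclidean_space) manifold \<Rightarrow> ('b, 'f::euclidean_space) manifold \<Rightarrow> ('a \<Rightarrow> 'b) \<Rightarrow>
    ('a \<Rightarrow> 'e \<Rightarrow> 'e \<Rightarrow> real) \<Rightarrow> ('a \<Rightarrow> 'e) \<Rightarrow> bool" where
  "horizontal_field M N F g X \<longleftrightarrow>
     vector_field M X \<and> (\<forall>p\<in>points M. X p \<in> horizontal_space M N F g p)"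

definition riemannian_submersion ::
  "('a, 'e::euclidean_space) manifold \<Rightarrow> ('a \<Rightarrow> 'e \<Rightarrow> 'e \<Rightarrow> real) \<Rightarrow>
    ('b, 'f::euclidean_space) manifold \<Rightarrow> ('b \<Rightarrow> 'f \<Rightarrow> 'f \<Rightarrow> real) \<Rightarrow> ('a \<Rightarrow> 'b) \<Rightarrow> bool" where
  "riemannian_submersion M gM N gN F \<longleftrightarrow>
     smooth_map M N F \<and> F ` points M = points N \<and>
     (\<forall>p\<in>points M. surj (dmap M N F p)) \<and>
     (\<forall>p\<in>points M. \<forall>v\<in>horizontal_space M N F gM p.
        sqrt (gN (F p) (dmap M N F p v) (dmap M N F p v)) = sqrt (gM p v v))"

definition anti_invariant ::
  "('a, 'e::euclidean_space) manifold \<Rightarrow> ('a \<Rightarrow> 'e \<Rightarrow> 'e) \<Rightarrow> ('a \<Rightarrow> 'e \<Rightarrow> 'e \<Rightarrow> real) \<Rightarrow>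
    ('b, 'f::euclidean_space) manifold \<Rightarrow> ('a \<Rightarrow> 'b) \<Rightarrow> bool" where
  "anti_invariant M \<phi> g N F \<longleftrightarrow>
     (\<forall>p\<in>points M. \<phi> p ` vertical_space M N F p \<subseteq> horizontal_space M N F g p)"

text \<open>\<open>S\<close> is the direct sum of \<open>A\<close> and \<open>B\<close>, orthogonal for the inner product \<open>b\<close>; directness
  follows from orthogonality and positive definiteness.\<close>

definition orth_direct_sum ::
  "('e::euclidean_space \<Rightarrow> 'e \<Rightarrow> real) \<Rightarrow> 'e set \<Rightarrow> 'e set \<Rightarrow> 'e set \<Rightarrow> bool" where
  "orth_direct_sum b S A B \<longleftrightarrow>
     S = {x + y | x y. x \<in> A \<and> y \<in> B} \<and> (\<forall>x\<in>A. \<forall>y\<in>B. b x y = 0)"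

definition oneill_T ::
  "('a, 'e::euclidean_space) manifold \<Rightarrow> ('b, 'f::euclidean_space) manifold \<Rightarrow> ('a \<Rightarrow> 'b) \<Rightarrow>
    ('a \<Rightarrow> 'e \<Rightarrow> 'e \<Rightarrow> real) \<Rightarrow> ('a \<Rightarrow> 'e \<Rightarrow> ('a \<Rightarrow> 'e) \<Rightarrow> 'e) \<Rightarrow>
    ('a \<Rightarrow> 'e) \<Rightarrow> ('a \<Rightarrow> 'e) \<Rightarrow> 'a \<Rightarrow> 'e" where
  "oneill_T M N F g nabla E G p =
     (let V = vproj M N F g; H = hproj M N F g in
        H p (nabla p (V p (E p)) (\<lambda>q. V q (G q))) + V p (nabla p (V p (E p)) (\<lambda>q. H q (G q))))"

definition oneill_A ::
  "('a, 'e::euclidean_space) manifold \<Rightarrow> ('b, 'f::euclidean_space) manifold \<Rightarrow> ('a \<Rightarrow> 'b) \<Rightarrow>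
    ('a \<Rightarrow> 'e \<Rightarrow> 'e \<Rightarrow> real) \<Rightarrow> ('a \<Rightarrow> 'e \<Rightarrow> ('a \<Rightarrow> 'e) \<Rightarrow> 'e) \<Rightarrow>
    ('a \<Rightarrow> 'e) \<Rightarrow> ('a \<Rightarrow> 'e) \<Rightarrow> 'a \<Rightarrow> 'e" where
  "oneill_A M N F g nabla E G p =
     (let V = vproj M N F g; H = hproj M N F g in
        V p (nabla p (H p (E p)) (\<lambda>q. H q (G q))) + H p (nabla p (H p (E p)) (\<lambda>q. V q (G q))))"

end

theory Submission
  imports Defs
begin

text \<open>The field \<open>\<xi>\<close> is horizontal, and the Sasakian structure prescribes its covariant derivative:
  \<open>\<nabla>\<^sub>Y \<xi> = -\<phi>Y\<close>, where \<open>\<phi>\<close> is an isometry from vertical to horizontal vectors. A nonzero vertical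
  field is incompatible with either side of the equivalence because of this derivative, and so both sides hold
  exactly when \<open>F\<close> has no nonzero vertical vectors.

  Let \<open>W\<close> be a vertical field, so that \<open>\<phi>W\<close> is horizontal and \<open>\<nabla>\<^bsub>\<phi>W\<^esub> \<xi> = -\<phi>\<phi>W = W\<close>. Differentiating
  \<open>g(W, \<xi>) = 0\<close> along \<open>\<phi>W\<close> gives \<open>g(\<nabla>\<^bsub>\<phi>W\<^esub> W, \<xi>) = -g(W, W)\<close>. If \<open>F\<close> is totally geodesic, then
  \<open>F\<^sub>*(\<nabla>\<^bsub>\<phi>W\<^esub> W) = 0\<close> because \<open>F\<^sub>*W = 0\<close>; thus \<open>\<nabla>\<^bsub>\<phi>W\<^esub> W\<close> is vertical, hence orthogonal to \<open>\<xi>\<close>, and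
  \<open>W = 0\<close>. The two O'Neill conditions, which only speak about \<open>\<phi>V\<close> and \<open>\<phi>W\<close> for vertical \<open>V\<close> and
  \<open>W\<close>, are then satisfied.

  Conversely, \<open>\<A>\<^sub>\<xi> \<phi>W = 0\<close> says that \<open>\<nabla>\<^sub>\<xi> \<phi>W\<close> is horizontal. Since \<open>F\<close> is
  isometric on horizontal vectors, \<open>g\<^sub>N(F\<^sub>*\<xi>, F\<^sub>*\<phi>W) = g(\<xi>, \<phi>W) = 0\<close> on \<open>M\<close>. The pullback connection \<open>D\<close> is
  metric, and \<open>D\<^sub>W F\<^sub>*X = F\<^sub>*[W, X]\<close> for vertical \<open>W\<close>, so differentiating along \<open>W\<close> gives
  \<open>0 = g([W, \<xi>], \<phi>W) + g(\<xi>, [W, \<phi>W])\<close>. The right-hand side equals \<open>-g(W, W) + 2 g(W, W)\<close>, hence \<open>W = 0\<close>.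
  As every vertical vector extends to a vertical field, there are no nonzero vertical vectors. Now
  the tangent spaces of \<open>M\<close> are horizontal and, by the given decomposition, spanned by \<open>\<xi>\<close>. The field
  \<open>\<xi>\<close> is parallel since \<open>\<phi>\<xi> = 0\<close>. The unit field \<open>F\<^sub>*\<xi>\<close> along \<open>F\<close> is parallel too, because its derivative is
  orthogonal to it and at the same time a multiple of it. Hence \<open>F\<close> is totally geodesic.

  Two analytic facts carry the second half. Vertical vectors extend to vertical fields
  (\<open>vertical_extension\<close>), which rests on solving linear equations with smooth coefficients and on
  smooth plateau functions. The pullback connection is metric and torsion free in the
  form used above (\<open>pullback_metric\<close>, \<open>pullback_torsion_vertical\<close>); both are obtained by expanding a
  section along \<open>F\<close> in a local frame of \<open>N\<close>, and the latter also needs the symmetry of second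
  derivatives.\<close>

section \<open>Smooth maps between Euclidean spaces\<close>

lemma Ck_on_cong:
  assumes "open S" "Ck_on k S f" "\<And>x. x \<in> S \<Longrightarrow> f x = g x"
  shows "Ck_on k S g"
  using assms(2,3)
proof (induction k arbitrary: f g)
  case 0
  then show ?case by (simp cong: continuous_on_cong)
next
  case (Suc k)
  have D: "(g has_derivative frechet_derivative f (at x)) (at x)" if "x \<in> S" for x
    using Suc.prems that assms(1)
    by (auto simp: frechet_derivative_works intro: has_derivative_transform_within_open[where s=S])
  have "frechet_derivative g (at x) = frechet_derivative f (at x)" if "x \<in> S" for x
    using frechet_derivative_at[OF D[OF that]] by simp
  then have "Ck_on k S (\<lambda>x. frechet_derivative g (at x) v)" for v
    using Suc.prems(1) by - (rule Suc.IH[of "\<lambda>x. frechet_derivative f (at x) v"], auto)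
  moreover have "\<forall>x\<in>S. g differentiable (at x)"
    using D by (blast intro: differentiableI)
  ultimately show ?case by simp
qed

lemma Ck_on_subset: "Ck_on k S f \<Longrightarrow> T \<subseteq> S \<Longrightarrow> Ck_on k T f"
  by (induction k arbitrary: f) (auto intro: continuous_on_subset)

text \<open>Every smooth object on a manifold is glued from pieces that live in different charts; this is
  the gluing step in coordinates.\<close>

lemma Ck_on_local:
  assumes "\<And>x. x \<in> S \<Longrightarrow> \<exists>T. open T \<and> x \<in> T \<and> Ck_on k T f"
  shows "Ck_on k S f"
  using assms
proof (induction k arbitrary: f)
  case 0
  have "isCont f x" if "x \<in> S" for x
    using 0[OF that] by (auto simp: continuous_on_eq_continuous_at)
  then show ?case by (simp add: continuous_at_imp_continuous_on)
next
  case (Suc k)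
  from Suc.prems have "f differentiable (at x)" if "x \<in> S" for x
    using that by fastforce
  moreover have "Ck_on k S (\<lambda>x. frechet_derivative f (at x) v)" for v
    by (rule Suc.IH) (use Suc.prems in fastforce)
  ultimately show ?case by simp
qed

lemma Ck_on_Suc_imp: "Ck_on (Suc k) S f \<Longrightarrow> Ck_on k S f"
proof (induction k arbitrary: f)
  case 0
  then show ?case
    by (auto intro!: continuous_at_imp_continuous_on differentiable_imp_continuous_within)
next
  case (Suc k)
  have "Ck_on k S (\<lambda>x. frechet_derivative f (at x) v)" for v
    using Suc.prems by (intro Suc.IH) (simp del: Ck_on.simps add: Ck_on.simps(2)[of "Suc k" S f])
  then show ?case using Suc.prems by simp
qed

lemma Ck_on_const: "Ck_on k S (\<lambda>x. c)"
  by (induction k arbitrary: c) (auto simp: continuous_on_const)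

text \<open>The way to increase the order of differentiability in all closure properties: exhibit some
  derivative, without mentioning \<^const>\<open>frechet_derivative\<close>.\<close>

lemma Ck_on_SucI:
  assumes "open S" "\<And>x. x \<in> S \<Longrightarrow> (f has_derivative f' x) (at x)" "\<And>v. Ck_on k S (\<lambda>x. f' x v)"
  shows "Ck_on (Suc k) S f"
proof -
  have "f' x v = frechet_derivative f (at x) v" if "x \<in> S" for x v
    using frechet_derivative_at[OF assms(2)[OF that]] by simp
  then have "Ck_on k S (\<lambda>x. frechet_derivative f (at x) v)" for v
    by (rule Ck_on_cong[OF assms(1) assms(3)[of v]])
  with assms(2) show ?thesis
    by (auto simp: differentiable_def)
qed

lemma Ck_on_SucD:
  assumes "Ck_on (Suc k) S f" "x \<in> S"
  shows "(f has_derivative frechet_derivative f (at x)) (at x)"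
  using assms by (simp add: frechet_derivative_works)

lemma Ck_on_linear:
  assumes "open S" "bounded_linear L" "Ck_on k S f"
  shows "Ck_on k S (\<lambda>x. L (f x))"
  using assms(3)
proof (induction k arbitrary: f)
  case 0
  then show ?case by (simp add: bounded_linear.continuous_on[OF assms(2)])
next
  case (Suc k)
  show ?case
    by (rule Ck_on_SucI[OF assms(1), where f' = "\<lambda>x v. L (frechet_derivative f (at x) v)"])
      (use Suc in \<open>auto intro!: bounded_linear.has_derivative[OF assms(2)] Ck_on_SucD[OF Suc.prems]\<close>)
qed

lemma Ck_on_id: "open S \<Longrightarrow> Ck_on k S (\<lambda>x. x)"
proof (cases k)
  case (Suc n)
  assume "open S"
  then show ?thesis unfolding Suc
    by (rule Ck_on_SucI[where f' = "\<lambda>x v. v"]) (auto intro: Ck_on_const)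
qed simp

lemma Ck_on_add:
  assumes "open S" "Ck_on k S f" "Ck_on k S g"
  shows "Ck_on k S (\<lambda>x. f x + g x)"
  using assms(2,3)
proof (induction k arbitrary: f g)
  case 0
  then show ?case by (simp add: continuous_on_add)
next
  case (Suc k)
  show ?case
    by (rule Ck_on_SucI[OF assms(1), where f' = "\<lambda>x v. frechet_derivative f (at x) v + frechet_derivative g (at x) v"])
      (use Suc in \<open>auto intro!: has_derivative_add Ck_on_SucD[OF Suc.prems(1)] Ck_on_SucD[OF Suc.prems(2)]\<close>)
qed

lemma Ck_on_sum:
  assumes "open S" "\<And>i. i \<in> I \<Longrightarrow> Ck_on k S (f i)"
  shows "Ck_on k S (\<lambda>x. \<Sum>i\<in>I. f i x)"
  using assms(2)
  by (induction I rule: infinite_finite_induct) (auto intro: Ck_on_const Ck_on_add[OF assms(1)])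

lemma (in bounded_bilinear) Ck_on_bilinear:
  assumes "open S" "Ck_on k S f" "Ck_on k S g"
  shows "Ck_on k S (\<lambda>x. prod (f x) (g x))"
  using assms(2,3)
proof (induction k arbitrary: f g)
  case 0
  then show ?case by (simp add: continuous_on)
next
  case (Suc k)
  note lower = Ck_on_Suc_imp[OF Suc.prems(1)] Ck_on_Suc_imp[OF Suc.prems(2)]
  show ?case
  proof (rule Ck_on_SucI[OF assms(1)])
    show "((\<lambda>x. prod (f x) (g x)) has_derivative
        (\<lambda>v. prod (f x) (frechet_derivative g (at x) v) + prod (frechet_derivative f (at x) v) (g x))) (at x)"
      if "x \<in> S" for x
      by (rule FDERIV) (use Ck_on_SucD[OF Suc.prems(1)] Ck_on_SucD[OF Suc.prems(2)] that in auto)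
  qed (use Suc lower in \<open>auto intro!: Ck_on_add[OF assms(1)]\<close>)
qed

lemma Ck_on_inverse:
  fixes f :: "'e::real_normed_vector \<Rightarrow> real"
  assumes "open S" "Ck_on k S f" "\<And>x. x \<in> S \<Longrightarrow> f x \<noteq> 0"
  shows "Ck_on k S (\<lambda>x. inverse (f x))"
  using assms(2)
proof (induction k)
  case 0
  then show ?case using assms(3) by (simp add: continuous_on_inverse)
next
  case (Suc k)
  have "Ck_on k S (\<lambda>x. inverse (f x))"
    using Suc Ck_on_Suc_imp by blast
  moreover have "((\<lambda>x. inverse (f x)) has_derivative
        (\<lambda>v. - (inverse (f x) * frechet_derivative f (at x) v * inverse (f x)))) (at x)" if "x \<in> S" for x
    by (rule Deriv.has_derivative_inverse[OF assms(3)[OF that] Ck_on_SucD[OF Suc.prems that]])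
  ultimately show ?case
    using Suc.prems
    by (intro Ck_on_SucI[OF assms(1),
          where f' = "\<lambda>x v. - (inverse (f x) * frechet_derivative f (at x) v * inverse (f x))"])
      (auto intro!: Ck_on_linear[OF assms(1) bounded_linear_minus[OF bounded_linear_ident]]
         bounded_bilinear.Ck_on_bilinear[OF bounded_bilinear_mult assms(1)])
qed

lemma linear_Basis_expand:
  fixes f :: "'e::euclidean_space \<Rightarrow> 'f::real_vector"
  assumes "linear f"
  shows "f v = (\<Sum>b\<in>Basis. (v \<bullet> b) *\<^sub>R f b)"
proof -
  have "f v = f (\<Sum>b\<in>Basis. (v \<bullet> b) *\<^sub>R b)"
    by (simp add: euclidean_representation)
  then show ?thesis
    by (simp add: linear_sum[OF assms] linear_scale[OF assms])
qed

text \<open>In the chain rule the direction of the outer derivative varies with the point, whereas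
  \<^const>\<open>Ck_on\<close> controls derivatives in a fixed direction only. Expanding the direction in the basis
  reduces one to the other.\<close>

lemma Ck_on_compose:
  fixes f :: "'e::real_normed_vector \<Rightarrow> 'f::euclidean_space" and g :: "'f \<Rightarrow> 'g::real_normed_vector"
  assumes "open S" "open T" "Ck_on k T g" "Ck_on k S f" "f ` S \<subseteq> T"
  shows "Ck_on k S (\<lambda>x. g (f x))"
  using assms(3,4)
proof (induction k arbitrary: g)
  case 0
  then show ?case using assms(5)
    by (auto intro: continuous_on_compose2)
next
  case (Suc k)
  show ?case
  proof (rule Ck_on_SucI[OF assms(1)])
    fix x assume x: "x \<in> S"
    have f: "(f has_derivative frechet_derivative f (at x)) (at x)"
      using Ck_on_SucD[OF Suc.prems(2) x] .
    have g: "(g has_derivative frechet_derivative g (at (f x))) (at (f x))"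
      using Ck_on_SucD[OF Suc.prems(1)] x assms(5) by blast
    have "linear (frechet_derivative g (at (f x)))"
      using g has_derivative_linear by blast
    then have "(\<lambda>v. frechet_derivative g (at (f x)) (frechet_derivative f (at x) v)) =
        (\<lambda>v. \<Sum>b\<in>Basis. (frechet_derivative f (at x) v \<bullet> b) *\<^sub>R frechet_derivative g (at (f x)) b)"
      by (intro ext linear_Basis_expand)
    with has_derivative_compose[OF f g]
    show "((\<lambda>x. g (f x)) has_derivative (\<lambda>v. \<Sum>b\<in>Basis.
        (frechet_derivative f (at x) v \<bullet> b) *\<^sub>R frechet_derivative g (at (f x)) b)) (at x)"
      by (simp only:)
  next
    fix v
    show "Ck_on k S (\<lambda>x. \<Sum>b\<in>Basis.
        (frechet_derivative f (at x) v \<bullet> b) *\<^sub>R frechet_derivative g (at (f x)) b)"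
    proof (intro Ck_on_sum[OF assms(1)] bounded_bilinear.Ck_on_bilinear[OF bounded_bilinear_scaleR assms(1)])
      fix b :: 'f
      show "Ck_on k S (\<lambda>x. frechet_derivative f (at x) v \<bullet> b)"
        using Suc.prems(2) by (intro Ck_on_linear[OF assms(1) bounded_linear_inner_left]) simp
      show "Ck_on k S (\<lambda>x. frechet_derivative g (at (f x)) b)"
        using Suc.prems Ck_on_Suc_imp by (intro Suc.IH) auto
    qed
  qed
qed

lemma smooth_on_cong:
  "open S \<Longrightarrow> smooth_on S f \<Longrightarrow> (\<And>x. x \<in> S \<Longrightarrow> f x = g x) \<Longrightarrow> smooth_on S g"
  unfolding smooth_on_def by (blast intro: Ck_on_cong)

lemma smooth_on_subset: "smooth_on S f \<Longrightarrow> T \<subseteq> S \<Longrightarrow> smooth_on T f"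
  unfolding smooth_on_def by (blast intro: Ck_on_subset)

lemma smooth_on_local:
  "(\<And>x. x \<in> S \<Longrightarrow> \<exists>T. open T \<and> x \<in> T \<and> smooth_on T f) \<Longrightarrow> smooth_on S f"
  unfolding smooth_on_def by (intro allI Ck_on_local) meson

lemma smooth_on_const: "smooth_on S (\<lambda>x. c)"
  unfolding smooth_on_def by (intro allI Ck_on_const)

lemma smooth_on_id: "open S \<Longrightarrow> smooth_on S (\<lambda>x. x)"
  unfolding smooth_on_def by (rule allI, rule Ck_on_id) auto

lemma smooth_on_linear:
  "open S \<Longrightarrow> bounded_linear L \<Longrightarrow> smooth_on S f \<Longrightarrow> smooth_on S (\<lambda>x. L (f x))"
  unfolding smooth_on_def by (rule allI, rule Ck_on_linear) auto

lemma smooth_on_add: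
  "open S \<Longrightarrow> smooth_on S f \<Longrightarrow> smooth_on S g \<Longrightarrow> smooth_on S (\<lambda>x. f x + g x)"
  unfolding smooth_on_def by (rule allI, rule Ck_on_add) auto

lemma smooth_on_sum:
  "open S \<Longrightarrow> (\<And>i. i \<in> I \<Longrightarrow> smooth_on S (f i)) \<Longrightarrow> smooth_on S (\<lambda>x. \<Sum>i\<in>I. f i x)"
  unfolding smooth_on_def by (rule allI, rule Ck_on_sum) auto

lemma smooth_on_scaleR:
  "open S \<Longrightarrow> smooth_on S f \<Longrightarrow> smooth_on S g \<Longrightarrow> smooth_on S (\<lambda>x. f x *\<^sub>R g x)"
  unfolding smooth_on_def by (rule allI, rule bounded_bilinear.Ck_on_bilinear[OF bounded_bilinear_scaleR]) auto

lemma smooth_on_mult: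
  fixes f g :: "'e::real_normed_vector \<Rightarrow> real"
  shows "open S \<Longrightarrow> smooth_on S f \<Longrightarrow> smooth_on S g \<Longrightarrow> smooth_on S (\<lambda>x. f x * g x)"
  unfolding smooth_on_def by (rule allI, rule bounded_bilinear.Ck_on_bilinear[OF bounded_bilinear_mult]) auto

lemma smooth_on_inner:
  "open S \<Longrightarrow> smooth_on S f \<Longrightarrow> smooth_on S g \<Longrightarrow> smooth_on S (\<lambda>x. f x \<bullet> g x)"
  unfolding smooth_on_def by (rule allI, rule bounded_bilinear.Ck_on_bilinear[OF bounded_bilinear_inner]) auto

lemma smooth_on_diff:
  "open S \<Longrightarrow> smooth_on S f \<Longrightarrow> smooth_on S g \<Longrightarrow> smooth_on S (\<lambda>x. f x - g x)"
  using smooth_on_add[of S f "\<lambda>x. (-1) *\<^sub>R g x"] smooth_on_scaleR[of S "\<lambda>_. -1" g] smooth_on_const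
  by force

lemma smooth_on_inverse:
  fixes f :: "'e::real_normed_vector \<Rightarrow> real"
  shows "open S \<Longrightarrow> smooth_on S f \<Longrightarrow> (\<And>x. x \<in> S \<Longrightarrow> f x \<noteq> 0) \<Longrightarrow> smooth_on S (\<lambda>x. inverse (f x))"
  unfolding smooth_on_def by (rule allI, rule Ck_on_inverse) auto

lemma smooth_on_compose:
  fixes f :: "'e::real_normed_vector \<Rightarrow> 'f::euclidean_space" and g :: "'f \<Rightarrow> 'g::real_normed_vector"
  assumes "open S" "open T" "smooth_on T g" "smooth_on S f" "f ` S \<subseteq> T"
  shows "smooth_on S (\<lambda>x. g (f x))"
  unfolding smooth_on_def by (rule allI, rule Ck_on_compose[OF assms(1,2)]) (use assms in \<open>auto simp: smooth_on_def\<close>)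

lemma smooth_on_deriv: "smooth_on S f \<Longrightarrow> smooth_on S (\<lambda>x. frechet_derivative f (at x) v)"
  unfolding smooth_on_def by (metis Ck_on.simps(2))

lemma smooth_on_has_derivative:
  "smooth_on S f \<Longrightarrow> x \<in> S \<Longrightarrow> (f has_derivative frechet_derivative f (at x)) (at x)"
  unfolding smooth_on_def using Ck_on_SucD[of 0] by blast

lemma smooth_on_continuous_on: "smooth_on S f \<Longrightarrow> continuous_on S f"
  unfolding smooth_on_def by (metis Ck_on.simps(1))

lemma smooth_on_linear_deriv: "smooth_on S f \<Longrightarrow> x \<in> S \<Longrightarrow> linear (frechet_derivative f (at x))"
  using smooth_on_has_derivative has_derivative_linear by blast

lemma smooth_on_differentiable: "smooth_on S f \<Longrightarrow> x \<in> S \<Longrightarrow> f differentiable (at x)"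
  using smooth_on_has_derivative by (rule differentiableI)

text \<open>The shape that a change of charts takes on tangent vectors and on sections along a map: a
  derivative at a moving point applied to a moving vector.\<close>

lemma smooth_on_deriv_at_along:
  fixes g :: "'f::euclidean_space \<Rightarrow> 'g::real_normed_vector" and y w :: "'e::real_normed_vector \<Rightarrow> 'f"
  assumes "open S" "open T" "smooth_on T g" "smooth_on S y" "y ` S \<subseteq> T" "smooth_on S w"
  shows "smooth_on S (\<lambda>x. frechet_derivative g (at (y x)) (w x))"
proof -
  have sm: "smooth_on S (\<lambda>x. \<Sum>b\<in>Basis. (w x \<bullet> b) *\<^sub>R frechet_derivative g (at (y x)) b)"
    by (intro smooth_on_sum smooth_on_scaleR smooth_on_inner smooth_on_const
        smooth_on_compose[OF assms(1,2) smooth_on_deriv[OF assms(3)] assms(4,5)] assms(1,6))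
  show ?thesis
  proof (rule smooth_on_cong[OF assms(1) sm])
    fix x assume "x \<in> S"
    then have "linear (frechet_derivative g (at (y x)))"
      using assms(3,5) smooth_on_linear_deriv by blast
    then show "(\<Sum>b\<in>Basis. (w x \<bullet> b) *\<^sub>R frechet_derivative g (at (y x)) b) = frechet_derivative g (at (y x)) (w x)"
      by (rule linear_Basis_expand[symmetric])
  qed
qed

lemma smooth_on_deriv_along:
  fixes f :: "'e::euclidean_space \<Rightarrow> 'f::real_normed_vector"
  assumes "open S" "smooth_on S f" "smooth_on S w"
  shows "smooth_on S (\<lambda>x. frechet_derivative f (at x) (w x))"
  using smooth_on_deriv_at_along[OF assms(1) assms(1,2) smooth_on_id[OF assms(1)] _ assms(3)] by simp

lemma frechet_derivative_chain:
  assumes "open S" "x \<in> S" "f differentiable (at x)" "g differentiable (at (f x))"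
    and "\<And>y. y \<in> S \<Longrightarrow> h y = g (f y)"
  shows "frechet_derivative h (at x) v = frechet_derivative g (at (f x)) (frechet_derivative f (at x) v)"
proof -
  have "((\<lambda>y. g (f y)) has_derivative
      (\<lambda>v. frechet_derivative g (at (f x)) (frechet_derivative f (at x) v))) (at x)"
    using has_derivative_compose assms(3,4) unfolding frechet_derivative_works by blast
  then have "(h has_derivative
      (\<lambda>v. frechet_derivative g (at (f x)) (frechet_derivative f (at x) v))) (at x)"
    by (rule has_derivative_transform_within_open[OF _ assms(1,2)]) (simp add: assms(5))
  from frechet_derivative_at[OF this] show ?thesis by metis
qed

section \<open>Symmetry of the second derivative\<close>

lemma smooth_on_has_real_derivative_line:
  fixes f :: "'e::real_normed_vector \<Rightarrow> real"
  assumes "smooth_on S f" "y + s *\<^sub>R u \<in> S"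
  shows "((\<lambda>s. f (y + s *\<^sub>R u)) has_real_derivative frechet_derivative f (at (y + s *\<^sub>R u)) u) (at s)"
proof -
  have line: "((\<lambda>s. y + s *\<^sub>R u) has_derivative (\<lambda>h. h *\<^sub>R u)) (at s)"
    by (auto intro!: derivative_eq_intros)
  have "((\<lambda>s. f (y + s *\<^sub>R u)) has_derivative (\<lambda>h. frechet_derivative f (at (y + s *\<^sub>R u)) (h *\<^sub>R u))) (at s)"
    using has_derivative_compose[OF line smooth_on_has_derivative[OF assms]] .
  moreover have "frechet_derivative f (at (y + s *\<^sub>R u)) (h *\<^sub>R u) = frechet_derivative f (at (y + s *\<^sub>R u)) u * h" for h
    using linear_scale[OF smooth_on_linear_deriv[OF assms]] by simp
  ultimately show ?thesis
    by (simp add: has_field_derivative_def)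
qed

text \<open>The mean value theorem is applied first in the direction \<open>u\<close>, to the difference of \<open>f\<close> along two
  parallel segments, and then in the direction \<open>v\<close>, to the derivative of \<open>f\<close> along \<open>u\<close>.\<close>

lemma second_difference_mean_value:
  fixes f :: "'e::real_normed_vector \<Rightarrow> real"
  assumes f: "smooth_on S f" and "t > 0"
    and S: "\<And>a b. 0 \<le> a \<Longrightarrow> a \<le> t \<Longrightarrow> 0 \<le> b \<Longrightarrow> b \<le> t \<Longrightarrow> x + a *\<^sub>R u + b *\<^sub>R v \<in> S"
  shows "\<exists>a b. 0 < a \<and> a < t \<and> 0 < b \<and> b < t \<and>
    f (x + t *\<^sub>R u + t *\<^sub>R v) - f (x + t *\<^sub>R u) - f (x + t *\<^sub>R v) + f x
      = t * t * frechet_derivative (\<lambda>y. frechet_derivative f (at y) u) (at (x + a *\<^sub>R u + b *\<^sub>R v)) v"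
proof -
  have "((\<lambda>s. f ((x + t *\<^sub>R v) + s *\<^sub>R u) - f (x + s *\<^sub>R u)) has_real_derivative
      frechet_derivative f (at ((x + t *\<^sub>R v) + s *\<^sub>R u)) u - frechet_derivative f (at (x + s *\<^sub>R u)) u) (at s)"
    if "0 \<le> s" "s \<le> t" for s
    using S[of s t] S[of s 0] that \<open>t > 0\<close>
    by (intro DERIV_diff smooth_on_has_real_derivative_line[OF f]) (auto simp: algebra_simps)
  from MVT2[OF \<open>t > 0\<close> this] obtain a where a: "0 < a" "a < t"
    and ea: "f (x + t *\<^sub>R v + t *\<^sub>R u) - f (x + t *\<^sub>R u) - (f (x + t *\<^sub>R v) - f x)
      = t * (frechet_derivative f (at (x + t *\<^sub>R v + a *\<^sub>R u)) u - frechet_derivative f (at (x + a *\<^sub>R u)) u)"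
    by auto
  have "((\<lambda>s. frechet_derivative f (at ((x + a *\<^sub>R u) + s *\<^sub>R v)) u) has_real_derivative
      frechet_derivative (\<lambda>y. frechet_derivative f (at y) u) (at ((x + a *\<^sub>R u) + s *\<^sub>R v)) v) (at s)"
    if "0 \<le> s" "s \<le> t" for s
    using S[of a s] that a by (intro smooth_on_has_real_derivative_line[OF smooth_on_deriv[OF f]]) auto
  from MVT2[OF \<open>t > 0\<close> this] obtain b where b: "0 < b" "b < t"
    and eb: "frechet_derivative f (at (x + a *\<^sub>R u + t *\<^sub>R v)) u - frechet_derivative f (at (x + a *\<^sub>R u)) u
       = t * frechet_derivative (\<lambda>y. frechet_derivative f (at y) u) (at (x + a *\<^sub>R u + b *\<^sub>R v)) v"
    by auto
  have "x + t *\<^sub>R v + a *\<^sub>R u = x + a *\<^sub>R u + t *\<^sub>R v" "x + t *\<^sub>R v + t *\<^sub>R u = x + t *\<^sub>R u + t *\<^sub>R v"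
    by (simp_all add: algebra_simps)
  with ea eb have "f (x + t *\<^sub>R u + t *\<^sub>R v) - f (x + t *\<^sub>R u) - f (x + t *\<^sub>R v) + f x
      = t * t * frechet_derivative (\<lambda>y. frechet_derivative f (at y) u) (at (x + a *\<^sub>R u + b *\<^sub>R v)) v"
    by simp
  with a b show ?thesis by blast
qed

text \<open>The second difference is symmetric in \<open>u\<close> and \<open>v\<close>, and by the mean value theorem it is \<open>t\<^sup>2\<close> times
  either mixed derivative at a point near \<open>x\<close>. If the two differed at \<open>x\<close>, continuity would keep them
  apart near \<open>x\<close>.\<close>

lemma symmetric_second_derivative_real:
  fixes f :: "'e::real_normed_vector \<Rightarrow> real"
  assumes "open S" and f: "smooth_on S f" and x: "x \<in> S"
  shows "frechet_derivative (\<lambda>y. frechet_derivative f (at y) u) (at x) v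
       = frechet_derivative (\<lambda>y. frechet_derivative f (at y) v) (at x) u"
proof (rule ccontr)
  define P where "P = (\<lambda>z. frechet_derivative (\<lambda>y. frechet_derivative f (at y) u) (at z) v)"
  define Q where "Q = (\<lambda>z. frechet_derivative (\<lambda>y. frechet_derivative f (at y) v) (at z) u)"
  assume "\<not> ?thesis"
  then have ne: "\<bar>P x - Q x\<bar> / 2 > 0" by (simp add: P_def Q_def)
  have "isCont P x" "isCont Q x"
    using smooth_on_continuous_on[OF smooth_on_deriv[OF smooth_on_deriv[OF f]]] x \<open>open S\<close>
    by (auto simp: P_def Q_def continuous_on_eq_continuous_at)
  with ne obtain d1 d2 where d: "d1 > 0" "\<And>y. dist y x < d1 \<Longrightarrow> dist (P y) (P x) < \<bar>P x - Q x\<bar> / 2"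
    "d2 > 0" "\<And>y. dist y x < d2 \<Longrightarrow> dist (Q y) (Q x) < \<bar>P x - Q x\<bar> / 2"
    unfolding continuous_at_eps_delta by metis
  obtain r where r: "r > 0" "ball x r \<subseteq> S" using \<open>open S\<close> x openE by blast
  define m where "m = min r (min d1 d2)"
  \<comment> \<open>the summand \<open>1\<close> keeps the denominator positive when \<open>u\<close> and \<open>v\<close> vanish\<close>
  define t where "t = m / (2 * (norm u + norm v + 1))"
  have m: "m > 0" using d r by (simp add: m_def)
  have np: "norm u + norm v + 1 > 0" using norm_ge_zero[of u] norm_ge_zero[of v] by linarith
  then have t: "t > 0" using m by (simp add: t_def)
  have near: "dist (x + a *\<^sub>R u + b *\<^sub>R v) x < m" if "0 \<le> a" "a \<le> t" "0 \<le> b" "b \<le> t" for a b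
  proof -
    have "dist (x + a *\<^sub>R u + b *\<^sub>R v) x = norm (a *\<^sub>R u + b *\<^sub>R v)"
      by (simp add: dist_norm)
    also have "\<dots> \<le> a * norm u + b * norm v"
      using norm_triangle_ineq[of "a *\<^sub>R u" "b *\<^sub>R v"] that by simp
    also have "\<dots> \<le> t * norm u + t * norm v"
      using that by (intro add_mono mult_right_mono) auto
    also have "\<dots> \<le> t * (norm u + norm v + 1)"
      using t by (simp add: algebra_simps)
    also have "\<dots> = m / 2"
      using np by (simp add: t_def divide_simps)
    also have "\<dots> < m" using m by simp
    finally show ?thesis .
  qed
  have inS: "x + a *\<^sub>R u + b *\<^sub>R v \<in> S" if "0 \<le> a" "a \<le> t" "0 \<le> b" "b \<le> t" for a b
    using near[OF that] r by (auto simp: m_def dist_commute)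
  have inS': "x + a *\<^sub>R v + b *\<^sub>R u \<in> S" if "0 \<le> a" "a \<le> t" "0 \<le> b" "b \<le> t" for a b
    using inS[of b a] that by (simp add: algebra_simps)
  obtain a b where ab: "0 < a" "a < t" "0 < b" "b < t"
    "f (x + t *\<^sub>R u + t *\<^sub>R v) - f (x + t *\<^sub>R u) - f (x + t *\<^sub>R v) + f x = t * t * P (x + a *\<^sub>R u + b *\<^sub>R v)"
    using second_difference_mean_value[OF f t inS] unfolding P_def by blast
  obtain a' b' where ab': "0 < a'" "a' < t" "0 < b'" "b' < t"
    "f (x + t *\<^sub>R v + t *\<^sub>R u) - f (x + t *\<^sub>R v) - f (x + t *\<^sub>R u) + f x = t * t * Q (x + a' *\<^sub>R v + b' *\<^sub>R u)"
    using second_difference_mean_value[OF f t inS'] unfolding Q_def by blast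
  have "x + t *\<^sub>R v + t *\<^sub>R u = x + t *\<^sub>R u + t *\<^sub>R v" "x + a' *\<^sub>R v + b' *\<^sub>R u = x + b' *\<^sub>R u + a' *\<^sub>R v"
    by (simp_all add: algebra_simps)
  with ab(5) ab'(5) have "t * t * P (x + a *\<^sub>R u + b *\<^sub>R v) = t * t * Q (x + b' *\<^sub>R u + a' *\<^sub>R v)"
    by (simp only:)
  then have "P (x + a *\<^sub>R u + b *\<^sub>R v) = Q (x + b' *\<^sub>R u + a' *\<^sub>R v)"
    using t by simp
  moreover have "dist (P (x + a *\<^sub>R u + b *\<^sub>R v)) (P x) < \<bar>P x - Q x\<bar> / 2"
    using near[of a b] ab by (intro d) (simp add: m_def)
  moreover have "dist (Q (x + b' *\<^sub>R u + a' *\<^sub>R v)) (Q x) < \<bar>P x - Q x\<bar> / 2"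
    using near[of b' a'] ab' by (intro d) (simp add: m_def)
  ultimately have "dist (P x) (Q x) < \<bar>P x - Q x\<bar>"
    by (metis dist_commute dist_triangle_half_l)
  then show False by (simp add: dist_real_def)
qed

lemma frechet_derivative_inner:
  assumes "f differentiable (at x)"
  shows "frechet_derivative (\<lambda>y. f y \<bullet> b) (at x) v = frechet_derivative f (at x) v \<bullet> b"
proof -
  have "((\<lambda>y. f y \<bullet> b) has_derivative (\<lambda>v. frechet_derivative f (at x) v \<bullet> b)) (at x)"
    using assms by (intro bounded_linear.has_derivative[OF bounded_linear_inner_left])
      (simp add: frechet_derivative_works)
  from frechet_derivative_at[OF this] show ?thesis by metis
qed

lemma symmetric_second_derivative:
  fixes f :: "'e::real_normed_vector \<Rightarrow> 'f::euclidean_space"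
  assumes "open S" and f: "smooth_on S f" and x: "x \<in> S"
  shows "frechet_derivative (\<lambda>y. frechet_derivative f (at y) u) (at x) v
       = frechet_derivative (\<lambda>y. frechet_derivative f (at y) v) (at x) u"
proof (rule euclidean_eqI)
  fix b :: 'f
  have diff: "g differentiable (at y)" if "smooth_on S g" "y \<in> S" for g :: "'e \<Rightarrow> 'f" and y
    using smooth_on_has_derivative[OF that] by (rule differentiableI)
  have "frechet_derivative (\<lambda>y. frechet_derivative f (at y) u) (at x) v \<bullet> b
      = frechet_derivative (\<lambda>y. frechet_derivative (\<lambda>z. f z \<bullet> b) (at y) u) (at x) v" for u v
  proof -
    have dd: "(\<lambda>y. frechet_derivative f (at y) u) differentiable (at x)"
      by (rule diff[OF smooth_on_deriv[OF f] x])
    have "(\<lambda>y. frechet_derivative f (at y) u \<bullet> b) differentiable (at x)"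
      using dd by (rule differentiable_compose[OF bounded_linear_imp_differentiable[OF bounded_linear_inner_left]])
    then have "frechet_derivative (\<lambda>y. frechet_derivative f (at y) u \<bullet> b) (at x)
      = frechet_derivative (\<lambda>y. frechet_derivative (\<lambda>z. f z \<bullet> b) (at y) u) (at x)"
      by (rule frechet_derivative_transform_within_open[OF _ \<open>open S\<close> x])
        (simp add: frechet_derivative_inner diff[OF f])
    then show ?thesis
      using frechet_derivative_inner[OF dd] by metis
  qed
  then show "frechet_derivative (\<lambda>y. frechet_derivative f (at y) u) (at x) v \<bullet> b
      = frechet_derivative (\<lambda>y. frechet_derivative f (at y) v) (at x) u \<bullet> b"
    using symmetric_second_derivative_real[OF \<open>open S\<close> smooth_on_linear[OF \<open>open S\<close> bounded_linear_inner_left f] x]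
    by metis
qed

text \<open>The product rule for \<open>f'(X)\<close>. Its last term is the second derivative of \<open>f\<close>,
  symmetric in \<open>w\<close> and \<open>X\<close>, so that it cancels when \<open>w\<close> and \<open>X\<close> are exchanged; what is left is the image
  of the Lie bracket.\<close>

lemma frechet_derivative_deriv_along:
  fixes f :: "'e::euclidean_space \<Rightarrow> 'f::euclidean_space" and X :: "'e \<Rightarrow> 'e"
  assumes "open S" "smooth_on S f" "smooth_on S X" "x \<in> S"
  shows "frechet_derivative (\<lambda>y. frechet_derivative f (at y) (X y)) (at x) w
    = frechet_derivative f (at x) (frechet_derivative X (at x) w)
      + frechet_derivative (\<lambda>y. frechet_derivative f (at y) w) (at x) (X x)"
proof -
  let ?D = "\<lambda>b. frechet_derivative (\<lambda>y. frechet_derivative f (at y) b) (at x)"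
  have lin: "frechet_derivative f (at y) u = (\<Sum>b\<in>Basis. (u \<bullet> b) *\<^sub>R frechet_derivative f (at y) b)" if "y \<in> S" for y u
    by (rule linear_Basis_expand) (use that assms smooth_on_linear_deriv in blast)
  have "((\<lambda>y. \<Sum>b\<in>Basis. (X y \<bullet> b) *\<^sub>R frechet_derivative f (at y) b) has_derivative
      (\<lambda>w. \<Sum>b\<in>Basis. (X x \<bullet> b) *\<^sub>R ?D b w + (frechet_derivative X (at x) w \<bullet> b) *\<^sub>R frechet_derivative f (at x) b)) (at x)"
    by (intro has_derivative_sum bounded_bilinear.FDERIV[OF bounded_bilinear_scaleR]
        smooth_on_has_derivative[OF smooth_on_deriv[OF assms(2)] assms(4)]
        bounded_linear.has_derivative[OF bounded_linear_inner_left] smooth_on_has_derivative[OF assms(3,4)])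
  then have "((\<lambda>y. frechet_derivative f (at y) (X y)) has_derivative
      (\<lambda>w. \<Sum>b\<in>Basis. (X x \<bullet> b) *\<^sub>R ?D b w + (frechet_derivative X (at x) w \<bullet> b) *\<^sub>R frechet_derivative f (at x) b)) (at x)"
    by (rule has_derivative_transform_within_open[OF _ assms(1,4)]) (metis lin)
  from fun_cong[OF frechet_derivative_at[OF this], of w]
  have "frechet_derivative (\<lambda>y. frechet_derivative f (at y) (X y)) (at x) w
    = (\<Sum>b\<in>Basis. (X x \<bullet> b) *\<^sub>R ?D b w) + (\<Sum>b\<in>Basis. (frechet_derivative X (at x) w \<bullet> b) *\<^sub>R frechet_derivative f (at x) b)"
    by (simp add: sum.distrib)
  moreover have "?D b w = ?D w b" for b
    by (rule symmetric_second_derivative[OF assms(1,2,4)])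
  moreover have "?D w (X x) = (\<Sum>b\<in>Basis. (X x \<bullet> b) *\<^sub>R ?D w b)"
    by (rule linear_Basis_expand[OF smooth_on_linear_deriv[OF smooth_on_deriv[OF assms(2)] assms(4)]])
  ultimately show ?thesis
    using lin[OF assms(4), of "frechet_derivative X (at x) w"] by simp
qed

section \<open>Smooth plateau functions on Euclidean space\<close>

text \<open>The functions \<open>P(1/t) exp (-1/t)\<close>, continued by zero. Unlike \<open>exp (-1/t)\<close> alone they
  form a class closed under differentiation, which makes smoothness a plain induction.\<close>

definition flat_exp :: "real poly \<Rightarrow> real \<Rightarrow> real" where
  "flat_exp P t = (if t > 0 then poly P (inverse t) * exp (- inverse t) else 0)"

lemma flat_exp_tendsto_0: "(flat_exp P \<longlongrightarrow> 0) (at 0)"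
proof -
  have "((\<lambda>s::real. s ^ k * exp (- s)) \<longlongrightarrow> 0) at_top" for k
    using tendsto_power_div_exp_0[of k] by (simp add: exp_minus divide_inverse)
  then have "((\<lambda>s. \<Sum>i\<le>degree P. coeff P i * (s ^ i * exp (- s))) \<longlongrightarrow> (\<Sum>i\<le>degree P. coeff P i * 0)) at_top"
    by (intro tendsto_sum tendsto_mult tendsto_const)
  then have "((\<lambda>s. poly P s * exp (- s)) \<longlongrightarrow> 0) at_top"
    by (simp add: poly_altdef sum_distrib_right mult.assoc)
  then have "((\<lambda>t. poly P (inverse t) * exp (- inverse t)) \<longlongrightarrow> 0) (at_right 0)"
    by (rule filterlim_compose[OF _ filterlim_inverse_at_top_right])
  then have "(flat_exp P \<longlongrightarrow> 0) (at_right 0)"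
    by (rule Lim_transform_eventually) (auto simp: flat_exp_def eventually_at_right_less eventually_at_filter)
  moreover have "(flat_exp P \<longlongrightarrow> 0) (at_left 0)"
    by (rule Lim_transform_eventually[OF tendsto_const])
      (auto simp: flat_exp_def eventually_at_filter)
  ultimately show ?thesis
    using filterlim_split_at by blast
qed

text \<open>At the origin, the difference quotient of \<open>P(1/t) exp (-1/t)\<close> is again of the
  same form, with \<open>P\<close> multiplied by the variable, and tends to zero.\<close>

lemma flat_exp_has_real_derivative:
  "(flat_exp P has_real_derivative flat_exp ([:0, 0, 1:] * (P - pderiv P)) t) (at t)"
proof -
  consider "t > 0" | "t < 0" | "t = 0" by linarith
  then show ?thesis
  proof cases
    case 1
    then have "((\<lambda>t. poly P (inverse t) * exp (- inverse t)) has_real_derivative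
        flat_exp ([:0, 0, 1:] * (P - pderiv P)) t) (at t)"
      by (auto intro!: derivative_eq_intros DERIV_chain2[OF poly_DERIV]
          simp: flat_exp_def field_simps power2_eq_square)
    then show ?thesis
      by (rule has_field_derivative_transform_within_open[where S = "{0<..}"])
        (use 1 in \<open>auto simp: flat_exp_def\<close>)
  next
    case 2
    have "((\<lambda>t. 0) has_real_derivative 0) (at t)" by simp
    then have "(flat_exp P has_real_derivative 0) (at t)"
      by (rule has_field_derivative_transform_within_open[where S = "{..<0}"])
         (use 2 in \<open>auto simp: flat_exp_def\<close>)
    with 2 show ?thesis by (simp add: flat_exp_def)
  next
    case 3
    have "((\<lambda>h. (flat_exp P (0 + h) - flat_exp P 0) / h) \<longlongrightarrow> 0) (at 0)"
      by (rule Lim_transform_eventually[OF flat_exp_tendsto_0[of "[:0, 1:] * P"]])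
        (auto simp: flat_exp_def eventually_at_filter field_simps)
    with 3 show ?thesis by (simp add: DERIV_def flat_exp_def)
  qed
qed

lemma Ck_on_flat_exp: "Ck_on k UNIV (flat_exp P)"
proof (induction k arbitrary: P)
  case 0
  show ?case
    using DERIV_isCont[OF flat_exp_has_real_derivative]
    by (simp add: continuous_at_imp_continuous_on)
next
  case (Suc k)
  show ?case
  proof (rule Ck_on_SucI[OF open_UNIV])
    show "(flat_exp P has_derivative (*) (flat_exp ([:0, 0, 1:] * (P - pderiv P)) x)) (at x)" for x
      using flat_exp_has_real_derivative by (simp add: has_field_derivative_def)
    show "Ck_on k UNIV (\<lambda>x. flat_exp ([:0, 0, 1:] * (P - pderiv P)) x * v)" for v
      by (intro bounded_bilinear.Ck_on_bilinear[OF bounded_bilinear_mult] open_UNIV Suc.IH Ck_on_const)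
  qed
qed

lemma smooth_step: "\<exists>s::real \<Rightarrow> real. smooth_on UNIV s \<and> (\<forall>t\<le>0. s t = 0) \<and> (\<forall>t\<ge>1. s t = 1)"
proof -
  define r where "r = flat_exp [:1:]"
  have r: "r t = (if t > 0 then exp (- inverse t) else 0)" for t
    by (simp add: r_def flat_exp_def)
  have sm: "smooth_on UNIV r"
    unfolding r_def smooth_on_def by (blast intro: Ck_on_flat_exp)
  have sm': "smooth_on UNIV (\<lambda>t. r (1 - t))"
    by (rule smooth_on_compose[OF _ _ sm smooth_on_diff[OF _ smooth_on_const smooth_on_id]]) auto
  have pos: "r t + r (1 - t) > 0" for t
    by (simp add: r add_pos_pos)
  then have nz: "r t + r (1 - t) \<noteq> 0" for t
    by (metis less_irrefl)
  have "smooth_on UNIV (\<lambda>t. r t * inverse (r t + r (1 - t)))"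
    using sm sm' nz by (intro smooth_on_mult smooth_on_inverse smooth_on_add) auto
  then show ?thesis
    by (intro exI[of _ "\<lambda>t. r t * inverse (r t + r (1 - t))"]) (auto simp: r)
qed

lemma smooth_bump:
  fixes x0 :: "'e::euclidean_space"
  assumes "r > 0"
  shows "\<exists>\<rho>::'e \<Rightarrow> real. smooth_on UNIV \<rho> \<and> (\<forall>x\<in>ball x0 r. \<rho> x = 1) \<and> (\<forall>x. x \<notin> ball x0 (2 * r) \<longrightarrow> \<rho> x = 0)"
proof -
  obtain s :: "real \<Rightarrow> real" where s: "smooth_on UNIV s" "\<And>t. t \<le> 0 \<Longrightarrow> s t = 0" "\<And>t. t \<ge> 1 \<Longrightarrow> s t = 1"
    using smooth_step by blast
  \<comment> \<open>at least \<open>1\<close> on the ball of radius \<open>r\<close>, at most \<open>-2\<close> off the ball of radius \<open>2 * r\<close>\<close>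
  let ?q = "\<lambda>x. 2 - ((x - x0) \<bullet> (x - x0)) * inverse (r * r)"
  have "smooth_on UNIV ?q"
    by (intro smooth_on_diff smooth_on_mult smooth_on_inner smooth_on_const smooth_on_id open_UNIV)
  then have "smooth_on UNIV (\<lambda>x. s (?q x))"
    by (intro smooth_on_compose[OF _ _ s(1)]) auto
  moreover have "s (?q x) = 1" if "x \<in> ball x0 r" for x
  proof (rule s(3))
    have "norm (x - x0) < r" using that by (simp add: dist_norm norm_minus_commute)
    then have "norm (x - x0) * norm (x - x0) \<le> r * r"
      by (intro mult_mono) (use assms in auto)
    then have "(x - x0) \<bullet> (x - x0) \<le> r * r"
      by (simp add: dot_square_norm power2_eq_square)
    then show "?q x \<ge> 1" using assms by (simp add: field_simps)
  qed
  moreover have "s (?q x) = 0" if "x \<notin> ball x0 (2 * r)" for x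
  proof (rule s(2))
    have "norm (x - x0) \<ge> 2 * r" using that by (simp add: dist_norm norm_minus_commute)
    then have "norm (x - x0) * norm (x - x0) \<ge> (2 * r) * (2 * r)"
      by (intro mult_mono) (use assms in auto)
    then have "(x - x0) \<bullet> (x - x0) \<ge> 2 * (r * r)"
      using mult_pos_pos[OF assms assms] unfolding dot_square_norm power2_eq_square by linarith
    then show "?q x \<le> 0" using assms by (simp add: field_simps)
  qed
  ultimately show ?thesis
    by (intro exI[of _ "\<lambda>x. s (?q x)"]) auto
qed

section \<open>Vector fields in the kernel of a derivative\<close>

text \<open>A vector killed by finitely many independent linear forms extends locally to a smooth field that
  is killed by them at every point. The forms are added one at a time: with \<open>w\<close> killed by the old
  forms and \<open>u\<close> a field killed by the old forms but not by the new form \<open>a\<close>, the field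
  \<open>w - (a w / a u) u\<close> is killed by all of them, and it has the same initial value as \<open>w\<close>.\<close>

lemma kernel_field_of_rows:
  fixes a :: "'i \<Rightarrow> 'e::euclidean_space \<Rightarrow> 'e \<Rightarrow> real"
  assumes "finite I" "open T" "x0 \<in> T"
    and smooth: "\<And>i w S. i \<in> I \<Longrightarrow> open S \<Longrightarrow> S \<subseteq> T \<Longrightarrow> smooth_on S w \<Longrightarrow> smooth_on S (\<lambda>x. a i x (w x))"
    and linear: "\<And>i x. i \<in> I \<Longrightarrow> x \<in> T \<Longrightarrow> linear (a i x)"
    and dual: "\<And>i. i \<in> I \<Longrightarrow> \<exists>v. a i x0 v \<noteq> 0 \<and> (\<forall>j\<in>I - {i}. a j x0 v = 0)"
    and v: "\<And>i. i \<in> I \<Longrightarrow> a i x0 v = 0"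
  shows "\<exists>S w. open S \<and> x0 \<in> S \<and> S \<subseteq> T \<and> smooth_on S w \<and> w x0 = v \<and> (\<forall>x\<in>S. \<forall>i\<in>I. a i x (w x) = 0)"
  using assms(1,4-)
proof (induction I arbitrary: v rule: finite_induct)
  case empty
  then show ?case using assms(2,3) smooth_on_const[of T v] by blast
next
  case (insert k I)
  have IH: "\<exists>S w. open S \<and> x0 \<in> S \<and> S \<subseteq> T \<and> smooth_on S w \<and> w x0 = v \<and> (\<forall>x\<in>S. \<forall>i\<in>I. a i x (w x) = 0)"
    if v: "\<And>i. i \<in> I \<Longrightarrow> a i x0 v = 0" for v
  proof (rule insert.IH)
    show "\<exists>v. a i x0 v \<noteq> 0 \<and> (\<forall>j\<in>I - {i}. a j x0 v = 0)" if "i \<in> I" for i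
      using insert.prems(3)[of i] that by blast
  qed (use insert.prems v in auto)
  obtain S w where w: "open S" "x0 \<in> S" "S \<subseteq> T" "smooth_on S w" "w x0 = v"
    "\<And>x i. x \<in> S \<Longrightarrow> i \<in> I \<Longrightarrow> a i x (w x) = 0"
    using IH[of v] insert.prems(4) by blast
  obtain e where e: "a k x0 e \<noteq> 0" "\<And>j. j \<in> I \<Longrightarrow> a j x0 e = 0"
    using insert.prems(3)[of k] insert.hyps(2) by blast
  obtain R u where u: "open R" "x0 \<in> R" "R \<subseteq> T" "smooth_on R u" "u x0 = e"
    "\<And>x i. x \<in> R \<Longrightarrow> i \<in> I \<Longrightarrow> a i x (u x) = 0"
    using IH[of e] e by blast
  have su: "smooth_on R (\<lambda>x. a k x (u x))"
    using insert.prems(1)[of k R u] u by blast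
  define Q where "Q = S \<inter> {x \<in> R. a k x (u x) \<noteq> 0}"
  have "{x \<in> R. a k x (u x) \<noteq> 0} = R \<inter> (\<lambda>x. a k x (u x)) -` (- {0})" by blast
  then have "open Q"
    unfolding Q_def using continuous_open_preimage[OF smooth_on_continuous_on[OF su] u(1), of "- {0}"] w(1)
    by (auto simp: open_Compl)
  have sub: "Q \<subseteq> S" "Q \<subseteq> R" "Q \<subseteq> T" and nz: "\<And>x. x \<in> Q \<Longrightarrow> a k x (u x) \<noteq> 0"
    using w(3) by (auto simp: Q_def)
  have x0: "x0 \<in> Q" using w(2) u(2,5) e(1) by (simp add: Q_def)
  have sw: "smooth_on Q w" and su': "smooth_on Q u"
    using smooth_on_subset w(4) u(4) sub by blast+
  define z where "z = (\<lambda>x. w x - (a k x (w x) * inverse (a k x (u x))) *\<^sub>R u x)"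
  have "smooth_on Q z"
    unfolding z_def using sw su' nz insert.prems(1)[of k Q] sub \<open>open Q\<close>
    by (intro smooth_on_diff smooth_on_scaleR smooth_on_mult smooth_on_inverse) auto
  moreover have "z x0 = v"
    using insert.prems(4)[of k] w(5) by (simp add: z_def)
  moreover have "a i x (z x) = 0" if "x \<in> Q" "i \<in> insert k I" for x i
  proof -
    have "a i x (z x) = a i x (w x) - a k x (w x) * inverse (a k x (u x)) * a i x (u x)"
      using insert.prems(2)[of i x] that sub by (auto simp: z_def linear_diff linear_scale)
    then show ?thesis
      using that w(6)[of x i] u(6)[of x i] nz[of x] subsetD[OF sub(1), of x] subsetD[OF sub(2), of x]
      by auto
  qed
  ultimately show ?case using \<open>open Q\<close> x0 sub by blast
qed

text \<open>The forms are the components of the derivative; surjectivity at \<open>x0\<close> makes them independent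
  there.\<close>

lemma kernel_field:
  fixes f :: "'e::euclidean_space \<Rightarrow> 'f::euclidean_space"
  assumes "open T" "x0 \<in> T" "smooth_on T f" "surj (frechet_derivative f (at x0))"
    and v: "frechet_derivative f (at x0) v = 0"
  shows "\<exists>S w. open S \<and> x0 \<in> S \<and> S \<subseteq> T \<and> smooth_on S w \<and> w x0 = v \<and>
    (\<forall>x\<in>S. frechet_derivative f (at x) (w x) = 0)"
proof -
  have "\<exists>S w. open S \<and> x0 \<in> S \<and> S \<subseteq> T \<and> smooth_on S w \<and> w x0 = v \<and>
    (\<forall>x\<in>S. \<forall>i\<in>Basis. frechet_derivative f (at x) (w x) \<bullet> i = 0)"
  proof (rule kernel_field_of_rows[OF finite_Basis assms(1,2)])
    fix i :: 'f and w :: "'e \<Rightarrow> 'e" and S assume *: "i \<in> Basis" "open S" "S \<subseteq> T" "smooth_on S w"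
    show "smooth_on S (\<lambda>x. frechet_derivative f (at x) (w x) \<bullet> i)"
      using * smooth_on_subset[OF assms(3)]
      by (intro smooth_on_inner smooth_on_deriv_along smooth_on_const)
  next
    fix i :: 'f and x assume "x \<in> T"
    from smooth_on_linear_deriv[OF assms(3) this]
    show "linear (\<lambda>v. frechet_derivative f (at x) v \<bullet> i)"
      by (auto simp: linear_iff inner_add_left)
  next
    fix i :: 'f assume i: "i \<in> Basis"
    obtain v where "frechet_derivative f (at x0) v = i"
      using assms(4) by (metis surjD)
    then show "\<exists>v. frechet_derivative f (at x0) v \<bullet> i \<noteq> 0 \<and>
        (\<forall>j\<in>Basis - {i}. frechet_derivative f (at x0) v \<bullet> j = 0)"
      using i by (intro exI[of _ v]) (auto simp: inner_Basis)
  qed (simp add: v)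
  then show ?thesis
    by (metis (no_types, lifting) euclidean_all_zero_iff)
qed

section \<open>Charts, tangent vectors and functions on a manifold\<close>

locale smooth_mfd =
  fixes M :: "('a, 'e::euclidean_space) manifold"
  assumes smooth_manifold: "smooth_manifold M"
begin

lemma chart_openin: "(U, c) \<in> atlas M \<Longrightarrow> openin (mtop M) U"
  and chart_open_image: "(U, c) \<in> atlas M \<Longrightarrow> open (c ` U)"
  and chart_homeo: "(U, c) \<in> atlas M \<Longrightarrow> homeomorphic_map (subtopology (mtop M) U) (top_of_set (c ` U)) c"
  and chart_transition: "(U, c) \<in> atlas M \<Longrightarrow> (V, d) \<in> atlas M \<Longrightarrow>
      smooth_on (c ` (U \<inter> V)) (d \<circ> chart_inv (U, c))"
  using smooth_manifold unfolding smooth_manifold_def by blast+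

lemma chart_subset: "(U, c) \<in> atlas M \<Longrightarrow> U \<subseteq> points M"
  using chart_openin openin_subset by blast

lemma chart_inj:
  assumes "(U, c) \<in> atlas M"
  shows "inj_on c U"
  using homeomorphic_imp_injective_map[OF chart_homeo[OF assms]] chart_subset[OF assms]
  by (simp add: Int_absorb1)

lemma chart_inv_image:
  assumes "(U, c) \<in> atlas M" "q \<in> U"
  shows "chart_inv (U, c) (c q) = q"
  using chart_inj assms by (simp add: chart_inv_def)

lemma chart_inv_right:
  assumes "(U, c) \<in> atlas M" "x \<in> c ` U"
  shows "c (chart_inv (U, c) x) = x" "chart_inv (U, c) x \<in> U"
  using chart_inv_image assms by auto

lemma chart_image_open:
  assumes "(U, c) \<in> atlas M" "openin (mtop M) A" "A \<subseteq> U"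
  shows "open (c ` A)"
proof -
  have "openin (top_of_set (c ` U)) (c ` A)"
    using homeomorphic_map_openness[OF chart_homeo[OF assms(1)], of A] assms chart_subset[OF assms(1)]
    by (auto simp: openin_subtopology_alt Int_absorb1 image_def)
  then show ?thesis
    using chart_open_image[OF assms(1)] openin_open_trans by blast
qed

lemma chart_preimage_open:
  assumes "(U, c) \<in> atlas M" "open B"
  shows "openin (mtop M) {q \<in> U. c q \<in> B}"
proof -
  have "continuous_map (subtopology (mtop M) U) (top_of_set (c ` U)) c"
    using homeomorphic_imp_continuous_map[OF chart_homeo[OF assms(1)]] .
  then have "continuous_map (subtopology (mtop M) U) euclidean c"
    by (rule continuous_map_into_fulltopology)
  from openin_continuous_map_preimage[OF this, of B]
  have "openin (subtopology (mtop M) U) {q \<in> U. c q \<in> B}"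
    using assms chart_subset[OF assms(1)] by (simp add: Int_absorb1)
  then show ?thesis
    using chart_openin[OF assms(1)] openin_trans_full by blast
qed

text \<open>The only place where the Hausdorff property enters: it is what allows a function with
  compact support in a chart to be extended by zero.\<close>

lemma chart_preimage_compact_closed:
  assumes "(U, c) \<in> atlas M" "compact K" "K \<subseteq> c ` U"
  shows "closedin (mtop M) {q \<in> U. c q \<in> K}"
proof -
  have eq: "c ` {q \<in> U. c q \<in> K} = K" using assms(3) by auto
  have "compactin (top_of_set (c ` U)) K"
    using assms by (simp add: compactin_subtopology)
  then have "compactin (subtopology (mtop M) U) {q \<in> U. c q \<in> K}"
    using homeomorphic_map_compactness[OF chart_homeo[OF assms(1)], of "{q \<in> U. c q \<in> K}"]
      chart_subset[OF assms(1)] by (simp add: eq Int_absorb1)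
  then have "compactin (mtop M) {q \<in> U. c q \<in> K}"
    by (simp add: compactin_subtopology)
  then show ?thesis
    using smooth_manifold compactin_imp_closedin unfolding smooth_manifold_def by blast
qed

lemma obtain_chart:
  assumes "p \<in> points M"
  obtains U c where "(U, c) \<in> atlas M" "p \<in> U"
proof -
  have "p \<in> (\<Union>ch\<in>atlas M. fst ch)"
    using smooth_manifold assms unfolding smooth_manifold_def by simp
  then show thesis using that by force
qed

lemma chart_at_atlas:
  assumes "p \<in> points M"
  shows "chart_at M p \<in> atlas M" "p \<in> fst (chart_at M p)"
proof -
  obtain U c where "(U, c) \<in> atlas M" "p \<in> U" using obtain_chart[OF assms] .
  then have "\<exists>ch. ch \<in> atlas M \<and> p \<in> fst ch" by force
  from someI_ex[OF this] show "chart_at M p \<in> atlas M" "p \<in> fst (chart_at M p)"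
    by (simp_all add: chart_at_def)
qed

lemma obtain_chart_at:
  assumes "p \<in> points M"
  obtains A a where "chart_at M p = (A, a)" "(A, a) \<in> atlas M" "p \<in> A"
  using chart_at_atlas[OF assms] by (cases "chart_at M p") auto

lemma overlap_open:
  assumes "(U, c) \<in> atlas M" "(V, d) \<in> atlas M"
  shows "open (c ` (U \<inter> V))"
  using assms chart_image_open chart_openin by (metis inf_le1 openin_Int)

text \<open>The chain rule for a change of charts, for a function \<open>h\<close> that is smooth near \<open>q\<close>. With
  \<open>(A, a)\<close> the chart chosen at \<open>q\<close>, it turns derivatives defined in that chart into derivatives in
  an arbitrary one.\<close>

lemma transition_chain:
  assumes "(A, a) \<in> atlas M" "(U, c) \<in> atlas M" "q \<in> A" "q \<in> U"
    and T: "openin (mtop M) T" "q \<in> T" "T \<subseteq> U"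
    and h: "smooth_on (c ` T) (h \<circ> chart_inv (U, c))"
  shows "frechet_derivative (h \<circ> chart_inv (A, a)) (at (a q)) v
    = frechet_derivative (h \<circ> chart_inv (U, c)) (at (c q))
        (frechet_derivative (c \<circ> chart_inv (A, a)) (at (a q)) v)"
proof -
  note inv = chart_inv_image[OF assms(1)] chart_inv_image[OF assms(2)]
  have "frechet_derivative (h \<circ> chart_inv (A, a)) (at (a q)) v
    = frechet_derivative (h \<circ> chart_inv (U, c)) (at ((c \<circ> chart_inv (A, a)) (a q)))
        (frechet_derivative (c \<circ> chart_inv (A, a)) (at (a q)) v)"
  proof (rule frechet_derivative_chain)
    show "open (a ` (A \<inter> T))"
      using T(1) assms(1) chart_image_open chart_openin by (metis inf_le1 openin_Int)
    show "a q \<in> a ` (A \<inter> T)" using assms by blast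
    show "(c \<circ> chart_inv (A, a)) differentiable (at (a q))"
      by (rule smooth_on_differentiable[OF chart_transition[OF assms(1,2)]]) (use assms in blast)
    show "(h \<circ> chart_inv (U, c)) differentiable (at ((c \<circ> chart_inv (A, a)) (a q)))"
      by (rule smooth_on_differentiable[OF h]) (use T assms in \<open>simp add: inv\<close>)
    show "(h \<circ> chart_inv (A, a)) y = (h \<circ> chart_inv (U, c)) ((c \<circ> chart_inv (A, a)) y)"
      if "y \<in> a ` (A \<inter> T)" for y
      using that T(3) by (auto simp: inv subsetD)
  qed
  then show ?thesis using assms by (simp add: inv)
qed

lemma tcomp_transition:
  assumes "(U, c) \<in> atlas M" "(V, d) \<in> atlas M" "q \<in> U" "q \<in> V"
  shows "tcomp M (V, d) q v = frechet_derivative (d \<circ> chart_inv (U, c)) (at (c q)) (tcomp M (U, c) q v)"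
proof -
  have q: "q \<in> points M" using assms chart_subset by blast
  obtain A a where A: "chart_at M q = (A, a)" "(A, a) \<in> atlas M" "q \<in> A"
    using obtain_chart_at[OF q] .
  have "openin (mtop M) (U \<inter> V)" using assms chart_openin by blast
  from transition_chain[OF A(2) assms(1) A(3) assms(3) this _ _ chart_transition[OF assms(1,2)]]
  show ?thesis using assms A by (simp add: tcomp_def)
qed

lemma tcomp_linear:
  assumes "(U, c) \<in> atlas M" "q \<in> U"
  shows "linear (tcomp M (U, c) q)"
proof -
  have q: "q \<in> points M" using assms chart_subset by blast
  obtain A a where A: "chart_at M q = (A, a)" "(A, a) \<in> atlas M" "q \<in> A"
    using obtain_chart_at[OF q] .
  have "linear (frechet_derivative (c \<circ> chart_inv (A, a)) (at (a q)))"
    by (rule smooth_on_linear_deriv[OF chart_transition[OF A(2) assms(1)]]) (use A assms in blast)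
  then show ?thesis using A by (simp add: tcomp_def[abs_def])
qed

lemma frechet_derivative_chart_id:
  assumes "(U, c) \<in> atlas M" "q \<in> U"
  shows "frechet_derivative (c \<circ> chart_inv (U, c)) (at (c q)) v = v"
proof -
  have "((\<lambda>x. x) has_derivative (\<lambda>v. v)) (at (c q))" by simp
  then have "((c \<circ> chart_inv (U, c)) has_derivative (\<lambda>v. v)) (at (c q))"
    by (rule has_derivative_transform_within_open[OF _ chart_open_image[OF assms(1)]])
      (use assms in \<open>auto simp: chart_inv_right[OF assms(1)]\<close>)
  from frechet_derivative_at[OF this] show ?thesis by metis
qed

lemma tcomp_chart_at:
  assumes "p \<in> points M" "chart_at M p = (A, a)"
  shows "tcomp M (A, a) p v = v"
  using chart_at_atlas[OF assms(1)] frechet_derivative_chart_id assms(2) by (simp add: tcomp_def)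

lemma tcomp_inj:
  assumes "(U, c) \<in> atlas M" "q \<in> U" "tcomp M (U, c) q v = tcomp M (U, c) q w"
  shows "v = w"
proof -
  have q: "q \<in> points M" using assms chart_subset by blast
  obtain A a where A: "chart_at M q = (A, a)" "(A, a) \<in> atlas M" "q \<in> A"
    using obtain_chart_at[OF q] .
  have "tcomp M (A, a) q v = tcomp M (A, a) q w"
    using tcomp_transition[OF assms(1) A(2) assms(2) A(3)] assms(3) by metis
  then show ?thesis using tcomp_chart_at[OF q A(1)] by metis
qed

lemma tcomp_surj:
  assumes "(U, c) \<in> atlas M" "q \<in> U"
  shows "\<exists>v. tcomp M (U, c) q v = w"
proof -
  have q: "q \<in> points M" using assms chart_subset by blast
  have "surj (tcomp M (U, c) q)"
    using tcomp_inj[OF assms] by (intro linear_inj_imp_surj tcomp_linear assms injI)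
  then show ?thesis by (metis surjD)
qed

text \<open>Changes of charts are smooth, so a single chart near each point decides about smoothness.\<close>

lemma smooth_fun_local:
  assumes "\<And>p. p \<in> points M \<Longrightarrow> \<exists>U c T. (U, c) \<in> atlas M \<and> openin (mtop M) T \<and> p \<in> T \<and> T \<subseteq> U \<and>
    smooth_on (c ` T) (f \<circ> chart_inv (U, c))"
  shows "smooth_fun M f"
  unfolding smooth_fun_def
proof (clarify, rule smooth_on_local)
  fix V d x assume V: "(V, d) \<in> atlas M" and x: "x \<in> d ` V"
  then obtain q where q: "q \<in> V" "x = d q" by blast
  with V chart_subset have "q \<in> points M" by blast
  from assms[OF this] obtain U c T where T: "(U, c) \<in> atlas M" "openin (mtop M) T" "q \<in> T" "T \<subseteq> U"
    "smooth_on (c ` T) (f \<circ> chart_inv (U, c))" by blast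
  note inv = chart_inv_image[OF V] chart_inv_image[OF T(1)]
  have op: "open (d ` (V \<inter> T))"
    using T(2) V chart_image_open chart_openin by (metis inf_le1 openin_Int)
  have "smooth_on (d ` (V \<inter> T)) (\<lambda>y. (f \<circ> chart_inv (U, c)) ((c \<circ> chart_inv (V, d)) y))"
  proof (rule smooth_on_compose[OF op chart_image_open[OF T(1,2,4)] T(5)])
    show "smooth_on (d ` (V \<inter> T)) (c \<circ> chart_inv (V, d))"
      by (rule smooth_on_subset[OF chart_transition[OF V T(1)]]) (use T(4) in blast)
    show "(c \<circ> chart_inv (V, d)) ` d ` (V \<inter> T) \<subseteq> c ` T" by (auto simp: inv)
  qed
  then have "smooth_on (d ` (V \<inter> T)) (f \<circ> chart_inv (V, d))"
    by (rule smooth_on_cong[OF op]) (use T(4) in \<open>auto simp: inv subsetD\<close>)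
  then show "\<exists>T. open T \<and> x \<in> T \<and> smooth_on T (f \<circ> chart_inv (V, d))"
    using op q T(3) by blast
qed

lemma smooth_fun_chart: "smooth_fun M f \<Longrightarrow> (U, c) \<in> atlas M \<Longrightarrow> smooth_on (c ` U) (f \<circ> chart_inv (U, c))"
  unfolding smooth_fun_def by blast

lemma smooth_fun_cong:
  assumes "smooth_fun M f" "\<And>q. q \<in> points M \<Longrightarrow> f q = g q"
  shows "smooth_fun M g"
  unfolding smooth_fun_def
proof clarify
  fix U c assume U: "(U, c) \<in> atlas M"
  show "smooth_on (c ` U) (g \<circ> chart_inv (U, c))"
    by (rule smooth_on_cong[OF chart_open_image[OF U] smooth_fun_chart[OF assms(1) U]])
      (use chart_inv_right[OF U] chart_subset[OF U] assms(2) in auto)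
qed

lemma smooth_fun_const: "smooth_fun M (\<lambda>_. k)"
  unfolding smooth_fun_def by (auto simp: comp_def intro: smooth_on_const)

lemma smooth_fun_add: "smooth_fun M f \<Longrightarrow> smooth_fun M g \<Longrightarrow> smooth_fun M (\<lambda>q. f q + g q)"
  unfolding smooth_fun_def using smooth_on_add[OF chart_open_image]
  by (fastforce simp: comp_def)

lemma smooth_fun_mult: "smooth_fun M f \<Longrightarrow> smooth_fun M g \<Longrightarrow> smooth_fun M (\<lambda>q. f q * g q)"
  unfolding smooth_fun_def using smooth_on_mult[OF chart_open_image]
  by (fastforce simp: comp_def)

lemma smooth_fun_differentiable:
  assumes "smooth_fun M f" "(U, c) \<in> atlas M" "q \<in> U"
  shows "(f \<circ> chart_inv (U, c)) differentiable (at (c q))"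
  using smooth_on_differentiable[OF smooth_fun_chart[OF assms(1,2)]] assms(3) by blast

lemma dfun_cong:
  assumes f: "smooth_fun M f" and T: "openin (mtop M) T" "p \<in> T" "\<And>q. q \<in> T \<Longrightarrow> f q = g q"
  shows "dfun M f p v = dfun M g p v"
proof -
  have p: "p \<in> points M" using T openin_subset by blast
  obtain A a where A: "chart_at M p = (A, a)" "(A, a) \<in> atlas M" "p \<in> A"
    using obtain_chart_at[OF p] .
  have "frechet_derivative (f \<circ> chart_inv (A, a)) (at (a p)) = frechet_derivative (g \<circ> chart_inv (A, a)) (at (a p))"
  proof (rule frechet_derivative_transform_within_open)
    show "(f \<circ> chart_inv (A, a)) differentiable (at (a p))"
      by (rule smooth_fun_differentiable[OF f A(2,3)])
    show "open (a ` (A \<inter> T))"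
      using T(1) A chart_image_open chart_openin by (metis inf_le1 openin_Int)
  qed (use A T chart_inv_image[OF A(2)] in auto)
  then show ?thesis by (simp add: dfun_def A)
qed

lemma dfun_const: "dfun M (\<lambda>_. k) p v = 0"
  by (simp add: dfun_def comp_def)

lemma dfun_add:
  assumes "smooth_fun M f" "smooth_fun M g" "p \<in> points M"
  shows "dfun M (\<lambda>q. f q + g q) p v = dfun M f p v + dfun M g p v"
proof -
  obtain A a where A: "chart_at M p = (A, a)" "(A, a) \<in> atlas M" "p \<in> A"
    using obtain_chart_at[OF assms(3)] .
  note d = smooth_fun_differentiable[OF assms(1) A(2,3)] smooth_fun_differentiable[OF assms(2) A(2,3)]
  have "((\<lambda>x. (f \<circ> chart_inv (A, a)) x + (g \<circ> chart_inv (A, a)) x) has_derivative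
     (\<lambda>v. frechet_derivative (f \<circ> chart_inv (A, a)) (at (a p)) v
       + frechet_derivative (g \<circ> chart_inv (A, a)) (at (a p)) v)) (at (a p))"
    using d unfolding frechet_derivative_works by (rule has_derivative_add)
  from fun_cong[OF frechet_derivative_at[OF this], of v] show ?thesis
    by (simp add: dfun_def A comp_def)
qed

lemma dfun_mult:
  assumes "smooth_fun M f" "smooth_fun M g" "p \<in> points M"
  shows "dfun M (\<lambda>q. f q * g q) p v = dfun M f p v * g p + f p * dfun M g p v"
proof -
  obtain A a where A: "chart_at M p = (A, a)" "(A, a) \<in> atlas M" "p \<in> A"
    using obtain_chart_at[OF assms(3)] .
  note d = smooth_fun_differentiable[OF assms(1) A(2,3)] smooth_fun_differentiable[OF assms(2) A(2,3)]
  have "((\<lambda>x. (f \<circ> chart_inv (A, a)) x * (g \<circ> chart_inv (A, a)) x) has_derivative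
     (\<lambda>v. (f \<circ> chart_inv (A, a)) (a p) * frechet_derivative (g \<circ> chart_inv (A, a)) (at (a p)) v
       + frechet_derivative (f \<circ> chart_inv (A, a)) (at (a p)) v * (g \<circ> chart_inv (A, a)) (a p))) (at (a p))"
    using d unfolding frechet_derivative_works by (rule has_derivative_mult)
  from fun_cong[OF frechet_derivative_at[OF this], of v] show ?thesis
    by (simp add: dfun_def A comp_def chart_inv_image[OF A(2,3)])
qed

section \<open>Extending local functions by zero\<close>

text \<open>Closedness of \<open>K\<close> in the whole manifold is essential: the complement of \<open>K\<close> is then a
  neighbourhood of every point at which the coordinate expression \<open>u\<close> is not available.\<close>

lemma smooth_fun_supported:
  assumes U: "(U, c) \<in> atlas M" and A: "open A" "A \<subseteq> c ` U"
    and K: "closedin (mtop M) K" "K \<subseteq> {q \<in> U. c q \<in> A}" "\<And>q. q \<notin> K \<Longrightarrow> f q = 0"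
    and u: "smooth_on A u" "\<And>q. q \<in> U \<Longrightarrow> c q \<in> A \<Longrightarrow> f q = u (c q)"
  shows "smooth_fun M f"
proof (rule smooth_fun_local)
  fix q assume q: "q \<in> points M"
  show "\<exists>U c T. (U, c) \<in> atlas M \<and> openin (mtop M) T \<and> q \<in> T \<and> T \<subseteq> U \<and>
    smooth_on (c ` T) (f \<circ> chart_inv (U, c))"
  proof (cases "q \<in> K")
    case True
    let ?T = "{q \<in> U. c q \<in> A}"
    have im: "c ` ?T = A" using A(2) by auto
    have "smooth_on A (f \<circ> chart_inv (U, c))"
      by (rule smooth_on_cong[OF A(1) u(1)]) (use chart_inv_right[OF U] A(2) u(2) in \<open>auto simp: subsetD\<close>)
    then show ?thesis
      using U chart_preimage_open[OF U A(1)] True K(2) im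
      by (intro exI[of _ U] exI[of _ c] exI[of _ ?T]) auto
  next
    case False
    obtain V d where V: "(V, d) \<in> atlas M" "q \<in> V" using obtain_chart[OF q] .
    let ?T = "V \<inter> (points M - K)"
    have T: "openin (mtop M) ?T" using K(1) V chart_openin by blast
    have "smooth_on (d ` ?T) (f \<circ> chart_inv (V, d))"
      by (rule smooth_on_cong[OF chart_image_open[OF V(1) T] smooth_on_const[of _ 0]])
        (use K(3) in \<open>auto simp: chart_inv_image[OF V(1)]\<close>)
    then show ?thesis
      using V T False q by (intro exI[of _ V] exI[of _ d] exI[of _ ?T]) auto
  qed
qed

lemma plateau_function:
  assumes U: "(U, c) \<in> atlas M" "p \<in> U" and A: "open A" "c p \<in> A" "A \<subseteq> c ` U"
  shows "\<exists>f T K. smooth_fun M f \<and> openin (mtop M) T \<and> p \<in> T \<and> T \<subseteq> K \<and> closedin (mtop M) K \<and>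
    K \<subseteq> {q \<in> U. c q \<in> A} \<and> (\<forall>q\<in>T. f q = 1) \<and> (\<forall>q. q \<notin> K \<longrightarrow> f q = 0)"
proof -
  obtain r0 where r0: "r0 > 0" "cball (c p) r0 \<subseteq> A"
    using A open_contains_cball by blast
  define r where "r = r0 / 2"
  have r: "r > 0" "cball (c p) (2 * r) \<subseteq> A" using r0 by (simp_all add: r_def)
  obtain \<rho> where \<rho>: "smooth_on UNIV \<rho>" "\<And>x. x \<in> ball (c p) r \<Longrightarrow> \<rho> x = (1::real)"
    "\<And>x. x \<notin> ball (c p) (2 * r) \<Longrightarrow> \<rho> x = 0"
    using smooth_bump[OF r(1), of "c p"] by blast
  define f where "f = (\<lambda>q. if q \<in> U then \<rho> (c q) else 0)"
  let ?K = "{q \<in> U. c q \<in> cball (c p) (2 * r)}"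
  let ?T = "{q \<in> U. c q \<in> ball (c p) r}"
  have K: "closedin (mtop M) ?K"
    by (rule chart_preimage_compact_closed[OF U(1)]) (use r(2) A(3) in auto)
  have KA: "?K \<subseteq> {q \<in> U. c q \<in> A}" using r(2) by blast
  have out: "f q = 0" if "q \<notin> ?K" for q
    using that \<rho>(3)[of "c q"] by (auto simp: f_def)
  have "smooth_fun M f"
    by (rule smooth_fun_supported[OF U(1) A(1,3) K KA out smooth_on_subset[OF \<rho>(1)]]) (auto simp: f_def)
  moreover have "openin (mtop M) ?T"
    using chart_preimage_open[OF U(1)] by blast
  moreover have "?T \<subseteq> ?K" using r(1) by auto
  moreover have "f q = 1" if "q \<in> ?T" for q
    using that \<rho>(2) by (simp add: f_def)
  ultimately show ?thesis
    using U r(1) K KA out by (intro exI[of _ f] exI[of _ ?T] exI[of _ ?K]) auto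
qed

text \<open>The extension agrees with the given function on a smaller neighbourhood, so germs of smooth
  functions are germs of global ones. Connections are only defined on global objects.\<close>

lemma extend_function:
  assumes U: "(U, c) \<in> atlas M" "p \<in> U" and A: "open A" "c p \<in> A" "A \<subseteq> c ` U" and u: "smooth_on A u"
  shows "\<exists>f T. smooth_fun M f \<and> openin (mtop M) T \<and> p \<in> T \<and> T \<subseteq> {q \<in> U. c q \<in> A} \<and> (\<forall>q\<in>T. f q = u (c q))"
proof -
  obtain f T K where f: "smooth_fun M f" "openin (mtop M) T" "p \<in> T" "T \<subseteq> K" "closedin (mtop M) K"
    "K \<subseteq> {q \<in> U. c q \<in> A}" "\<And>q. q \<in> T \<Longrightarrow> f q = 1" "\<And>q. q \<notin> K \<Longrightarrow> f q = 0"
    using plateau_function[OF U A] by blast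
  have "smooth_on A (\<lambda>x. (f \<circ> chart_inv (U, c)) x * u x)"
    by (rule smooth_on_mult[OF A(1) smooth_on_subset[OF smooth_fun_chart[OF f(1) U(1)] A(3)] u])
  then have "smooth_fun M (\<lambda>q. f q * u (c q))"
    by (rule smooth_fun_supported[OF U(1) A(1,3) f(5,6), rotated])
      (use f(8) in \<open>auto simp: chart_inv_image[OF U(1)]\<close>)
  then show ?thesis using f by (intro exI[of _ "\<lambda>q. f q * u (c q)"] exI[of _ T]) auto
qed

lemma bump_function:
  assumes "openin (mtop M) W" "p \<in> W"
  shows "\<exists>f. smooth_fun M f \<and> f p = 1 \<and> (\<forall>q. q \<notin> W \<longrightarrow> f q = 0)"
proof -
  have "p \<in> points M" using assms openin_subset by blast
  then obtain U c where U: "(U, c) \<in> atlas M" "p \<in> U" using obtain_chart by blast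
  have op: "open (c ` (U \<inter> W))"
    using assms(1) U chart_image_open chart_openin by (metis inf_le1 openin_Int)
  obtain f T K where "smooth_fun M f" "p \<in> T" "\<forall>q\<in>T. f q = 1" "K \<subseteq> {q \<in> U. c q \<in> c ` (U \<inter> W)}"
    "\<And>q. q \<notin> K \<Longrightarrow> f q = 0"
    using plateau_function[OF U op] U assms by blast
  moreover have "{q \<in> U. c q \<in> c ` (U \<inter> W)} \<subseteq> W"
    using chart_inj[OF U(1)] by (auto dest: inj_onD)
  ultimately show ?thesis by blast
qed

end

section \<open>Smooth maps and sections along them\<close>

locale smooth_mfd_map = M: smooth_mfd M + N: smooth_mfd N
  for M :: "('a, 'e::euclidean_space) manifold" and N :: "('b, 'f::euclidean_space) manifold" +
  fixes F :: "'a \<Rightarrow> 'b"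
  assumes smooth_map: "smooth_map M N F"
begin

lemma map_points: "p \<in> points M \<Longrightarrow> F p \<in> points N"
  using smooth_map continuous_map_image_subset_topspace unfolding smooth_map_def by blast

lemma map_preimage_open:
  assumes "openin (mtop M) T" "openin (mtop N) V"
  shows "openin (mtop M) (T \<inter> F -` V)"
proof -
  have "openin (mtop M) {q \<in> points M. F q \<in> V}"
    using smooth_map assms(2) openin_continuous_map_preimage unfolding smooth_map_def by blast
  then have "openin (mtop M) (T \<inter> {q \<in> points M. F q \<in> V})"
    using assms(1) by blast
  moreover have "T \<inter> {q \<in> points M. F q \<in> V} = T \<inter> F -` V"
    using openin_subset[OF assms(1)] by auto
  ultimately show ?thesis by simp
qed

lemma chart_overlap:
  assumes "(U, c) \<in> atlas M" "(V, d) \<in> atlas N"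
  shows "openin (mtop M) (U \<inter> F -` V)" "open (c ` (U \<inter> F -` V))"
    "smooth_on (c ` (U \<inter> F -` V)) (d \<circ> F \<circ> chart_inv (U, c))"
proof -
  show op: "openin (mtop M) (U \<inter> F -` V)"
    using assms M.chart_openin N.chart_openin map_preimage_open by blast
  then show "open (c ` (U \<inter> F -` V))"
    using M.chart_image_open[OF assms(1)] by blast
  show "smooth_on (c ` (U \<inter> F -` V)) (d \<circ> F \<circ> chart_inv (U, c))"
    using smooth_map assms unfolding smooth_map_def by blast
qed

text \<open>A change of charts of \<open>N\<close> transforms components by its derivative at the moving point \<open>F q\<close>, which
  is smooth; therefore one pair of charts near each point suffices.\<close>

lemma section_local:
  assumes "\<And>p. p \<in> points M \<Longrightarrow> \<exists>U c V d T. (U, c) \<in> atlas M \<and> (V, d) \<in> atlas N \<and>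
    openin (mtop M) T \<and> p \<in> T \<and> T \<subseteq> U \<inter> F -` V \<and>
    smooth_on (c ` T) ((\<lambda>q. tcomp N (V, d) (F q) (s q)) \<circ> chart_inv (U, c))"
  shows "section_along M N F s"
  unfolding section_along_def
proof (clarify, rule smooth_on_local)
  fix U' c' V' d' x
  assume U': "(U', c') \<in> atlas M" and V': "(V', d') \<in> atlas N" and x: "x \<in> c' ` (U' \<inter> F -` V')"
  then obtain q where q: "q \<in> U'" "F q \<in> V'" "x = c' q" by blast
  with U' M.chart_subset have "q \<in> points M" by blast
  from assms[OF this] obtain U c V d T where U: "(U, c) \<in> atlas M" and V: "(V, d) \<in> atlas N" and
    T: "openin (mtop M) T" "q \<in> T" "T \<subseteq> U \<inter> F -` V"
    "smooth_on (c ` T) ((\<lambda>q. tcomp N (V, d) (F q) (s q)) \<circ> chart_inv (U, c))" by blast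
  let ?T = "(U' \<inter> F -` V') \<inter> T"
  have opT: "openin (mtop M) ?T" using chart_overlap(1)[OF U' V'] T(1) by blast
  then have op: "open (c' ` ?T)" using M.chart_image_open[OF U'] by blast
  note inv = M.chart_inv_image[OF U'] M.chart_inv_image[OF U]
  have TU: "r \<in> U" "F r \<in> V" if "r \<in> T" for r using T(3) that by auto
  have w: "smooth_on (c' ` ?T) (\<lambda>y. ((\<lambda>q. tcomp N (V, d) (F q) (s q)) \<circ> chart_inv (U, c)) ((c \<circ> chart_inv (U', c')) y))"
  proof (rule smooth_on_compose[OF op _ T(4)])
    show "open (c ` T)" by (rule M.chart_image_open[OF U T(1)]) (use T(3) in blast)
    show "smooth_on (c' ` ?T) (c \<circ> chart_inv (U', c'))"
      by (rule smooth_on_subset[OF M.chart_transition[OF U' U]]) (use T(3) in blast)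
    show "(c \<circ> chart_inv (U', c')) ` c' ` ?T \<subseteq> c ` T" by (auto simp: inv)
  qed
  have y: "smooth_on (c' ` ?T) (d \<circ> F \<circ> chart_inv (U', c'))"
    by (rule smooth_on_subset[OF chart_overlap(3)[OF U' V]]) (use T(3) in blast)
  have "smooth_on (c' ` ?T) (\<lambda>y. frechet_derivative (d' \<circ> chart_inv (V, d)) (at ((d \<circ> F \<circ> chart_inv (U', c')) y))
      (((\<lambda>q. tcomp N (V, d) (F q) (s q)) \<circ> chart_inv (U, c)) ((c \<circ> chart_inv (U', c')) y)))"
    by (rule smooth_on_deriv_at_along[OF op N.overlap_open[OF V V'] N.chart_transition[OF V V'] y _ w])
      (use T(3) in \<open>auto simp: inv\<close>)
  then have "smooth_on (c' ` ?T) ((\<lambda>q. tcomp N (V', d') (F q) (s q)) \<circ> chart_inv (U', c'))"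
    by (rule smooth_on_cong[OF op]) (auto simp: inv TU N.tcomp_transition[OF V V'])
  then show "\<exists>T. open T \<and> x \<in> T \<and> smooth_on T ((\<lambda>q. tcomp N (V', d') (F q) (s q)) \<circ> chart_inv (U', c'))"
    using op q T(2) by (intro exI[of _ "c' ` ?T"]) auto
qed

lemma section_chart:
  assumes "section_along M N F s" "(U, c) \<in> atlas M" "(V, d) \<in> atlas N"
  shows "smooth_on (c ` (U \<inter> F -` V)) ((\<lambda>q. tcomp N (V, d) (F q) (s q)) \<circ> chart_inv (U, c))"
  using assms unfolding section_along_def by blast

lemma sectionI:
  assumes "\<And>U c V d. (U, c) \<in> atlas M \<Longrightarrow> (V, d) \<in> atlas N \<Longrightarrow>
    smooth_on (c ` (U \<inter> F -` V)) ((\<lambda>q. tcomp N (V, d) (F q) (s q)) \<circ> chart_inv (U, c))"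
  shows "section_along M N F s"
  using assms unfolding section_along_def by blast

lemma section_cong:
  assumes "section_along M N F s" "\<And>q. q \<in> points M \<Longrightarrow> s q = t q"
  shows "section_along M N F t"
proof (rule sectionI)
  fix U c V d assume UV: "(U, c) \<in> atlas M" "(V, d) \<in> atlas N"
  show "smooth_on (c ` (U \<inter> F -` V)) ((\<lambda>q. tcomp N (V, d) (F q) (t q)) \<circ> chart_inv (U, c))"
    by (rule smooth_on_cong[OF chart_overlap(2)[OF UV] section_chart[OF assms(1) UV]])
      (use assms(2) M.chart_subset[OF UV(1)] in \<open>auto simp: M.chart_inv_image[OF UV(1)] subsetD\<close>)
qed

lemma section_add:
  assumes "section_along M N F s" "section_along M N F t"
  shows "section_along M N F (\<lambda>q. s q + t q)"
proof (rule sectionI)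
  fix U c V d assume UV: "(U, c) \<in> atlas M" "(V, d) \<in> atlas N"
  show "smooth_on (c ` (U \<inter> F -` V)) ((\<lambda>q. tcomp N (V, d) (F q) (s q + t q)) \<circ> chart_inv (U, c))"
    by (rule smooth_on_cong[OF chart_overlap(2)[OF UV]
        smooth_on_add[OF chart_overlap(2)[OF UV] section_chart[OF assms(1) UV] section_chart[OF assms(2) UV]]])
      (auto simp: M.chart_inv_image[OF UV(1)] linear_add[OF N.tcomp_linear[OF UV(2)]])
qed

lemma section_scale:
  assumes "smooth_fun M f" "section_along M N F s"
  shows "section_along M N F (\<lambda>q. f q *\<^sub>R s q)"
proof (rule sectionI)
  fix U c V d assume UV: "(U, c) \<in> atlas M" "(V, d) \<in> atlas N"
  have f: "smooth_on (c ` (U \<inter> F -` V)) (f \<circ> chart_inv (U, c))"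
    by (rule smooth_on_subset[OF M.smooth_fun_chart[OF assms(1) UV(1)]]) blast
  show "smooth_on (c ` (U \<inter> F -` V)) ((\<lambda>q. tcomp N (V, d) (F q) (f q *\<^sub>R s q)) \<circ> chart_inv (U, c))"
    by (rule smooth_on_cong[OF chart_overlap(2)[OF UV]
        smooth_on_scaleR[OF chart_overlap(2)[OF UV] f section_chart[OF assms(2) UV]]])
      (auto simp: M.chart_inv_image[OF UV(1)] linear_scale[OF N.tcomp_linear[OF UV(2)]])
qed

lemma section_zero: "section_along M N F (\<lambda>q. 0)"
proof (rule sectionI)
  fix U c V d assume UV: "(U, c) \<in> atlas M" "(V, d) \<in> atlas N"
  show "smooth_on (c ` (U \<inter> F -` V)) ((\<lambda>q. tcomp N (V, d) (F q) 0) \<circ> chart_inv (U, c))"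
    by (rule smooth_on_cong[OF chart_overlap(2)[OF UV] smooth_on_const[of _ 0]])
      (auto simp: M.chart_inv_image[OF UV(1)] linear_0[OF N.tcomp_linear[OF UV(2)]])
qed

lemma section_sum:
  assumes "\<And>i. i \<in> I \<Longrightarrow> section_along M N F (s i)"
  shows "section_along M N F (\<lambda>q. \<Sum>i\<in>I. s i q)"
  using assms by (induction I rule: infinite_finite_induct) (auto intro: section_zero section_add)

lemma section_compose:
  assumes "vector_field N Z"
  shows "section_along M N F (\<lambda>q. Z (F q))"
proof (rule sectionI)
  fix U c V d assume UV: "(U, c) \<in> atlas M" "(V, d) \<in> atlas N"
  have Z: "smooth_on (d ` V) ((\<lambda>y. tcomp N (V, d) y (Z y)) \<circ> chart_inv (V, d))"
    using assms UV(2) unfolding vector_field_def section_along_def by force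
  have "smooth_on (c ` (U \<inter> F -` V)) (\<lambda>x. ((\<lambda>y. tcomp N (V, d) y (Z y)) \<circ> chart_inv (V, d)) ((d \<circ> F \<circ> chart_inv (U, c)) x))"
    by (rule smooth_on_compose[OF chart_overlap(2)[OF UV] N.chart_open_image[OF UV(2)] Z chart_overlap(3)[OF UV]])
      (auto simp: M.chart_inv_image[OF UV(1)])
  then show "smooth_on (c ` (U \<inter> F -` V)) ((\<lambda>q. tcomp N (V, d) (F q) (Z (F q))) \<circ> chart_inv (U, c))"
    by (rule smooth_on_cong[OF chart_overlap(2)[OF UV]])
      (auto simp: M.chart_inv_image[OF UV(1)] N.chart_inv_image[OF UV(2)])
qed

lemma smooth_fun_compose:
  assumes "smooth_fun N h"
  shows "smooth_fun M (\<lambda>q. h (F q))"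
proof (rule M.smooth_fun_local)
  fix p assume p: "p \<in> points M"
  obtain U c where U: "(U, c) \<in> atlas M" "p \<in> U" using M.obtain_chart[OF p] .
  obtain V d where V: "(V, d) \<in> atlas N" "F p \<in> V" using N.obtain_chart[OF map_points[OF p]] .
  note UV = U(1) V(1)
  have "smooth_on (c ` (U \<inter> F -` V)) (\<lambda>x. (h \<circ> chart_inv (V, d)) ((d \<circ> F \<circ> chart_inv (U, c)) x))"
    by (rule smooth_on_compose[OF chart_overlap(2)[OF UV] N.chart_open_image[OF UV(2)]
        N.smooth_fun_chart[OF assms UV(2)] chart_overlap(3)[OF UV]])
      (auto simp: M.chart_inv_image[OF UV(1)])
  then have "smooth_on (c ` (U \<inter> F -` V)) ((\<lambda>q. h (F q)) \<circ> chart_inv (U, c))"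
    by (rule smooth_on_cong[OF chart_overlap(2)[OF UV]])
      (auto simp: M.chart_inv_image[OF UV(1)] N.chart_inv_image[OF UV(2)])
  then show "\<exists>U c T. (U, c) \<in> atlas M \<and> openin (mtop M) T \<and> p \<in> T \<and> T \<subseteq> U \<and>
      smooth_on (c ` T) ((\<lambda>q. h (F q)) \<circ> chart_inv (U, c))"
    using U V chart_overlap(1)[OF UV] by (intro exI[of _ U] exI[of _ c] exI[of _ "U \<inter> F -` V"]) auto
qed

lemma dfun_compose:
  assumes "smooth_fun N h" "p \<in> points M"
  shows "dfun M (\<lambda>q. h (F q)) p v = dfun N h (F p) (dmap M N F p v)"
proof -
  obtain A a where A: "chart_at M p = (A, a)" "(A, a) \<in> atlas M" "p \<in> A"
    using M.obtain_chart_at[OF assms(2)] .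
  obtain B b where B: "chart_at N (F p) = (B, b)" "(B, b) \<in> atlas N" "F p \<in> B"
    using N.obtain_chart_at[OF map_points[OF assms(2)]] .
  note AB = A(2) B(2)
  have val: "(b \<circ> F \<circ> chart_inv (A, a)) (a p) = b (F p)"
    by (simp add: M.chart_inv_image[OF A(2,3)])
  have "frechet_derivative ((\<lambda>q. h (F q)) \<circ> chart_inv (A, a)) (at (a p)) v =
    frechet_derivative (h \<circ> chart_inv (B, b)) (at ((b \<circ> F \<circ> chart_inv (A, a)) (a p)))
      (frechet_derivative (b \<circ> F \<circ> chart_inv (A, a)) (at (a p)) v)"
  proof (rule frechet_derivative_chain[OF chart_overlap(2)[OF AB]])
    show "a p \<in> a ` (A \<inter> F -` B)" using A B by blast
    then show "(b \<circ> F \<circ> chart_inv (A, a)) differentiable (at (a p))"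
      using smooth_on_differentiable[OF chart_overlap(3)[OF AB]] by blast
    show "(h \<circ> chart_inv (B, b)) differentiable (at ((b \<circ> F \<circ> chart_inv (A, a)) (a p)))"
      unfolding val by (rule N.smooth_fun_differentiable[OF assms(1) B(2,3)])
  qed (auto simp: M.chart_inv_image[OF A(2)] N.chart_inv_image[OF B(2)])
  then show ?thesis by (simp add: dfun_def dmap_def A B M.chart_inv_image[OF A(2,3)])
qed

text \<open>The differential is defined through the charts chosen at \<open>q\<close> and \<open>F q\<close>, which vary without
  any regularity; this is its expression in fixed charts.\<close>

lemma tcomp_dmap:
  assumes "(U, c) \<in> atlas M" "(V, d) \<in> atlas N" "q \<in> U" "F q \<in> V"
  shows "tcomp N (V, d) (F q) (dmap M N F q v)
    = frechet_derivative (d \<circ> F \<circ> chart_inv (U, c)) (at (c q)) (tcomp M (U, c) q v)"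
proof -
  have q: "q \<in> points M" using assms M.chart_subset by blast
  obtain A a where A: "chart_at M q = (A, a)" "(A, a) \<in> atlas M" "q \<in> A"
    using M.obtain_chart_at[OF q] .
  obtain B b where B: "chart_at N (F q) = (B, b)" "(B, b) \<in> atlas N" "F q \<in> B"
    using N.obtain_chart_at[OF map_points[OF q]] .
  note AB = A(2) B(2)
  have val: "(b \<circ> F \<circ> chart_inv (A, a)) (a q) = b (F q)"
    by (simp add: M.chart_inv_image[OF A(2,3)])
  have opV: "openin (mtop N) (B \<inter> V)"
    using B assms N.chart_openin by blast
  have "frechet_derivative (d \<circ> F \<circ> chart_inv (A, a)) (at (a q)) v =
    frechet_derivative (d \<circ> chart_inv (B, b)) (at ((b \<circ> F \<circ> chart_inv (A, a)) (a q)))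
      (frechet_derivative (b \<circ> F \<circ> chart_inv (A, a)) (at (a q)) v)"
  proof (rule frechet_derivative_chain)
    show "open (a ` (A \<inter> F -` (B \<inter> V)))"
      by (rule M.chart_image_open[OF A(2) map_preimage_open[OF M.chart_openin[OF A(2)] opV]]) blast
    show "a q \<in> a ` (A \<inter> F -` (B \<inter> V))" using A B assms by blast
    show "(b \<circ> F \<circ> chart_inv (A, a)) differentiable (at (a q))"
      by (rule smooth_on_differentiable[OF chart_overlap(3)[OF AB]]) (use A B in blast)
    show "(d \<circ> chart_inv (B, b)) differentiable (at ((b \<circ> F \<circ> chart_inv (A, a)) (a q)))"
      unfolding val by (rule smooth_on_differentiable[OF N.chart_transition[OF B(2) assms(2)]])
        (use B assms in blast)
  qed (auto simp: M.chart_inv_image[OF A(2)] N.chart_inv_image[OF B(2)])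
  then have "tcomp N (V, d) (F q) (dmap M N F q v) = frechet_derivative (d \<circ> F \<circ> chart_inv (A, a)) (at (a q)) v"
    by (simp add: tcomp_def dmap_def A B M.chart_inv_image[OF A(2,3)])
  also have "\<dots> = frechet_derivative (d \<circ> F \<circ> chart_inv (U, c)) (at (c q)) (tcomp M (U, c) q v)"
  proof -
    have "q \<in> U \<inter> F -` V" using assms by blast
    from M.transition_chain[OF A(2) assms(1) A(3) assms(3) chart_overlap(1)[OF assms(1,2)] this _ chart_overlap(3)[OF assms(1,2)]]
    show ?thesis by (simp add: tcomp_def A comp_assoc)
  qed
  finally show ?thesis .
qed

lemma dmap_linear:
  assumes "p \<in> points M"
  shows "linear (dmap M N F p)"
proof -
  obtain A a where A: "chart_at M p = (A, a)" "(A, a) \<in> atlas M" "p \<in> A"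
    using M.obtain_chart_at[OF assms] .
  obtain B b where B: "chart_at N (F p) = (B, b)" "(B, b) \<in> atlas N" "F p \<in> B"
    using N.obtain_chart_at[OF map_points[OF assms]] .
  have "linear (frechet_derivative (b \<circ> F \<circ> chart_inv (A, a)) (at (a p)))"
    by (rule smooth_on_linear_deriv[OF chart_overlap(3)[OF A(2) B(2)]]) (use A B in blast)
  then show ?thesis by (simp add: dmap_def[abs_def] A B)
qed

lemma dmap_section:
  assumes "vector_field M X"
  shows "section_along M N F (\<lambda>q. dmap M N F q (X q))"
proof (rule sectionI)
  fix U c V d assume UV: "(U, c) \<in> atlas M" "(V, d) \<in> atlas N"
  have X: "smooth_on (c ` U) ((\<lambda>y. tcomp M (U, c) y (X y)) \<circ> chart_inv (U, c))"
    using assms UV(1) unfolding vector_field_def section_along_def by force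
  have "smooth_on (c ` (U \<inter> F -` V)) (\<lambda>x. frechet_derivative (d \<circ> F \<circ> chart_inv (U, c)) (at x)
      (((\<lambda>y. tcomp M (U, c) y (X y)) \<circ> chart_inv (U, c)) x))"
    by (rule smooth_on_deriv_along[OF chart_overlap(2,3)[OF UV]], rule smooth_on_subset[OF X]) blast
  then show "smooth_on (c ` (U \<inter> F -` V)) ((\<lambda>q. tcomp N (V, d) (F q) (dmap M N F q (X q))) \<circ> chart_inv (U, c))"
    by (rule smooth_on_cong[OF chart_overlap(2)[OF UV]])
      (auto simp: M.chart_inv_image[OF UV(1)] tcomp_dmap[OF UV])
qed

end

context smooth_mfd
begin

lemma identity_map: "smooth_mfd_map M M (\<lambda>p. p)"
proof
  have "(\<lambda>p. p) -` V = V" for V :: "'a set" by blast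
  then show "smooth_map M M (\<lambda>p. p)"
    using chart_transition unfolding smooth_map_def by (auto simp: comp_def)
qed

lemma vector_field_chart:
  assumes "vector_field M X" "(U, c) \<in> atlas M"
  shows "smooth_on (c ` U) ((\<lambda>y. tcomp M (U, c) y (X y)) \<circ> chart_inv (U, c))"
  using assms unfolding vector_field_def section_along_def by force

text \<open>A coordinate field is multiplied by a plateau function. The last conclusion says that the
  extension is everywhere a multiple of the given field, so that linear conditions such as being
  vertical survive.\<close>

lemma extend_field:
  assumes U: "(U, c) \<in> atlas M" "p \<in> U" and A: "open A" "c p \<in> A" "A \<subseteq> c ` U" and w: "smooth_on A w"
  shows "\<exists>X T. vector_field M X \<and> openin (mtop M) T \<and> p \<in> T \<and> T \<subseteq> {q \<in> U. c q \<in> A} \<and>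
    (\<forall>q\<in>T. tcomp M (U, c) q (X q) = w (c q)) \<and>
    (\<forall>q. X q = 0 \<or> q \<in> U \<and> c q \<in> A \<and> (\<exists>r. tcomp M (U, c) q (X q) = r *\<^sub>R w (c q)))"
proof -
  interpret I: smooth_mfd_map M M "\<lambda>p. p" by (rule identity_map)
  obtain f T K where f: "smooth_fun M f" "openin (mtop M) T" "p \<in> T" "T \<subseteq> K" "closedin (mtop M) K"
    "K \<subseteq> {q \<in> U. c q \<in> A}" "\<And>q. q \<in> T \<Longrightarrow> f q = 1" "\<And>q. q \<notin> K \<Longrightarrow> f q = 0"
    using plateau_function[OF U A] by blast
  define Y where "Y = (\<lambda>q. SOME v. tcomp M (U, c) q v = w (c q))"
  have Y: "tcomp M (U, c) q (Y q) = w (c q)" if "q \<in> U" for q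
    unfolding Y_def using someI_ex[OF tcomp_surj[OF U(1) that]] .
  let ?X = "\<lambda>q. f q *\<^sub>R Y q"
  have X: "tcomp M (U, c) q (?X q) = f q *\<^sub>R w (c q)" if "q \<in> U" for q
    by (simp add: linear_scale[OF tcomp_linear[OF U(1) that]] Y[OF that])
  have "vector_field M ?X"
    unfolding vector_field_def
  proof (rule I.section_local)
    fix q assume q: "q \<in> points M"
    show "\<exists>U c V d T. (U, c) \<in> atlas M \<and> (V, d) \<in> atlas M \<and> openin (mtop M) T \<and> q \<in> T \<and>
      T \<subseteq> U \<inter> (\<lambda>p. p) -` V \<and> smooth_on (c ` T) ((\<lambda>q. tcomp M (V, d) q (?X q)) \<circ> chart_inv (U, c))"
    proof (cases "q \<in> K")
      case True
      let ?T = "{q \<in> U. c q \<in> A}"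
      have im: "c ` ?T = A" using A(3) by auto
      have "smooth_on A (\<lambda>x. (f \<circ> chart_inv (U, c)) x *\<^sub>R w x)"
        by (rule smooth_on_scaleR[OF A(1) smooth_on_subset[OF smooth_fun_chart[OF f(1) U(1)] A(3)] w])
      then have "smooth_on A ((\<lambda>q. tcomp M (U, c) q (?X q)) \<circ> chart_inv (U, c))"
        by (rule smooth_on_cong[OF A(1)]) (use chart_inv_right[OF U(1)] A(3) X in \<open>auto simp: subsetD\<close>)
      then show ?thesis
        using U chart_preimage_open[OF U(1) A(1)] True f(6) im
        by (intro exI[of _ U] exI[of _ c] exI[of _ U] exI[of _ c] exI[of _ ?T]) auto
    next
      case False
      obtain V d where V: "(V, d) \<in> atlas M" "q \<in> V" using obtain_chart[OF q] .
      let ?T = "V \<inter> (points M - K)"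
      have T: "openin (mtop M) ?T" using f(5) V chart_openin by blast
      have "smooth_on (d ` ?T) ((\<lambda>q. tcomp M (V, d) q (?X q)) \<circ> chart_inv (V, d))"
        by (rule smooth_on_cong[OF chart_image_open[OF V(1) T] smooth_on_const[of _ 0]])
          (use f(8) in \<open>auto simp: chart_inv_image[OF V(1)] linear_0[OF tcomp_linear[OF V(1)]]\<close>)
      then show ?thesis
        using V T False q
        by (intro exI[of _ V] exI[of _ d] exI[of _ V] exI[of _ d] exI[of _ ?T]) auto
    qed
  qed
  moreover have "?X q = 0 \<or> q \<in> U \<and> c q \<in> A \<and> (\<exists>r. tcomp M (U, c) q (?X q) = r *\<^sub>R w (c q))" for q
    using f(6) f(8)[of q] X by (cases "q \<in> K") auto
  moreover have "tcomp M (U, c) q (?X q) = w (c q)" if "q \<in> T" for q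
    using X[of q] f(4,6,7) that by auto
  ultimately show ?thesis
    using f by (intro exI[of _ ?X] exI[of _ T]) blast
qed

end

section \<open>Orthogonal projections\<close>

definition inner_form :: "('e::real_vector \<Rightarrow> 'e \<Rightarrow> real) \<Rightarrow> bool" where
  "inner_form g \<longleftrightarrow> bilinear g \<and> (\<forall>v w. g v w = g w v) \<and> (\<forall>v. v \<noteq> 0 \<longrightarrow> g v v > 0)"

lemma inner_form_bilinear: "inner_form g \<Longrightarrow> bilinear g"
  and inner_form_sym: "inner_form g \<Longrightarrow> g v w = g w v"
  and inner_form_eq_0: "inner_form g \<Longrightarrow> g v v = 0 \<longleftrightarrow> v = 0"
  unfolding inner_form_def by (auto simp: bilinear_lzero)

lemmas bilinear_simps = bilinear_ladd bilinear_radd bilinear_lmul bilinear_rmul bilinear_lneg bilinear_rneg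
  bilinear_lzero bilinear_rzero bilinear_lsub bilinear_rsub

text \<open>The Gram-Schmidt step: \<open>b - z\<close> is the part of the new vector \<open>b\<close> that is orthogonal to the previous ones, and
  the projection of \<open>v\<close> to its line is added.\<close>

lemma orth_decomposition_finite:
  assumes g: "inner_form g" and "finite B"
  shows "\<exists>w\<in>span B. \<forall>u\<in>span B. g (v - w) u = 0"
  using assms(2)
proof (induction B arbitrary: v rule: finite_induct)
  case empty
  then show ?case by (simp add: bilinear_rzero[OF inner_form_bilinear[OF g]])
next
  case (insert b B)
  note bil = bilinear_simps[OF inner_form_bilinear[OF g]]
  obtain w where w: "w \<in> span B" "\<And>u. u \<in> span B \<Longrightarrow> g (v - w) u = 0"
    using insert.IH[of v] by blast
  obtain z where z: "z \<in> span B" "\<And>u. u \<in> span B \<Longrightarrow> g (b - z) u = 0"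
    using insert.IH[of b] by blast
  have mono: "span B \<subseteq> span (insert b B)" by (rule span_mono) blast
  show ?case
  proof (cases "b - z = 0")
    case True
    then have "span (insert b B) = span B" using z(1) by (simp add: span_redundant)
    then show ?thesis using w by blast
  next
    case False
    then have nz: "g (b - z) (b - z) \<noteq> 0" using inner_form_eq_0[OF g] by blast
    define c where "c = g v (b - z) / g (b - z) (b - z)"
    have "w + c *\<^sub>R (b - z) \<in> span (insert b B)"
      using w(1) z(1) mono by (intro span_add span_scale span_diff) (auto intro: span_base)
    moreover have "g (v - (w + c *\<^sub>R (b - z))) u = 0" if uB: "u \<in> span (insert b B)" for u
    proof -
      obtain k where k: "u - k *\<^sub>R b \<in> span B" using uB span_breakdown_eq by blast
      define u' where "u' = (u - k *\<^sub>R b) + k *\<^sub>R z"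
      have u': "u' \<in> span B" using k z(1) unfolding u'_def by (intro span_add span_scale)
      have u: "u = u' + k *\<^sub>R (b - z)" by (simp add: u'_def algebra_simps)
      have "g w (b - z) = 0" using z(2)[OF w(1)] inner_form_sym[OF g] by metis
      then have "g (v - (w + c *\<^sub>R (b - z))) (b - z) = 0"
        using nz by (simp add: bil(1,3,9) c_def)
      moreover have "g (v - (w + c *\<^sub>R (b - z))) u' = 0"
        using w(2)[OF u'] z(2)[OF u'] by (simp add: bil(1,3,9))
      ultimately show ?thesis unfolding u by (simp add: bil(2,4))
    qed
    ultimately show ?thesis by blast
  qed
qed

lemma orth_proj_unique:
  assumes g: "inner_form g" and S: "subspace S" and w: "w \<in> S" "\<And>u. u \<in> S \<Longrightarrow> g (v - w) u = 0"
  shows "orth_proj g S v = w"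
  unfolding orth_proj_def
proof (rule the_equality)
  fix z assume z: "z \<in> S \<and> (\<forall>u\<in>S. g (v - z) u = 0)"
  then have d: "z - w \<in> S" using S w(1) by (simp add: subspace_diff)
  have "g (z - w) (z - w) = g ((v - w) - (v - z)) (z - w)" by simp
  also have "\<dots> = 0"
    using z w(2)[OF d] d unfolding bilinear_lsub[OF inner_form_bilinear[OF g]] by simp
  finally show "z = w" using inner_form_eq_0[OF g] by simp
qed (use w in blast)

lemma orth_proj:
  fixes S :: "'e::euclidean_space set"
  assumes g: "inner_form g" and S: "subspace S"
  shows "orth_proj g S v \<in> S" "u \<in> S \<Longrightarrow> g (v - orth_proj g S v) u = 0"
proof -
  obtain B where B: "finite B" "span B = S"
    by (metis S basis_subspace_exists)
  obtain w where "w \<in> S" "\<And>u. u \<in> S \<Longrightarrow> g (v - w) u = 0"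
    using orth_decomposition_finite[OF g B(1), of v] unfolding B(2) by blast
  with orth_proj_unique[OF g S this]
  show "orth_proj g S v \<in> S" "u \<in> S \<Longrightarrow> g (v - orth_proj g S v) u = 0" by auto
qed

lemma orth_proj_member:
  assumes "inner_form g" "subspace S" "v \<in> S"
  shows "orth_proj g S v = v"
  using assms by (intro orth_proj_unique) (simp_all add: bilinear_lzero[OF inner_form_bilinear])

lemma orth_proj_orthogonal:
  assumes "inner_form g" "subspace S" "\<And>u. u \<in> S \<Longrightarrow> g v u = 0"
  shows "orth_proj g S v = 0"
  using assms by (intro orth_proj_unique) (simp_all add: subspace_0)

lemma riemannian_inner_form: "riemannian_manifold M g \<Longrightarrow> p \<in> points M \<Longrightarrow> inner_form (g p)"
  unfolding riemannian_manifold_def inner_form_def by blast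

section \<open>Connections along a map\<close>

context smooth_mfd_map
begin

lemma connection_add:
  assumes "connection_along M N F D" "p \<in> points M" "section_along M N F s" "section_along M N F t"
  shows "D p v (\<lambda>q. s q + t q) = D p v s + D p v t"
  using assms unfolding connection_along_def by blast

lemma connection_scale:
  assumes "connection_along M N F D" "p \<in> points M" "smooth_fun M f" "section_along M N F s"
  shows "D p v (\<lambda>q. f q *\<^sub>R s q) = dfun M f p v *\<^sub>R s p + f p *\<^sub>R D p v s"
  using assms unfolding connection_along_def by blast

text \<open>Multiplying both sections by a function that is \<open>1\<close> at \<open>p\<close> and vanishes off the neighbourhood makes
  them equal, and by the Leibniz rule this changes their covariant derivatives at \<open>p\<close> by the same
  amount.\<close>

lemma connection_local:
  assumes D: "connection_along M N F D" and T: "openin (mtop M) T" "p \<in> T" "\<And>q. q \<in> T \<Longrightarrow> s q = t q"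
    and s: "section_along M N F s" and t: "section_along M N F t"
  shows "D p v s = D p v t"
proof -
  have p: "p \<in> points M" using T openin_subset by blast
  obtain f where f: "smooth_fun M f" "f p = 1" "\<And>q. q \<notin> T \<Longrightarrow> f q = 0"
    using M.bump_function[OF T(1,2)] by blast
  have "(\<lambda>q. f q *\<^sub>R s q) = (\<lambda>q. f q *\<^sub>R t q)"
    using f(3) T(3) by (metis scaleR_zero_left)
  then have "D p v (\<lambda>q. f q *\<^sub>R s q) = D p v (\<lambda>q. f q *\<^sub>R t q)" by simp
  then show ?thesis
    using connection_scale[OF D p f(1) s] connection_scale[OF D p f(1) t] f(2) T(2,3) by simp
qed

text \<open>Sections are functions on the whole type; their values off the manifold are immaterial.\<close>

lemma connection_cong:
  assumes "connection_along M N F D" "p \<in> points M" "section_along M N F s" "\<And>q. q \<in> points M \<Longrightarrow> s q = t q"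
  shows "D p v s = D p v t"
  using connection_local[OF assms(1) openin_topspace assms(2,4,3) section_cong[OF assms(3,4)]] .

lemma connection_zero:
  assumes D: "connection_along M N F D" and p: "p \<in> points M" and s: "\<And>q. q \<in> points M \<Longrightarrow> s q = 0"
  shows "D p v s = 0"
proof -
  have "D p v (\<lambda>q. 0) = 0"
    using connection_scale[OF D p M.smooth_fun_const[of 0] section_zero] by (simp add: M.dfun_const)
  then show ?thesis
    using connection_cong[OF D p section_zero, of s] s by metis
qed

lemma connection_sum:
  assumes D: "connection_along M N F D" and p: "p \<in> points M" and "finite I"
    and s: "\<And>i. i \<in> I \<Longrightarrow> section_along M N F (s i)"
  shows "D p v (\<lambda>q. \<Sum>i\<in>I. s i q) = (\<Sum>i\<in>I. D p v (s i))"
  using assms(3) s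
proof (induction I rule: finite_induct)
  case empty
  show ?case using connection_zero[OF D p] by simp
next
  case (insert i I)
  have "D p v (\<lambda>q. s i q + (\<Sum>i\<in>I. s i q)) = D p v (s i) + D p v (\<lambda>q. \<Sum>i\<in>I. s i q)"
    using insert.prems by (intro connection_add[OF D p] section_sum) auto
  then show ?case using insert by simp
qed

text \<open>Near \<open>p\<close> a section along \<open>F\<close> is a combination of sections of the form \<open>Z \<circ> F\<close>, on which the
  pullback connection is known. The fields \<open>Z i\<close> extend the coordinate frame of \<open>N\<close>, and the
  coefficients extend the components of the section.\<close>

lemma section_expansion:
  assumes s: "section_along M N F s" and p: "p \<in> points M"
    and A: "chart_at M p = (A, a)" and B: "chart_at N (F p) = (B, b)"
  obtains S Z T where "\<forall>i. smooth_fun M (S i)" "\<forall>i. vector_field N (Z i)" "\<forall>i. Z i (F p) = i"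
    "openin (mtop M) T" "p \<in> T" "T \<subseteq> A \<inter> F -` B"
    "\<forall>q\<in>T. s q = (\<Sum>i\<in>Basis. S i q *\<^sub>R Z i (F q))"
    "\<forall>q\<in>T. \<forall>i\<in>Basis. S i q = tcomp N (B, b) (F q) (s q) \<bullet> i"
proof -
  have A': "(A, a) \<in> atlas M" "p \<in> A" using M.chart_at_atlas[OF p] A by auto
  have B': "(B, b) \<in> atlas N" "F p \<in> B" using N.chart_at_atlas[OF map_points[OF p]] B by auto
  note AB = A'(1) B'(1)
  have bB: "open (b ` B)" "b (F p) \<in> b ` B" using N.chart_open_image[OF B'(1)] B'(2) by auto
  have "\<exists>Z R. vector_field N Z \<and> openin (mtop N) R \<and> F p \<in> R \<and> R \<subseteq> B \<and> (\<forall>y\<in>R. tcomp N (B, b) y (Z y) = i)" for i :: 'f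
    using N.extend_field[OF B' bB subset_refl smooth_on_const[of _ i]] by blast
  then obtain Z R where Z: "\<And>i. vector_field N (Z i)" "\<And>i. openin (mtop N) (R i)" "\<And>i. F p \<in> R i"
    "\<And>i y. y \<in> R i \<Longrightarrow> tcomp N (B, b) y (Z i y) = i"
    by metis
  let ?\<sigma> = "(\<lambda>q. tcomp N (B, b) (F q) (s q)) \<circ> chart_inv (A, a)"
  have \<sigma>: "smooth_on (a ` (A \<inter> F -` B)) (\<lambda>x. ?\<sigma> x \<bullet> i)" for i
    by (rule smooth_on_inner[OF chart_overlap(2)[OF AB] section_chart[OF s AB] smooth_on_const])
  define P where "P i f Q \<longleftrightarrow> smooth_fun M f \<and> openin (mtop M) Q \<and> p \<in> Q \<and> Q \<subseteq> A \<and>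
    (\<forall>q\<in>Q. f q = ?\<sigma> (a q) \<bullet> i)" for i f Q
  have "\<exists>f Q. P i f Q" for i
    using M.extend_function[OF A' chart_overlap(2)[OF AB] _ _ \<sigma>[of i]] A' B' unfolding P_def by blast
  then obtain S Q where "\<And>i. P i (S i) (Q i)" by metis
  then have S: "\<And>i. smooth_fun M (S i)" "\<And>i. openin (mtop M) (Q i)" "\<And>i. p \<in> Q i" "\<And>i. Q i \<subseteq> A"
    "\<And>i q. q \<in> Q i \<Longrightarrow> S i q = ?\<sigma> (a q) \<bullet> i"
    unfolding P_def by blast+
  let ?T = "(A \<inter> F -` B) \<inter> (\<Inter>i\<in>Basis. Q i \<inter> F -` R i)"
  have "openin (mtop M) (\<Inter>i\<in>Basis. Q i \<inter> F -` R i)"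
    using S(2) Z(2) by (intro openin_INT2 map_preimage_open) auto
  then have opT: "openin (mtop M) ?T" using chart_overlap(1)[OF AB] by blast
  have pT: "p \<in> ?T" using A' B' S(3) Z(3) by blast
  have Sq: "S i q = tcomp N (B, b) (F q) (s q) \<bullet> i" if "q \<in> ?T" "i \<in> Basis" for q i
    using S(5)[of q i] that M.chart_inv_image[OF A'(1)] by simp
  have sq: "s q = (\<Sum>i\<in>Basis. S i q *\<^sub>R Z i (F q))" if q: "q \<in> ?T" for q
  proof -
    have FqB: "F q \<in> B" using q by blast
    note lin = N.tcomp_linear[OF B'(1) FqB]
    have "tcomp N (B, b) (F q) (\<Sum>i\<in>Basis. S i q *\<^sub>R Z i (F q))
      = (\<Sum>i\<in>Basis. S i q *\<^sub>R tcomp N (B, b) (F q) (Z i (F q)))"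
      by (simp add: linear_sum[OF lin] linear_scale[OF lin])
    also have "\<dots> = (\<Sum>i\<in>Basis. (tcomp N (B, b) (F q) (s q) \<bullet> i) *\<^sub>R i)"
      by (rule sum.cong) (use q Sq Z(4) in auto)
    also have "\<dots> = tcomp N (B, b) (F q) (s q)" by (rule euclidean_representation)
    finally show ?thesis using N.tcomp_inj[OF B'(1) FqB] by metis
  qed
  have Zp: "Z i (F p) = i" for i
    using Z(4)[OF Z(3)] N.tcomp_chart_at[OF map_points[OF p] B] by metis
  have sub: "?T \<subseteq> A \<inter> F -` B" by blast
  show thesis
  proof (rule that)
    show "\<forall>i. smooth_fun M (S i)" "\<forall>i. vector_field N (Z i)" "\<forall>i. Z i (F p) = i"
      using S(1) Z(1) Zp by blast+
    show "openin (mtop M) ?T" "p \<in> ?T" "?T \<subseteq> A \<inter> F -` B" by (fact opT pT sub)+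
    show "\<forall>q\<in>?T. s q = (\<Sum>i\<in>Basis. S i q *\<^sub>R Z i (F q))" by (rule ballI) (rule sq)
    show "\<forall>q\<in>?T. \<forall>i\<in>Basis. S i q = tcomp N (B, b) (F q) (s q) \<bullet> i" by (intro ballI) (rule Sq)
  qed
qed

text \<open>In a vertical direction the connection of \<open>N\<close> contributes nothing, so only the
  coefficients in a frame \<open>Z \<circ> F\<close> are differentiated.\<close>

lemma pullback_deriv_kernel:
  assumes D: "pullback_connection M N F nablaN D" and nablaN: "affine_connection N nablaN"
    and s: "section_along M N F s" and p: "p \<in> points M" and v: "dmap M N F p v = 0"
    and A: "chart_at M p = (A, a)" and B: "chart_at N (F p) = (B, b)"
  shows "D p v s = frechet_derivative ((\<lambda>q. tcomp N (B, b) (F q) (s q)) \<circ> chart_inv (A, a)) (at (a p)) v"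
proof -
  have conn: "connection_along M N F D"
    and DZ: "\<And>Z. vector_field N Z \<Longrightarrow> D p v (\<lambda>q. Z (F q)) = nablaN (F p) (dmap M N F p v) Z"
    using D p unfolding pullback_connection_def by blast+
  have A': "(A, a) \<in> atlas M" "p \<in> A" using M.chart_at_atlas[OF p] A by auto
  have B': "(B, b) \<in> atlas N" "F p \<in> B" using N.chart_at_atlas[OF map_points[OF p]] B by auto
  note AB = A'(1) B'(1)
  let ?\<sigma> = "(\<lambda>q. tcomp N (B, b) (F q) (s q)) \<circ> chart_inv (A, a)"
  obtain S Z T where *: "\<forall>i. smooth_fun M (S i)" "\<forall>i. vector_field N (Z i)" "\<forall>i. Z i (F p) = i"
    and T: "openin (mtop M) T" "p \<in> T" "T \<subseteq> A \<inter> F -` B"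
    and exp': "\<forall>q\<in>T. s q = (\<Sum>i\<in>Basis. S i q *\<^sub>R Z i (F q))"
      "\<forall>q\<in>T. \<forall>i\<in>Basis. S i q = tcomp N (B, b) (F q) (s q) \<bullet> i"
    by (rule section_expansion[OF s p A B]) (rule that)
  note SZ = *[rule_format] and exp = exp'[rule_format]
  have sec: "section_along M N F (\<lambda>q. S i q *\<^sub>R Z i (F q))" for i
    by (rule section_scale[OF SZ(1) section_compose[OF SZ(2)]])
  have "D p v s = D p v (\<lambda>q. \<Sum>i\<in>Basis. S i q *\<^sub>R Z i (F q))"
    by (rule connection_local[OF conn T(1,2) exp(1) s section_sum[OF sec]])
  also have "\<dots> = (\<Sum>i\<in>Basis. D p v (\<lambda>q. S i q *\<^sub>R Z i (F q)))"
    by (rule connection_sum[OF conn p finite_Basis sec])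
  also have "\<dots> = (\<Sum>i\<in>Basis. (frechet_derivative ?\<sigma> (at (a p)) v \<bullet> i) *\<^sub>R i)"
  proof (rule sum.cong[OF refl])
    fix i :: 'f assume i: "i \<in> Basis"
    have "linear (\<lambda>v. nablaN (F p) v (Z i))"
      using nablaN SZ(2)[of i] map_points[OF p]
      unfolding affine_connection_def connection_along_def vector_field_def by blast
    then have "nablaN (F p) (dmap M N F p v) (Z i) = 0"
      unfolding v by (rule linear_0)
    then have "D p v (\<lambda>q. S i q *\<^sub>R Z i (F q)) = dfun M (S i) p v *\<^sub>R i"
      using connection_scale[OF conn p SZ(1) section_compose[OF SZ(2)]] DZ[OF SZ(2)] SZ(3)[of i]
      by simp
    moreover have "dfun M (S i) p v = frechet_derivative ?\<sigma> (at (a p)) v \<bullet> i"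
    proof -
      have dif: "?\<sigma> differentiable (at (a p))"
        by (rule smooth_on_differentiable[OF section_chart[OF s AB]]) (use A' B' in blast)
      have "frechet_derivative (S i \<circ> chart_inv (A, a)) (at (a p)) = frechet_derivative (\<lambda>x. ?\<sigma> x \<bullet> i) (at (a p))"
      proof (rule frechet_derivative_transform_within_open)
        show "(S i \<circ> chart_inv (A, a)) differentiable (at (a p))"
          by (rule M.smooth_fun_differentiable[OF SZ(1) A'])
        show "open (a ` T)" by (rule M.chart_image_open[OF A'(1) T(1)]) (use T(3) in blast)
        show "a p \<in> a ` T" using T(2) by blast
        fix x assume "x \<in> a ` T"
        then obtain q where "q \<in> T" "x = a q" by blast
        then show "(S i \<circ> chart_inv (A, a)) x = ?\<sigma> x \<bullet> i"
          using T(3) exp(2)[OF _ i] M.chart_inv_image[OF A'(1), of q] by auto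
      qed
      then show ?thesis
        using frechet_derivative_inner[OF dif, of i v] by (simp add: dfun_def A)
    qed
    ultimately show "D p v (\<lambda>q. S i q *\<^sub>R Z i (F q)) = (frechet_derivative ?\<sigma> (at (a p)) v \<bullet> i) *\<^sub>R i"
      by simp
  qed
  also have "\<dots> = frechet_derivative ?\<sigma> (at (a p)) v" by (rule euclidean_representation)
  finally show ?thesis .
qed

text \<open>In coordinates, \<open>D\<^sub>W F\<^sub>*X\<close> is the derivative of \<open>f'(X)\<close> along \<open>W\<close>, that is \<open>f'(X'(W)) + f''(W, X)\<close>,
  where \<open>f\<close> stands for \<open>F\<close>. Differentiating \<open>f'(W) = 0\<close> along \<open>X\<close> gives \<open>f''(X, W) = -f'(W'(X))\<close>, and
  what remains is the image of the bracket \<open>X'(W) - W'(X)\<close>.\<close>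

lemma pullback_torsion_vertical:
  assumes D: "pullback_connection M N F nablaN D" and nablaN: "affine_connection N nablaN"
    and X: "vector_field M X" and W: "vertical_field M N F W" and p: "p \<in> points M"
  shows "D p (W p) (\<lambda>q. dmap M N F q (X q)) = dmap M N F p (lie_bracket M W X p)"
proof -
  have Wf: "vector_field M W" and Wv: "\<And>q. q \<in> points M \<Longrightarrow> dmap M N F q (W q) = 0"
    using W unfolding vertical_field_def vertical_space_def by auto
  obtain A a where A: "chart_at M p = (A, a)" "(A, a) \<in> atlas M" "p \<in> A"
    using M.obtain_chart_at[OF p] .
  obtain B b where B: "chart_at N (F p) = (B, b)" "(B, b) \<in> atlas N" "F p \<in> B"
    using N.obtain_chart_at[OF map_points[OF p]] .
  note AB = A(2) B(2) and op = chart_overlap(2)[OF A(2) B(2)]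
  let ?S = "a ` (A \<inter> F -` B)"
  let ?f = "b \<circ> F \<circ> chart_inv (A, a)"
  let ?loc = "\<lambda>Z. (\<lambda>q. tcomp M (A, a) q (Z q)) \<circ> chart_inv (A, a)"
  have x0: "a p \<in> ?S" using A B by blast
  have loc: "smooth_on ?S (?loc Z)" if "vector_field M Z" for Z
    by (rule smooth_on_subset[OF M.vector_field_chart[OF that A(2)]]) blast
  have loc_p: "?loc Z (a p) = Z p" for Z
    by (simp add: M.chart_inv_image[OF A(2,3)] M.tcomp_chart_at[OF p A(1)])
  have comp: "((\<lambda>q. tcomp N (B, b) (F q) (dmap M N F q (Z q))) \<circ> chart_inv (A, a)) y
      = frechet_derivative ?f (at y) (?loc Z y)" if "y \<in> ?S" for Z y
    using that by (auto simp: M.chart_inv_image[OF A(2)] tcomp_dmap[OF AB])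
  have der: "frechet_derivative ((\<lambda>q. tcomp N (B, b) (F q) (dmap M N F q (Z q))) \<circ> chart_inv (A, a)) (at (a p)) w
      = frechet_derivative ?f (at (a p)) (frechet_derivative (?loc Z) (at (a p)) w)
        + frechet_derivative (\<lambda>y. frechet_derivative ?f (at y) w) (at (a p)) (Z p)"
    if Z: "vector_field M Z" for Z w
  proof -
    have "frechet_derivative ((\<lambda>q. tcomp N (B, b) (F q) (dmap M N F q (Z q))) \<circ> chart_inv (A, a)) (at (a p))
        = frechet_derivative (\<lambda>y. frechet_derivative ?f (at y) (?loc Z y)) (at (a p))"
      by (rule frechet_derivative_transform_within_open[OF
            smooth_on_differentiable[OF section_chart[OF dmap_section[OF Z] AB] x0] op x0 comp])
    then show ?thesis
      using frechet_derivative_deriv_along[OF op chart_overlap(3)[OF AB] loc[OF Z] x0, of w] loc_p[of Z] by simp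
  qed
  have bracket: "lie_bracket M W X p
      = frechet_derivative (?loc X) (at (a p)) (W p) - frechet_derivative (?loc W) (at (a p)) (X p)"
    by (simp add: lie_bracket_def A Let_def)
  have dm: "dmap M N F p v = frechet_derivative ?f (at (a p)) v" for v
    by (simp add: dmap_def A B)
  have "D p (W p) (\<lambda>q. dmap M N F q (X q))
      = frechet_derivative ?f (at (a p)) (frechet_derivative (?loc X) (at (a p)) (W p))
        + frechet_derivative (\<lambda>y. frechet_derivative ?f (at y) (W p)) (at (a p)) (X p)"
    using pullback_deriv_kernel[OF D nablaN dmap_section[OF X] p Wv[OF p] A(1) B(1)] der[OF X] by simp
  also have "frechet_derivative (\<lambda>y. frechet_derivative ?f (at y) (W p)) (at (a p)) (X p)
      = frechet_derivative (\<lambda>y. frechet_derivative ?f (at y) (X p)) (at (a p)) (W p)"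
    by (rule symmetric_second_derivative[OF op chart_overlap(3)[OF AB] x0])
  also have "\<dots> = - frechet_derivative ?f (at (a p)) (frechet_derivative (?loc W) (at (a p)) (X p))"
  proof -
    have "frechet_derivative (\<lambda>x. 0) (at (a p))
      = frechet_derivative ((\<lambda>q. tcomp N (B, b) (F q) (dmap M N F q (W q))) \<circ> chart_inv (A, a)) (at (a p))"
    proof (rule frechet_derivative_transform_within_open[OF _ op x0])
      fix y assume "y \<in> ?S"
      then obtain q where q: "q \<in> A" "F q \<in> B" "y = a q" by blast
      then have "dmap M N F q (W q) = 0" using Wv M.chart_subset[OF A(2)] by blast
      then show "0 = ((\<lambda>q. tcomp N (B, b) (F q) (dmap M N F q (W q))) \<circ> chart_inv (A, a)) y"
        using q by (simp add: M.chart_inv_image[OF A(2)] linear_0[OF N.tcomp_linear[OF B(2)]])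
    qed simp
    from fun_cong[OF this, of "X p"] show ?thesis using der[OF Wf, of "X p"]
      by (simp add: eq_neg_iff_add_eq_0 add.commute)
  qed
  finally show ?thesis
    unfolding bracket dm linear_diff[OF smooth_on_linear_deriv[OF chart_overlap(3)[OF AB] x0]]
    by (simp only: diff_conv_add_uminus)
qed

section \<open>Metric compatibility of the pullback connection\<close>

text \<open>The product rule holds for sections of the form \<open>Z \<circ> F\<close>, where it is the one on \<open>N\<close>, and it
  is stable under sums and under multiplication by functions. Hence it holds for
  the local expansions of \<open>s\<close> and \<open>t\<close>. The derivative of their product is zero as the product is
  constant.\<close>

lemma pullback_metric:
  assumes D: "pullback_connection M N F nablaN D" and lc: "levi_civita N gN nablaN"
    and gN: "riemannian_manifold N gN"
    and s: "section_along M N F s" and t: "section_along M N F t" and p: "p \<in> points M"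
    and const: "\<And>q. q \<in> points M \<Longrightarrow> gN (F q) (s q) (t q) = k"
  shows "gN (F p) (D p v s) (t p) + gN (F p) (s p) (D p v t) = 0"
proof -
  have conn: "connection_along M N F D"
    and DZ: "\<And>Z. vector_field N Z \<Longrightarrow> D p v (\<lambda>q. Z (F q)) = nablaN (F p) (dmap M N F p v) Z"
    using D p unfolding pullback_connection_def by blast+
  note bil = bilinear_simps[OF inner_form_bilinear[OF riemannian_inner_form[OF gN map_points]]]
  \<comment> \<open>the product rule at \<open>p\<close> in the direction \<open>v\<close>, together with what is needed to combine instances\<close>
  define MC where "MC s t \<longleftrightarrow> section_along M N F s \<and> section_along M N F t \<and>
    smooth_fun M (\<lambda>q. gN (F q) (s q) (t q)) \<and>
    dfun M (\<lambda>q. gN (F q) (s q) (t q)) p v = gN (F p) (D p v s) (t p) + gN (F p) (s p) (D p v t)" for s t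
  have sym: "MC t s" if "MC s t" for s t
  proof -
    have eq: "gN (F q) (s q) (t q) = gN (F q) (t q) (s q)" if "q \<in> points M" for q
      by (rule inner_form_sym[OF riemannian_inner_form[OF gN map_points[OF that]]])
    have "smooth_fun M (\<lambda>q. gN (F q) (t q) (s q))"
      by (rule M.smooth_fun_cong[OF _ eq]) (use that MC_def in blast)
    moreover have "dfun M (\<lambda>q. gN (F q) (s q) (t q)) p v = dfun M (\<lambda>q. gN (F q) (t q) (s q)) p v"
      by (rule M.dfun_cong[OF _ openin_topspace p eq]) (use that MC_def in blast)
    ultimately show ?thesis
      using that inner_form_sym[OF riemannian_inner_form[OF gN map_points[OF p]]] unfolding MC_def by (metis add.commute)
  qed
  have scale: "MC (\<lambda>q. f q *\<^sub>R s q) t" if "MC s t" "smooth_fun M f" for f s t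
  proof -
    have st: "section_along M N F s" "smooth_fun M (\<lambda>q. gN (F q) (s q) (t q))" using that MC_def by blast+
    have eq: "f q * gN (F q) (s q) (t q) = gN (F q) (f q *\<^sub>R s q) (t q)" if "q \<in> points M" for q
      using bil(3)[OF that] by simp
    note sm = M.smooth_fun_mult[OF that(2) st(2)]
    have "dfun M (\<lambda>q. gN (F q) (f q *\<^sub>R s q) (t q)) p v = dfun M (\<lambda>q. f q * gN (F q) (s q) (t q)) p v"
      by (rule M.dfun_cong[OF sm openin_topspace p eq, symmetric])
    then show ?thesis
      using that M.smooth_fun_cong[OF sm eq] section_scale[OF that(2) st(1)] M.dfun_mult[OF that(2) st(2) p, of v]
        connection_scale[OF conn p that(2) st(1), of v]
      unfolding MC_def by (simp add: bil[OF p] algebra_simps)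
  qed
  have add: "MC (\<lambda>q. s q + s' q) t" if "MC s t" "MC s' t" for s s' t
  proof -
    have st: "section_along M N F s" "smooth_fun M (\<lambda>q. gN (F q) (s q) (t q))"
      "section_along M N F s'" "smooth_fun M (\<lambda>q. gN (F q) (s' q) (t q))" using that MC_def by blast+
    have eq: "gN (F q) (s q) (t q) + gN (F q) (s' q) (t q) = gN (F q) (s q + s' q) (t q)" if "q \<in> points M" for q
      using bil(1)[OF that] by simp
    note sm = M.smooth_fun_add[OF st(2,4)]
    have "dfun M (\<lambda>q. gN (F q) (s q + s' q) (t q)) p v = dfun M (\<lambda>q. gN (F q) (s q) (t q) + gN (F q) (s' q) (t q)) p v"
      by (rule M.dfun_cong[OF sm openin_topspace p eq, symmetric])
    then show ?thesis
      using that M.smooth_fun_cong[OF sm eq] section_add[OF st(1,3)] M.dfun_add[OF st(2,4) p, of v]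
        connection_add[OF conn p st(1,3), of v]
      unfolding MC_def by (simp add: bil[OF p] algebra_simps)
  qed
  have base: "MC (\<lambda>q. Y (F q)) (\<lambda>q. Z (F q))" if "vector_field N Y" "vector_field N Z" for Y Z
  proof -
    have h: "smooth_fun N (\<lambda>y. gN y (Y y) (Z y))"
      using gN that unfolding riemannian_manifold_def by blast
    have "dfun N (\<lambda>y. gN y (Y y) (Z y)) (F p) w
        = gN (F p) (nablaN (F p) w Y) (Z (F p)) + gN (F p) (Y (F p)) (nablaN (F p) w Z)" for w
      using lc that map_points[OF p] unfolding levi_civita_def by blast
    then show ?thesis
      unfolding MC_def
      using section_compose[OF that(1)] section_compose[OF that(2)] smooth_fun_compose[OF h]
        dfun_compose[OF h p, of v] DZ[OF that(1)] DZ[OF that(2)] by simp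
  qed
  have sum: "MC (\<lambda>q. \<Sum>i\<in>I. S i q *\<^sub>R Z i (F q)) t"
    if "finite I" "I \<noteq> {}" "\<And>i. i \<in> I \<Longrightarrow> smooth_fun M (S i)" "\<And>i. i \<in> I \<Longrightarrow> MC (\<lambda>q. Z i (F q)) t"
    for I :: "'f set" and S Z t
    using that
  proof (induction I rule: finite_ne_induct)
    case (singleton i)
    then show ?case using scale by simp
  next
    case (insert i I)
    then have "MC (\<lambda>q. S i q *\<^sub>R Z i (F q) + (\<Sum>i\<in>I. S i q *\<^sub>R Z i (F q))) t"
      by (intro add scale) auto
    then show ?case using insert by simp
  qed
  obtain A a where A: "chart_at M p = (A, a)" by (cases "chart_at M p") auto
  obtain B b where B: "chart_at N (F p) = (B, b)" by (cases "chart_at N (F p)") auto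
  obtain S Y T where SY: "\<forall>i. smooth_fun M (S i)" "\<forall>i. vector_field N (Y i)" "\<forall>i. Y i (F p) = i"
    and T: "openin (mtop M) T" "p \<in> T" "T \<subseteq> A \<inter> F -` B" "\<forall>q\<in>T. s q = (\<Sum>i\<in>Basis. S i q *\<^sub>R Y i (F q))"
      "\<forall>q\<in>T. \<forall>i\<in>Basis. S i q = tcomp N (B, b) (F q) (s q) \<bullet> i"
    by (rule section_expansion[OF s p A B]) (rule that)
  obtain S' Y' T' where SY': "\<forall>i. smooth_fun M (S' i)" "\<forall>i. vector_field N (Y' i)" "\<forall>i. Y' i (F p) = i"
    and T': "openin (mtop M) T'" "p \<in> T'" "T' \<subseteq> A \<inter> F -` B" "\<forall>q\<in>T'. t q = (\<Sum>i\<in>Basis. S' i q *\<^sub>R Y' i (F q))"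
      "\<forall>q\<in>T'. \<forall>i\<in>Basis. S' i q = tcomp N (B, b) (F q) (t q) \<bullet> i"
    by (rule section_expansion[OF t p A B]) (rule that)
  note SY = SY[rule_format] and SY' = SY'[rule_format]
    and T = T(1,2) T(4)[rule_format] and T' = T'(1,2) T'(4)[rule_format]
  let ?s = "\<lambda>q. \<Sum>i\<in>Basis. S i q *\<^sub>R Y i (F q)" and ?t = "\<lambda>q. \<Sum>i\<in>Basis. S' i q *\<^sub>R Y' i (F q)"
  have "MC (\<lambda>q. Y i (F q)) ?t" for i
    by (rule sym[OF sum[OF finite_Basis _ SY'(1) sym[OF base[OF SY(2) SY'(2)]]]]) simp
  then have MC: "MC ?s ?t"
    by (intro sum finite_Basis SY(1)) simp_all
  have sec: "section_along M N F ?s" "section_along M N F ?t" using MC MC_def by blast+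
  have Ds: "D p v s = D p v ?s" by (rule connection_local[OF conn T s sec(1)])
  have Dt: "D p v t = D p v ?t" by (rule connection_local[OF conn T' t sec(2)])
  \<comment> \<open>\<open>?s\<close> and \<open>?t\<close> agree with \<open>s\<close> and \<open>t\<close> near \<open>p\<close> only, hence the product is constant only there\<close>
  have "dfun M (\<lambda>q. gN (F q) (?s q) (?t q)) p v = dfun M (\<lambda>_. k) p v"
  proof (rule M.dfun_cong)
    show "smooth_fun M (\<lambda>q. gN (F q) (?s q) (?t q))" using MC unfolding MC_def by (elim conjE)
    show "openin (mtop M) (T \<inter> T')" using T T' by blast
    fix q assume q: "q \<in> T \<inter> T'"
    then have "q \<in> points M" using openin_subset[OF T(1)] by blast
    with q show "gN (F q) (?s q) (?t q) = k" using T(3)[of q] T'(3)[of q] const[of q] by simp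
  qed (use T T' in blast)
  then show ?thesis
    using MC T(3)[OF T(2)] T'(3)[OF T'(2)] unfolding MC_def Ds Dt by (simp add: M.dfun_const)
qed

section \<open>Vertical extensions of vertical vectors\<close>

text \<open>In coordinates \<open>dF\<close> is the derivative of a smooth map and \<open>v\<close> lies in its kernel. A local field in the
  kernel is cut off to a global one, and all its values remain multiples of vertical vectors.\<close>

lemma vertical_extension:
  assumes p: "p \<in> points M" and surj: "surj (dmap M N F p)" and v: "v \<in> vertical_space M N F p"
  shows "\<exists>W. vertical_field M N F W \<and> W p = v"
proof -
  obtain A a where A: "chart_at M p = (A, a)" "(A, a) \<in> atlas M" "p \<in> A"
    using M.obtain_chart_at[OF p] .
  obtain B b where B: "chart_at N (F p) = (B, b)" "(B, b) \<in> atlas N" "F p \<in> B"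
    using N.obtain_chart_at[OF map_points[OF p]] .
  note AB = A(2) B(2)
  let ?f = "b \<circ> F \<circ> chart_inv (A, a)"
  have df: "frechet_derivative ?f (at (a p)) = dmap M N F p"
    by (simp add: dmap_def[abs_def] A B)
  have "a p \<in> a ` (A \<inter> F -` B)" using A B by blast
  then obtain S w where w: "open S" "a p \<in> S" "S \<subseteq> a ` (A \<inter> F -` B)" "smooth_on S w" "w (a p) = v"
    "\<And>x. x \<in> S \<Longrightarrow> frechet_derivative ?f (at x) (w x) = 0"
    using kernel_field[OF chart_overlap(2)[OF AB] _ chart_overlap(3)[OF AB], of "a p" v] surj v
    unfolding df vertical_space_def by blast
  have SA: "S \<subseteq> a ` A" using w(3) by blast
  from M.extend_field[OF A(2,3) w(1,2) SA w(4)]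
  obtain X T where X: "vector_field M X" "p \<in> T" "\<forall>q\<in>T. tcomp M (A, a) q (X q) = w (a q)"
    "\<forall>q. X q = 0 \<or> q \<in> A \<and> a q \<in> S \<and> (\<exists>r. tcomp M (A, a) q (X q) = r *\<^sub>R w (a q))"
    by (elim exE conjE) (rule that)
  have "dmap M N F q (X q) = 0" if q: "q \<in> points M" for q
    using X(4)[rule_format, of q]
  proof
    assume "X q = 0" then show ?thesis using linear_0[OF dmap_linear[OF q]] by simp
  next
    assume "q \<in> A \<and> a q \<in> S \<and> (\<exists>r. tcomp M (A, a) q (X q) = r *\<^sub>R w (a q))"
    then obtain r where r: "q \<in> A" "a q \<in> S" "tcomp M (A, a) q (X q) = r *\<^sub>R w (a q)" by blast
    then obtain q' where "q' \<in> A" "F q' \<in> B" "a q = a q'" using w(3) by blast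
    then have FqB: "F q \<in> B" using M.chart_inj[OF A(2)] r(1) by (metis inj_onD)
    have "a q \<in> a ` (A \<inter> F -` B)" using r(1) FqB by blast
    then have "tcomp N (B, b) (F q) (dmap M N F q (X q)) = 0"
      using w(6)[OF r(2)] linear_scale[OF smooth_on_linear_deriv[OF chart_overlap(3)[OF AB]]]
      unfolding tcomp_dmap[OF AB r(1) FqB] r(3) by simp
    then show ?thesis
      using N.tcomp_inj[OF B(2) FqB] linear_0[OF N.tcomp_linear[OF B(2) FqB]] by metis
  qed
  moreover have "X p = v"
    using X(3)[rule_format, OF X(2)] w(5) M.tcomp_chart_at[OF p A(1)] by simp
  ultimately show ?thesis
    using X(1) unfolding vertical_field_def vertical_space_def by blast
qed

end

section \<open>The geometry of the submersion\<close>

locale sasakian_submersion =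
  fixes M :: "('a, 'e::euclidean_space) manifold"
    and N :: "('b, 'f::euclidean_space) manifold"
    and \<phi> :: "'a \<Rightarrow> 'e \<Rightarrow> 'e" and \<xi> :: "'a \<Rightarrow> 'e" and \<eta> :: "'a \<Rightarrow> 'e \<Rightarrow> real"
    and gM :: "'a \<Rightarrow> 'e \<Rightarrow> 'e \<Rightarrow> real" and gN :: "'b \<Rightarrow> 'f \<Rightarrow> 'f \<Rightarrow> real"
    and nablaM :: "'a \<Rightarrow> 'e \<Rightarrow> ('a \<Rightarrow> 'e) \<Rightarrow> 'e"
    and nablaN :: "'b \<Rightarrow> 'f \<Rightarrow> ('b \<Rightarrow> 'f) \<Rightarrow> 'f"
    and nablaF :: "'a \<Rightarrow> 'e \<Rightarrow> ('a \<Rightarrow> 'f) \<Rightarrow> 'f"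
    and F :: "'a \<Rightarrow> 'b"
  assumes sasakian: "sasakian_manifold M \<phi> \<xi> \<eta> gM nablaM"
    and riemannian_N: "riemannian_manifold N gN"
    and levi_civita_N: "levi_civita N gN nablaN"
    and submersion: "riemannian_submersion M gM N gN F"
    and pullback: "pullback_connection M N F nablaN nablaF"
    and anti_invariant: "anti_invariant M \<phi> gM N F"
    and decomposition: "\<And>p. p \<in> points M \<Longrightarrow>
           orth_direct_sum (gM p) (horizontal_space M N F gM p)
             (\<phi> p ` vertical_space M N F p) (span {\<xi> p})"
begin

lemma riemannian_M: "riemannian_manifold M gM"
  and levi_civita_M: "levi_civita M gM nablaM"
  and tensor_phi: "tensor_field_11 M \<phi>"
  and vector_field_xi: "vector_field M \<xi>"
  and one_form_eta: "one_form M \<eta>"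
  using sasakian unfolding sasakian_manifold_def by blast+

lemma phi_phi: "p \<in> points M \<Longrightarrow> \<phi> p (\<phi> p v) = - v + \<eta> p v *\<^sub>R \<xi> p"
  and phi_xi: "p \<in> points M \<Longrightarrow> \<phi> p (\<xi> p) = 0"
  and eta_phi: "p \<in> points M \<Longrightarrow> \<eta> p (\<phi> p v) = 0"
  and eta_xi: "p \<in> points M \<Longrightarrow> \<eta> p (\<xi> p) = 1"
  and metric_phi_phi: "p \<in> points M \<Longrightarrow> gM p (\<phi> p v) (\<phi> p w) = gM p v w - \<eta> p v * \<eta> p w"
  and eta_eq: "p \<in> points M \<Longrightarrow> \<eta> p v = gM p v (\<xi> p)"
  using sasakian unfolding sasakian_manifold_def by blast+

lemma nabla_phi:
  "vector_field M X \<Longrightarrow> vector_field M Y \<Longrightarrow> p \<in> points M \<Longrightarrow>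
    nablaM p (X p) (\<lambda>q. \<phi> q (Y q)) - \<phi> p (nablaM p (X p) Y) = gM p (X p) (Y p) *\<^sub>R \<xi> p - \<eta> p (Y p) *\<^sub>R X p"
  using sasakian unfolding sasakian_manifold_def by blast

sublocale smooth_mfd_map M N F
  using riemannian_M riemannian_N submersion
  by unfold_locales (auto simp: riemannian_manifold_def riemannian_submersion_def)

text \<open>Vector fields are sections along the identity.\<close>

sublocale I: smooth_mfd_map M M "\<lambda>p. p"
  by (rule M.identity_map)

lemma conn_M: "connection_along M M (\<lambda>p. p) nablaM"
  using levi_civita_M unfolding levi_civita_def affine_connection_def by blast

lemma conn_F: "connection_along M N F nablaF"
  using pullback unfolding pullback_connection_def by blast

lemma inner_M: "p \<in> points M \<Longrightarrow> inner_form (gM p)"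
  by (rule riemannian_inner_form[OF riemannian_M])

lemma inner_N: "p \<in> points M \<Longrightarrow> inner_form (gN (F p))"
  by (rule riemannian_inner_form[OF riemannian_N map_points])

lemmas bilin_M = bilinear_simps[OF inner_form_bilinear[OF inner_M]]
lemmas bilin_N = bilinear_simps[OF inner_form_bilinear[OF inner_N]]
lemmas sym_M = inner_form_sym[OF inner_M]

lemma phi_linear: "p \<in> points M \<Longrightarrow> linear (\<phi> p)"
  using tensor_phi unfolding tensor_field_11_def by blast

lemma phi_field: "vector_field M X \<Longrightarrow> vector_field M (\<lambda>q. \<phi> q (X q))"
  using tensor_phi unfolding tensor_field_11_def by blast

lemma nabla_metric:
  assumes "vector_field M Y" "vector_field M Z" "p \<in> points M"
    and const: "\<And>q. q \<in> points M \<Longrightarrow> gM q (Y q) (Z q) = k"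
  shows "gM p (nablaM p v Y) (Z p) = - gM p (Y p) (nablaM p v Z)"
proof -
  have sm: "smooth_fun M (\<lambda>q. gM q (Y q) (Z q))"
    using riemannian_M assms(1,2) unfolding riemannian_manifold_def by blast
  have "dfun M (\<lambda>q. gM q (Y q) (Z q)) p v = dfun M (\<lambda>_. k) p v"
    by (rule M.dfun_cong[OF sm openin_topspace assms(3) const])
  moreover have "dfun M (\<lambda>q. gM q (Y q) (Z q)) p v = gM p (nablaM p v Y) (Z p) + gM p (Y p) (nablaM p v Z)"
    using levi_civita_M assms unfolding levi_civita_def by blast
  ultimately show ?thesis by (simp add: M.dfun_const)
qed

text \<open>Applying the Sasakian identity to \<open>\<phi>\<xi> = 0\<close> determines \<open>\<phi>(\<nabla>\<^sub>X \<xi>)\<close>, and \<open>\<phi>\<close> loses only the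
  component along \<open>\<xi>\<close>, which vanishes because \<open>\<xi>\<close> has constant length.\<close>

lemma nabla_xi:
  assumes X: "vector_field M X" and p: "p \<in> points M"
  shows "nablaM p (X p) \<xi> = - \<phi> p (X p)"
proof -
  let ?n = "nablaM p (X p) \<xi>"
  have "nablaM p (X p) (\<lambda>q. \<phi> q (\<xi> q)) = 0"
    by (rule I.connection_zero[OF conn_M p phi_xi])
  then have 1: "\<phi> p ?n = X p - \<eta> p (X p) *\<^sub>R \<xi> p"
    using nabla_phi[OF X vector_field_xi p] eta_xi[OF p] eta_eq[OF p, of "X p"] by (simp add: algebra_simps)
  have "gM p ?n (\<xi> p) = - gM p (\<xi> p) ?n"
    by (rule nabla_metric[OF vector_field_xi vector_field_xi p, where k = 1])
      (simp add: eta_eq[symmetric] eta_xi)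
  then have "\<eta> p ?n = 0"
    using sym_M[OF p, of ?n "\<xi> p"] eta_eq[OF p, of ?n] by simp
  then have "- ?n = \<phi> p (\<phi> p ?n)" using phi_phi[OF p, of ?n] by simp
  also have "\<dots> = \<phi> p (X p)"
    unfolding 1 by (simp add: linear_diff[OF phi_linear[OF p]] linear_scale[OF phi_linear[OF p]] phi_xi[OF p])
  finally show ?thesis by (metis minus_minus)
qed

lemma vertical_subspace: "p \<in> points M \<Longrightarrow> subspace (vertical_space M N F p)"
  unfolding vertical_space_def by (rule linear_subspace_kernel[OF dmap_linear])

lemma horizontal_subspace: "p \<in> points M \<Longrightarrow> subspace (horizontal_space M N F gM p)"
  unfolding horizontal_space_def subspace_def by (simp add: bilin_M)

lemma xi_horizontal:
  assumes "p \<in> points M"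
  shows "\<xi> p \<in> horizontal_space M N F gM p"
proof -
  have "\<phi> p 0 = 0" "0 \<in> vertical_space M N F p"
    using linear_0[OF phi_linear[OF assms]] subspace_0[OF vertical_subspace[OF assms]] by auto
  then have "0 \<in> \<phi> p ` vertical_space M N F p" by force
  moreover have "\<xi> p = 0 + \<xi> p" "\<xi> p \<in> span {\<xi> p}" by (auto intro: span_base)
  ultimately show ?thesis
    using decomposition[OF assms] unfolding orth_direct_sum_def by blast
qed

lemma phi_vertical_horizontal:
  "p \<in> points M \<Longrightarrow> v \<in> vertical_space M N F p \<Longrightarrow> \<phi> p v \<in> horizontal_space M N F gM p"
  using anti_invariant unfolding anti_invariant_def by blast

lemma horizontal_vertical_orth:
  "p \<in> points M \<Longrightarrow> h \<in> horizontal_space M N F gM p \<Longrightarrow> v \<in> vertical_space M N F p \<Longrightarrow> gM p h v = 0"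
  unfolding horizontal_space_def by blast

lemma eta_vertical: "p \<in> points M \<Longrightarrow> v \<in> vertical_space M N F p \<Longrightarrow> \<eta> p v = 0"
  using horizontal_vertical_orth[OF _ xi_horizontal] eta_eq sym_M by metis

text \<open>Polarisation of the preservation of lengths.\<close>

lemma submersion_isometry_horizontal:
  assumes p: "p \<in> points M" and v: "v \<in> horizontal_space M N F gM p" and w: "w \<in> horizontal_space M N F gM p"
  shows "gN (F p) (dmap M N F p v) (dmap M N F p w) = gM p v w"
proof -
  have quad: "gN (F p) (dmap M N F p u) (dmap M N F p u) = gM p u u" if "u \<in> horizontal_space M N F gM p" for u
    using submersion p that unfolding riemannian_submersion_def by (metis real_sqrt_eq_iff)
  have "v + w \<in> horizontal_space M N F gM p"
    using subspace_add[OF horizontal_subspace[OF p] v w] .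
  from quad[OF this] show ?thesis
    using quad[OF v] quad[OF w] sym_M[OF p, of w v]
      inner_form_sym[OF inner_N[OF p], of "dmap M N F p w" "dmap M N F p v"]
    by (simp add: linear_add[OF dmap_linear[OF p]] bilin_M[OF p] bilin_N[OF p])
qed

text \<open>One horizontal argument is enough, because the vertical part of the other one
  contributes to neither side.\<close>

lemma submersion_isometry:
  assumes p: "p \<in> points M" and w: "w \<in> horizontal_space M N F gM p"
  shows "gN (F p) (dmap M N F p u) (dmap M N F p w) = gM p u w"
    and "gN (F p) (dmap M N F p w) (dmap M N F p u) = gM p w u"
proof -
  let ?v = "orth_proj (gM p) (vertical_space M N F p) u"
  have v: "?v \<in> vertical_space M N F p" "\<And>x. x \<in> vertical_space M N F p \<Longrightarrow> gM p (u - ?v) x = 0"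
    using orth_proj[OF inner_M[OF p] vertical_subspace[OF p]] by blast+
  then have h: "u - ?v \<in> horizontal_space M N F gM p" unfolding horizontal_space_def by blast
  have "dmap M N F p ?v = 0" using v(1) unfolding vertical_space_def by blast
  then have "dmap M N F p u = dmap M N F p (u - ?v)"
    by (simp add: linear_diff[OF dmap_linear[OF p]])
  moreover have "gM p ?v w = 0"
    using horizontal_vertical_orth[OF p w v(1)] sym_M[OF p] by metis
  ultimately show *: "gN (F p) (dmap M N F p u) (dmap M N F p w) = gM p u w"
    using submersion_isometry_horizontal[OF p h w] by (simp add: bilin_M[OF p])
  then show "gN (F p) (dmap M N F p w) (dmap M N F p u) = gM p w u"
    using sym_M[OF p] inner_form_sym[OF inner_N[OF p]] by metis
qed

lemma vertical_fieldD:
  assumes "vertical_field M N F W"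
  shows "vector_field M W" "p \<in> points M \<Longrightarrow> W p \<in> vertical_space M N F p"
    "p \<in> points M \<Longrightarrow> dmap M N F p (W p) = 0"
  using assms unfolding vertical_field_def vertical_space_def by auto

lemma nabla_phiW_xi:
  assumes W: "vertical_field M N F W" and p: "p \<in> points M"
  shows "nablaM p (\<phi> p (W p)) \<xi> = W p"
  using nabla_xi[OF phi_field[OF vertical_fieldD(1)[OF W]] p] phi_phi[OF p]
    eta_vertical[OF p vertical_fieldD(2)[OF W p]] by simp

text \<open>The quantity that makes total geodesy fail: the derivative of \<open>g(W, \<xi>) = 0\<close> along \<open>\<phi>W\<close>.\<close>

lemma metric_nabla_phiW_W_xi:
  assumes W: "vertical_field M N F W" and p: "p \<in> points M"
  shows "gM p (nablaM p (\<phi> p (W p)) W) (\<xi> p) = - gM p (W p) (W p)"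
proof -
  have "gM p (nablaM p (\<phi> p (W p)) W) (\<xi> p) = - gM p (W p) (nablaM p (\<phi> p (W p)) \<xi>)"
    by (rule nabla_metric[OF vertical_fieldD(1)[OF W] vector_field_xi p, of 0])
      (use eta_eq eta_vertical vertical_fieldD(2)[OF W] in metis)
  then show ?thesis using nabla_phiW_xi[OF W p] by simp
qed

section \<open>Both conditions force the vertical spaces to vanish\<close>

text \<open>Total geodesy makes \<open>\<nabla>\<^bsub>\<phi>W\<^esub> W\<close> vertical, hence orthogonal to \<open>\<xi>\<close>.\<close>

lemma totally_geodesic_vertical_zero:
  assumes tg: "totally_geodesic_map M N F nablaM nablaF" and W: "vertical_field M N F W" and p: "p \<in> points M"
  shows "W p = 0"
proof -
  let ?n = "nablaM p (\<phi> p (W p)) W"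
  have "second_fundamental_form M N F nablaM nablaF (\<lambda>q. \<phi> q (W q)) W p = 0"
    using tg phi_field vertical_fieldD(1)[OF W] p unfolding totally_geodesic_map_def by blast
  moreover have "nablaF p (\<phi> p (W p)) (\<lambda>q. dmap M N F q (W q)) = 0"
    by (rule connection_zero[OF conn_F p vertical_fieldD(3)[OF W]])
  ultimately have "?n \<in> vertical_space M N F p"
    by (simp add: second_fundamental_form_def vertical_space_def)
  then have "gM p ?n (\<xi> p) = 0"
    using horizontal_vertical_orth[OF p xi_horizontal[OF p]] sym_M[OF p] by metis
  then show ?thesis
    using metric_nabla_phiW_W_xi[OF W p] inner_form_eq_0[OF inner_M[OF p]] by simp
qed

lemma hproj_horizontal: "p \<in> points M \<Longrightarrow> v \<in> horizontal_space M N F gM p \<Longrightarrow> hproj M N F gM p v = v"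
  unfolding hproj_def by (rule orth_proj_member[OF inner_M horizontal_subspace])

lemma vproj_horizontal: "p \<in> points M \<Longrightarrow> v \<in> horizontal_space M N F gM p \<Longrightarrow> vproj M N F gM p v = 0"
  unfolding vproj_def by (rule orth_proj_orthogonal[OF inner_M vertical_subspace])
    (auto intro: horizontal_vertical_orth)

lemma proj_zero:
  assumes "p \<in> points M"
  shows "hproj M N F gM p 0 = 0" "vproj M N F gM p 0 = 0"
  using hproj_horizontal[OF assms] vproj_horizontal[OF assms] subspace_0[OF horizontal_subspace[OF assms]] by auto

lemma oneill_zero:
  assumes "\<And>q. q \<in> points M \<Longrightarrow> G q = 0" and p: "p \<in> points M"
  shows "oneill_T M N F gM nablaM E G p = 0" "oneill_A M N F gM nablaM E G p = 0"
proof -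
  have z: "nablaM p v (\<lambda>q. vproj M N F gM q (G q)) = 0" "nablaM p v (\<lambda>q. hproj M N F gM q (G q)) = 0" for v
    by (rule I.connection_zero[OF conn_M p], simp add: assms(1) proj_zero)+
  show "oneill_T M N F gM nablaM E G p = 0" "oneill_A M N F gM nablaM E G p = 0"
    by (simp_all add: oneill_T_def oneill_A_def Let_def z proj_zero[OF p])
qed

text \<open>For a horizontal field the sections under the derivatives are \<open>G\<close> itself and zero.\<close>

lemma oneill_A_horizontal:
  assumes X: "X p \<in> horizontal_space M N F gM p"
    and G: "vector_field M G" "\<And>q. q \<in> points M \<Longrightarrow> G q \<in> horizontal_space M N F gM q"
    and p: "p \<in> points M"
  shows "oneill_A M N F gM nablaM X G p = vproj M N F gM p (nablaM p (X p) G)"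
proof -
  have "nablaM p v G = nablaM p v (\<lambda>q. hproj M N F gM q (G q))" for v
    by (rule I.connection_cong[OF conn_M p]) (use G hproj_horizontal in \<open>auto simp: vector_field_def\<close>)
  moreover have "nablaM p v (\<lambda>q. vproj M N F gM q (G q)) = 0" for v
    by (rule I.connection_zero[OF conn_M p]) (use G vproj_horizontal in auto)
  ultimately show ?thesis
    by (simp add: oneill_A_def Let_def hproj_horizontal[OF p X] proj_zero[OF p])
qed

text \<open>A vertical field \<open>W\<close> preserves the pulled back metric on horizontal fields. For the orthogonal pair
  \<open>\<xi>\<close>, \<open>\<phi>W\<close> this reads \<open>g([W, \<xi>], \<phi>W) + g(\<xi>, [W, \<phi>W]) = 0\<close>, and all four covariant derivatives that occur
  are known from \<open>\<nabla>\<^sub>Y \<xi> = -\<phi>Y\<close>, except \<open>g(\<nabla>\<^sub>\<xi> W, \<phi>W) = -g(W, \<nabla>\<^sub>\<xi> \<phi>W)\<close>, which the assumption makes zero.\<close>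

lemma oneill_A_vertical_zero:
  assumes A: "oneill_A M N F gM nablaM \<xi> (\<lambda>q. \<phi> q (W q)) p = 0"
    and W: "vertical_field M N F W" and p: "p \<in> points M"
  shows "W p = 0"
proof -
  let ?Y = "\<lambda>q. \<phi> q (W q)"
  note Wf = vertical_fieldD(1)[OF W] and Wv = vertical_fieldD(2)[OF W]
  have Yf: "vector_field M ?Y" by (rule phi_field[OF Wf])
  have Yh: "?Y q \<in> horizontal_space M N F gM q" if "q \<in> points M" for q
    by (rule phi_vertical_horizontal[OF that Wv[OF that]])
  have "vproj M N F gM p (nablaM p (\<xi> p) ?Y) = 0"
    using A oneill_A_horizontal[where X=\<xi> and G="?Y", OF xi_horizontal[OF p] Yf Yh p] by simp
  then have A': "gM p (nablaM p (\<xi> p) ?Y) (W p) = 0"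
    using orth_proj(2)[OF inner_M[OF p] vertical_subspace[OF p] Wv[OF p], of "nablaM p (\<xi> p) ?Y"]
    unfolding vproj_def by simp
  have D: "nablaF p (W p) (\<lambda>q. dmap M N F q (Z q)) = dmap M N F p (nablaM p (W p) Z - nablaM p (Z p) W)"
    if "vector_field M Z" for Z
  proof -
    have "nablaM p (W p) Z - nablaM p (Z p) W = lie_bracket M W Z p"
      using levi_civita_M Wf that p unfolding levi_civita_def by blast
    moreover have "affine_connection N nablaN"
      using levi_civita_N unfolding levi_civita_def by blast
    ultimately show ?thesis
      using pullback_torsion_vertical[OF pullback _ that W p] by simp
  qed
  have orth: "gN (F q) (dmap M N F q (\<xi> q)) (dmap M N F q (?Y q)) = 0" if "q \<in> points M" for q
    using submersion_isometry(1)[OF that Yh[OF that]] eta_phi[OF that] eta_eq[OF that] sym_M[OF that] by metis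
  \<comment> \<open>differentiate the preceding equation along \<open>W\<close> and push the result back to \<open>M\<close>\<close>
  from pullback_metric[OF pullback levi_civita_N riemannian_N dmap_section[OF vector_field_xi] dmap_section[OF Yf] p orth, of "W p"]
  have "gM p (nablaM p (W p) \<xi> - nablaM p (\<xi> p) W) (?Y p) + gM p (\<xi> p) (nablaM p (W p) ?Y - nablaM p (?Y p) W) = 0"
    unfolding D[OF vector_field_xi] D[OF Yf]
      submersion_isometry(1)[OF p Yh[OF p]] submersion_isometry(2)[OF p xi_horizontal[OF p]] .
  moreover have "gM p (nablaM p (W p) \<xi>) (?Y p) = - gM p (W p) (W p)"
    using nabla_xi[OF Wf p] metric_phi_phi[OF p, of "W p" "W p"] eta_vertical[OF p Wv[OF p]]
    by (simp add: bilin_M[OF p])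
  moreover have "gM p (nablaM p (\<xi> p) W) (?Y p) = 0"
    using nabla_metric[OF Wf Yf p, of 0 "\<xi> p"] A' horizontal_vertical_orth[OF _ Yh Wv] sym_M p by (metis neg_equal_zero add.inverse_neutral)
  moreover have "gM p (\<xi> p) (nablaM p (W p) ?Y) = gM p (W p) (W p)"
  proof -
    have "gM p (nablaM p (W p) \<xi>) (?Y p) = - gM p (\<xi> p) (nablaM p (W p) ?Y)"
      by (rule nabla_metric[OF vector_field_xi Yf p, of 0]) (use eta_phi eta_eq sym_M in metis)
    then show ?thesis using calculation(2) by simp
  qed
  moreover have "gM p (\<xi> p) (nablaM p (?Y p) W) = - gM p (W p) (W p)"
    using metric_nabla_phiW_W_xi[OF W p] sym_M[OF p] by metis
  ultimately have "gM p (W p) (W p) = 0" by (simp add: bilin_M[OF p])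
  then show ?thesis using inner_form_eq_0[OF inner_M[OF p]] by blast
qed

text \<open>Without vertical vectors \<open>\<xi>\<close> spans the tangent spaces, so by the Leibniz rule only \<open>\<xi>\<close> has to be
  examined. It is parallel because \<open>\<phi>\<xi> = 0\<close>, and \<open>F\<^sub>*\<xi>\<close> is parallel because its derivative is a multiple of
  it and orthogonal to it.\<close>

lemma totally_geodesic_if_no_vertical:
  assumes V: "\<And>q. q \<in> points M \<Longrightarrow> vertical_space M N F q = {0}"
  shows "totally_geodesic_map M N F nablaM nablaF"
  unfolding totally_geodesic_map_def
proof (intro allI impI ballI)
  fix X Y p
  assume "vector_field M X \<and> vector_field M Y" and p: "p \<in> points M"
  then have X: "vector_field M X" and Y: "vector_field M Y" by auto
  let ?s = "\<lambda>q. dmap M N F q (\<xi> q)"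
  have multiple: "v = \<eta> q v *\<^sub>R \<xi> q" if q: "q \<in> points M" for q v
  proof -
    have "v \<in> horizontal_space M N F gM q"
      using V[OF q] by (simp add: horizontal_space_def bilin_M[OF q])
    then have "v \<in> span {\<xi> q}"
      using decomposition[OF q] linear_0[OF phi_linear[OF q]]
      unfolding orth_direct_sum_def V[OF q] by auto
    then obtain k where "v = k *\<^sub>R \<xi> q" by (auto simp: span_singleton)
    then show ?thesis
      using eta_xi[OF q] by (simp add: eta_eq[OF q] bilin_M[OF q])
  qed
  have unit: "gN (F q) (?s q) (?s q) = 1" if "q \<in> points M" for q
    using submersion_isometry_horizontal[OF that xi_horizontal[OF that] xi_horizontal[OF that]]
      eta_xi[OF that] eta_eq[OF that] by simp
  have sec: "section_along M N F ?s" by (rule dmap_section[OF vector_field_xi])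
  let ?D = "nablaF p (X p) ?s"
  have "gN (F p) ?D (?s p) + gN (F p) (?s p) ?D = 0"
    by (rule pullback_metric[OF pullback levi_civita_N riemannian_N sec sec p unit])
  then have orth: "gN (F p) ?D (?s p) = 0"
    using inner_form_sym[OF inner_N[OF p], of "?s p" ?D] by simp
  obtain u where u: "?D = dmap M N F p u"
    using submersion p unfolding riemannian_submersion_def by (metis surjD)
  have Du: "?D = \<eta> p u *\<^sub>R ?s p"
    unfolding u by (subst multiple[OF p, of u]) (simp add: linear_scale[OF dmap_linear[OF p]])
  with orth have "\<eta> p u = 0" using unit[OF p] by (simp add: bilin_N[OF p])
  then have D0: "?D = 0" using Du by simp
  have "\<phi> p (X p) = 0"
    by (subst multiple[OF p, of "X p"]) (simp add: linear_scale[OF phi_linear[OF p]] phi_xi[OF p])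
  then have n0: "nablaM p (X p) \<xi> = 0" using nabla_xi[OF X p] by simp
  define f where "f = (\<lambda>q. \<eta> q (Y q))"
  have f: "smooth_fun M f" using one_form_eta Y unfolding one_form_def f_def by blast
  have "nablaM p (X p) Y = nablaM p (X p) (\<lambda>q. f q *\<^sub>R \<xi> q)"
    by (rule I.connection_cong[OF conn_M p]) (use Y multiple in \<open>auto simp: vector_field_def f_def\<close>)
  also have "\<dots> = dfun M f p (X p) *\<^sub>R \<xi> p"
    using I.connection_scale[OF conn_M p f, of \<xi>] vector_field_xi n0 by (simp add: vector_field_def)
  finally have nY: "nablaM p (X p) Y = dfun M f p (X p) *\<^sub>R \<xi> p" .
  have "nablaF p (X p) (\<lambda>q. dmap M N F q (Y q)) = nablaF p (X p) (\<lambda>q. f q *\<^sub>R ?s q)"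
  proof (rule connection_cong[OF conn_F p dmap_section[OF Y]])
    fix q assume q: "q \<in> points M"
    show "dmap M N F q (Y q) = f q *\<^sub>R ?s q"
      unfolding f_def by (subst multiple[OF q, of "Y q"]) (simp add: linear_scale[OF dmap_linear[OF q]])
  qed
  also have "\<dots> = dfun M f p (X p) *\<^sub>R ?s p"
    using connection_scale[OF conn_F p f sec] D0 by simp
  finally show "second_fundamental_form M N F nablaM nablaF X Y p = 0"
    by (simp add: second_fundamental_form_def nY linear_scale[OF dmap_linear[OF p]])
qed

end

section \<open>The characterisation of totally geodesic maps\<close>

theorem theorem12:
  fixes M :: "('a, 'e::euclidean_space) manifold"
    and N :: "('b, 'f::euclidean_space) manifold"
    and \<phi> :: "'a \<Rightarrow> 'e \<Rightarrow> 'e" and \<xi> :: "'a \<Rightarrow> 'e" and \<eta> :: "'a \<Rightarrow> 'e \<Rightarrow> real"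
    and gM :: "'a \<Rightarrow> 'e \<Rightarrow> 'e \<Rightarrow> real" and gN :: "'b \<Rightarrow> 'f \<Rightarrow> 'f \<Rightarrow> real"
    and nablaM :: "'a \<Rightarrow> 'e \<Rightarrow> ('a \<Rightarrow> 'e) \<Rightarrow> 'e"
    and nablaN :: "'b \<Rightarrow> 'f \<Rightarrow> ('b \<Rightarrow> 'f) \<Rightarrow> 'f"
    and nablaF :: "'a \<Rightarrow> 'e \<Rightarrow> ('a \<Rightarrow> 'f) \<Rightarrow> 'f"
    and F :: "'a \<Rightarrow> 'b"
  assumes "sasakian_manifold M \<phi> \<xi> \<eta> gM nablaM"
    and "riemannian_manifold N gN"
    and "levi_civita N gN nablaN"
    and "riemannian_submersion M gM N gN F"
    and "pullback_connection M N F nablaN nablaF"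
    and "anti_invariant M \<phi> gM N F"
    and "\<And>p. p \<in> points M \<Longrightarrow>
           orth_direct_sum (gM p) (horizontal_space M N F gM p)
             (\<phi> p ` vertical_space M N F p) (span {\<xi> p})"
  shows "totally_geodesic_map M N F nablaM nablaF \<longleftrightarrow>
     (\<forall>W V. vertical_field M N F W \<and> vertical_field M N F V \<longrightarrow>
        (\<forall>p\<in>points M. oneill_T M N F gM nablaM W (\<lambda>q. \<phi> q (V q)) p = 0)) \<and>
     (\<forall>X W. horizontal_field M N F gM X \<and> vertical_field M N F W \<longrightarrow>
        (\<forall>p\<in>points M. oneill_A M N F gM nablaM X (\<lambda>q. \<phi> q (W q)) p = 0))"
    (is "_ \<longleftrightarrow> ?T \<and> ?A")
proof -
  interpret sasakian_submersion M N \<phi> \<xi> \<eta> gM gN nablaM nablaN nablaF F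
    by unfold_locales (fact assms)+
  show ?thesis
  proof
    assume tg: "totally_geodesic_map M N F nablaM nablaF"
    have "\<phi> p (W p) = 0" if "vertical_field M N F W" "p \<in> points M" for W p
      using totally_geodesic_vertical_zero[OF tg that] linear_0[OF phi_linear[OF that(2)]] by simp
    then show "?T \<and> ?A" by (simp add: oneill_zero)
  next
    assume "?T \<and> ?A"
    moreover have "horizontal_field M N F gM \<xi>"
      using vector_field_xi xi_horizontal unfolding horizontal_field_def by blast
    ultimately have A: "oneill_A M N F gM nablaM \<xi> (\<lambda>q. \<phi> q (W q)) p = 0"
      if "vertical_field M N F W" "p \<in> points M" for W p
      using that by simp
    show "totally_geodesic_map M N F nablaM nablaF"
    proof (rule totally_geodesic_if_no_vertical)
      fix q assume q: "q \<in> points M"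
      have "v = 0" if v: "v \<in> vertical_space M N F q" for v
      proof -
        have "surj (dmap M N F q)"
          using submersion q unfolding riemannian_submersion_def by blast
        from vertical_extension[OF q this v] obtain W where "vertical_field M N F W" "W q = v" by blast
        then show ?thesis using oneill_A_vertical_zero[OF A _ q] q by blast
      qed
      then show "vertical_space M N F q = {0}"
        using subspace_0[OF vertical_subspace[OF q]] by blast
    qed
  qed
qed

end
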